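(* Let $\Gamma\subset \mathrm{SU}((2,1),\mathbb{C})$ be a discrete, torsion-free, cocompact subgroup and let $X_\Gamma=\Gamma\backslash\mathbb{B}^2$. There is $k_0$ depending only on $X_\Gamma$ such that for every $\epsilon>0$ there is a constant $c>0$, depending only on $X_\Gamma$ and $\epsilon$, such that for all integers $k\ge k_0$, $$\sup_{z\in X_\Gamma}\bigg|\frac{\mu_{\mathrm{ber}}^{k,\mathrm{vol}}(z)}{\mu_{\mathrm{hyp}}^{\mathrm{vol}}(z)}\bigg|\le c\,k^{4+\epsilon},$$ where $\mu_{\mathrm{ber}}^{k,\mathrm{vol}}$ and $\mu_{\mathrm{hyp}}^{\mathrm{vol}}$ are the volume forms associated to the Bergman metric $\mu_{\mathrm{ber}}^k$ of $\Lambda^{\otimes k}$, $\Lambda=\Omega^2_{X_\Gamma}$, and to the hyperbolic metric $\mu_{\mathrm{hyp}}$, respectively.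
   Context: Let $\mathbb{B}^2=\{z=(z_1,z_2)^t\in\mathbb{C}^2: |z|^2=|z_1|^2+|z_2|^2<1\}$ and $H=\mathrm{diag}(1,1,-1)$. $\mathrm{SU}((2,1),\mathbb{C})=\{A\in\mathrm{SL}(3,\mathbb{C}): A^*HA=H\}$. An element $\gamma=\begin{pmatrix}A&B\\C&D\end{pmatrix}$ ($A$ of size $2\times2$, $B$ of size $2\times 1$, $C$ of size $1\times 2$, $D\in\mathbb{C}$) acts on $\mathbb{B}^2$ by $\gamma z=(Az+B)/(Cz+D)$. The group $\Gamma$ is discrete, torsion-free and cocompact, so $X_\Gamma=\Gamma\backslash\mathbb{B}^2$ is a compact complex surface. The hyperbolic metric is $\mu_{\mathrm{hyp}}(z)=-\frac{i}{2}\partial\overline\partial\log(1-|z|^2)$, with volume form $\mu_{\mathrm{hyp}}^{\mathrm{vol}}(z)=(\frac i2)^2\frac{dz_1\wedge d\overline{z_1}\wedge dz_2\wedge d\overline{z_2}}{(1-|z|^2)^3}$. $\Lambda=\Omega^2_{X_\Gamma}$ is the line bundle of holomorphic $(2,0)$-forms. $\mathcal{S}_m(\Gamma)$ is the space of holomorphic $f:\mathbb{B}^2\to\mathbb{C}$ with $f(\gamma z)=(Cz+D)^mf(z)$ for all $\gamma\in\Gamma$. Sections of $\Lambda^{\otimes k}$ are $\omega=f\,(dz_1\wedge dz_2)^{\otimes k}$ with $f\in\mathcal{S}_{3k}(\Gamma)$; the pointwise norm is $|\omega(z)|^2_{\mathrm{hyp}}=(1-|z|^2)^{3k}|f(z)|^2$,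 and the $L^2$ inner product is $\langle\omega,\eta\rangle_{\mathrm{hyp}}=\int_{\mathcal{F}_\Gamma}(1-|z|^2)^{3k}f(z)\overline{g(z)}\,\mu_{\mathrm{hyp}}^{\mathrm{vol}}(z)$ for $\eta=g\,(dz_1\wedge dz_2)^{\otimes k}$, with $\mathcal{F}_\Gamma$ a fundamental domain. For an orthonormal basis $\omega_j=f_j\,(dz_1\wedge dz_2)^{\otimes k}$ of $H^0(X_\Gamma,\Lambda^{\otimes k})$, the Bergman kernel is $\mathcal{B}_\Lambda^k(z,w)=\sum_j\omega_j(z)\overline{\omega_j(w)}$, and on the diagonal $|\mathcal{B}_\Lambda^k(z,z)|_{\mathrm{hyp}}=(1-|z|^2)^{3k}\sum_j|f_j(z)|^2$. The Bergman metric is $\mu_{\mathrm{ber}}^k(z)=-\frac{i}{2\pi}\partial\overline\partial\log|\mathcal{B}_\Lambda^k(z,z)|_{\mathrm{hyp}}$, and its volume form is $\mu_{\mathrm{ber}}^{k,\mathrm{vol}}=\frac{1}{2!}\,\mu_{\mathrm{ber}}^k\wedge\mu_{\mathrm{ber}}^k$. *)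

theory Defs
  imports "HOL-Analysis.Analysis" "HOL-Algebra.Group"
begin

section \<open>The group $SU((2,1),C)$ and its action on the ball\<close>

text \<open>
  The ball is \<^term>\<open>ball 0 1 :: (complex^2) set\<close>; the norm of \<^typ>\<open>complex^2\<close> is the
  Hermitian one.
\<close>

definition conj_transpose :: "complex^'n^'m \<Rightarrow> complex^'m^'n" where
  "conj_transpose A = (\<chi> i j. cnj (A $ j $ i))"

definition H21 :: "complex^3^3" where
  "H21 = (\<chi> i j. if i = j then (if i = 3 then - 1 else 1) else 0)"

definition SU21 :: "(complex^3^3) monoid" where
  "SU21 = \<lparr>carrier = {A. det A = 1 \<and> conj_transpose A ** H21 ** A = H21},
           mult = (**), one = mat 1\<rparr>"

definition autfactor :: "complex^3^3 \<Rightarrow> complex^2 \<Rightarrow> complex" where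
  "autfactor \<gamma> z = \<gamma>$3$1 * z$1 + \<gamma>$3$2 * z$2 + \<gamma>$3$3"

definition act :: "complex^3^3 \<Rightarrow> complex^2 \<Rightarrow> complex^2" where
  "act \<gamma> z = vector
     [(\<gamma>$1$1 * z$1 + \<gamma>$1$2 * z$2 + \<gamma>$1$3) / autfactor \<gamma> z,
      (\<gamma>$2$1 * z$1 + \<gamma>$2$2 * z$2 + \<gamma>$2$3) / autfactor \<gamma> z]"

definition torsion_free :: "(complex^3^3) set \<Rightarrow> bool" where
  "torsion_free \<Gamma> \<longleftrightarrow>
     (\<forall>\<gamma>\<in>\<Gamma>. \<forall>n::nat. n > 0 \<and> \<gamma> [^]\<^bsub>SU21\<^esub> n = \<one>\<^bsub>SU21\<^esub> \<longrightarrow> \<gamma> = \<one>\<^bsub>SU21\<^esub>)"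

definition orbit :: "(complex^3^3) set \<Rightarrow> complex^2 \<Rightarrow> (complex^2) set" where
  "orbit \<Gamma> z = (\<lambda>\<gamma>. act \<gamma> z) ` \<Gamma>"

text \<open>The orbit space of the ball, with the quotient topology.\<close>

definition quotient_space :: "(complex^3^3) set \<Rightarrow> (complex^2) set topology" where
  "quotient_space \<Gamma> = topology (\<lambda>U. U \<subseteq> orbit \<Gamma> ` ball 0 1 \<and>
     openin (top_of_set (ball 0 1)) {z \<in> ball 0 1. orbit \<Gamma> z \<in> U})"

lemma openin_quotient_space:
  "openin (quotient_space \<Gamma>) U \<longleftrightarrow> U \<subseteq> orbit \<Gamma> ` ball 0 1 \<and>
     openin (top_of_set (ball 0 1)) {z \<in> ball 0 1. orbit \<Gamma> z \<in> U}"
proof -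
  let ?P = "\<lambda>U. U \<subseteq> orbit \<Gamma> ` ball 0 1 \<and>
     openin (top_of_set (ball 0 1)) {z \<in> ball 0 1. orbit \<Gamma> z \<in> U}"
  have "?P (S \<inter> T)" if "?P S" "?P T" for S T
  proof -
    have "{z \<in> ball 0 1. orbit \<Gamma> z \<in> S \<inter> T} =
        {z \<in> ball 0 1. orbit \<Gamma> z \<in> S} \<inter> {z \<in> ball 0 1. orbit \<Gamma> z \<in> T}" by auto
    with that show ?thesis by (auto intro: openin_Int)
  qed
  moreover have "?P (\<Union>K)" if "\<forall>S\<in>K. ?P S" for K
  proof -
    have "{z \<in> ball 0 1. orbit \<Gamma> z \<in> \<Union>K} =
        (\<Union>S\<in>K. {z \<in> ball 0 1. orbit \<Gamma> z \<in> S})" by auto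
    with that show ?thesis by (auto intro!: openin_Union)
  qed
  ultimately have "istopology ?P"
    unfolding istopology_def by blast
  then show ?thesis
    unfolding quotient_space_def by (simp add: topology_inverse')
qed

lemma topspace_quotient_space: "topspace (quotient_space \<Gamma>) = orbit \<Gamma> ` ball 0 1"
proof
  show "topspace (quotient_space \<Gamma>) \<subseteq> orbit \<Gamma> ` ball 0 1"
    unfolding topspace_def openin_quotient_space by blast
  have "{z \<in> ball 0 1. orbit \<Gamma> z \<in> orbit \<Gamma> ` ball 0 1} = ball (0::complex^2) 1"
    by auto
  then have "openin (quotient_space \<Gamma>) (orbit \<Gamma> ` ball 0 1)"
    unfolding openin_quotient_space by simp
  then show "orbit \<Gamma> ` ball 0 1 \<subseteq> topspace (quotient_space \<Gamma>)"
    by (rule openin_subset)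
qed

definition cocompact :: "(complex^3^3) set \<Rightarrow> bool" where
  "cocompact \<Gamma> \<longleftrightarrow> compact_space (quotient_space \<Gamma>)"

definition fundamental_domain :: "(complex^3^3) set \<Rightarrow> (complex^2) set \<Rightarrow> bool" where
  "fundamental_domain \<Gamma> F \<longleftrightarrow> F \<in> sets lebesgue \<and> F \<subseteq> ball 0 1 \<and>
     (\<forall>z\<in>ball 0 1. \<exists>\<gamma>\<in>\<Gamma>. act \<gamma> z \<in> F) \<and>
     (\<forall>\<gamma>\<in>\<Gamma>. \<gamma> \<noteq> mat 1 \<longrightarrow> negligible (F \<inter> act \<gamma> ` F))"


section \<open>Automorphic forms and the Bergman kernel\<close>

definition holomorphic2_on :: "(complex^2 \<Rightarrow> complex) \<Rightarrow> (complex^2) set \<Rightarrow> bool" where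
  "holomorphic2_on f S \<longleftrightarrow> (\<forall>z\<in>S. \<exists>f'. (f has_derivative f') (at z) \<and>
     (\<forall>c v. f' (c *s v) = c * f' v))"

definition aut_forms :: "nat \<Rightarrow> (complex^3^3) set \<Rightarrow> (complex^2 \<Rightarrow> complex) set" where
  "aut_forms m \<Gamma> = {f. holomorphic2_on f (ball 0 1) \<and>
     (\<forall>\<gamma>\<in>\<Gamma>. \<forall>z\<in>ball 0 1. f (act \<gamma> z) = autfactor \<gamma> z ^ m * f z)}"

text \<open>
  A section $f\,(dz_1\wedge dz_2)^{\otimes k}$ of the $k$-th power of the canonical bundle is
  represented by its coefficient \<open>f \<in> aut_forms (3 * k) \<Gamma>\<close>; only the values of \<open>f\<close>
  on the ball matter. The hyperbolic volume form is Lebesgue measure divided by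
  $(1-|z|^2)^3$, because $\frac i2\,dz\wedge d\overline z = dx\wedge dy$.
\<close>

definition hyp_inner ::
    "(complex^2) set \<Rightarrow> nat \<Rightarrow> (complex^2 \<Rightarrow> complex) \<Rightarrow> (complex^2 \<Rightarrow> complex) \<Rightarrow> complex" where
  "hyp_inner F k f g =
     (LINT z:F|lebesgue. of_real ((1 - (norm z)\<^sup>2) ^ (3 * k)) * f z * cnj (g z) *
        of_real (1 / (1 - (norm z)\<^sup>2) ^ 3))"

definition orthonormal_basis ::
    "(complex^3^3) set \<Rightarrow> (complex^2) set \<Rightarrow> nat \<Rightarrow> nat \<Rightarrow> (nat \<Rightarrow> complex^2 \<Rightarrow> complex) \<Rightarrow> bool" where
  "orthonormal_basis \<Gamma> F k d f \<longleftrightarrow>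
     (\<forall>j<d. f j \<in> aut_forms (3 * k) \<Gamma>) \<and>
     (\<forall>i<d. \<forall>j<d. hyp_inner F k (f i) (f j) = (if i = j then 1 else 0)) \<and>
     (\<forall>g\<in>aut_forms (3 * k) \<Gamma>. \<exists>a. \<forall>z\<in>ball 0 1. g z = (\<Sum>j<d. a j * f j z))"

definition bergman_kernel ::
    "nat \<Rightarrow> (nat \<Rightarrow> complex^2 \<Rightarrow> complex) \<Rightarrow> complex^2 \<Rightarrow> complex^2 \<Rightarrow> complex" where
  "bergman_kernel d f z w = (\<Sum>j<d. f j z * cnj (f j w))"

definition bergman_norm ::
    "nat \<Rightarrow> nat \<Rightarrow> (nat \<Rightarrow> complex^2 \<Rightarrow> complex) \<Rightarrow> complex^2 \<Rightarrow> real" where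
  "bergman_norm k d f z = (1 - (norm z)\<^sup>2) ^ (3 * k) * cmod (bergman_kernel d f z z)"

lemma bergman_norm_eq_sum:
  "bergman_norm k d f z = (1 - (norm z)\<^sup>2) ^ (3 * k) * (\<Sum>j<d. (cmod (f j z))\<^sup>2)"
proof -
  have "bergman_kernel d f z z = of_real (\<Sum>j<d. (cmod (f j z))\<^sup>2)"
    unfolding bergman_kernel_def of_real_sum by (simp only: complex_norm_square)
  then show ?thesis
    unfolding bergman_norm_def by (simp add: sum_nonneg del: of_real_sum)
qed


section \<open>Differential forms on $C^2$ and the metrics\<close>

text \<open>
  A complex-valued $p$-form at a point is a function of $p$ real tangent vectors in
  \<^typ>\<open>complex^2\<close>. The wedge products are the shuffle sums without factorial
  prefactors, so that $(\alpha\wedge\beta)(u,v)=\alpha(u)\beta(v)-\alpha(v)\beta(u)$.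
\<close>

type_synonym form1 = "complex^2 \<Rightarrow> complex"
type_synonym form2 = "complex^2 \<Rightarrow> complex^2 \<Rightarrow> complex"
type_synonym form4 = "complex^2 \<Rightarrow> complex^2 \<Rightarrow> complex^2 \<Rightarrow> complex^2 \<Rightarrow> complex"

definition dz :: "2 \<Rightarrow> form1" where "dz a = (\<lambda>v. v $ a)"

definition dzbar :: "2 \<Rightarrow> form1" where "dzbar a = (\<lambda>v. cnj (v $ a))"

definition wedge11 :: "form1 \<Rightarrow> form1 \<Rightarrow> form2" where
  "wedge11 \<alpha> \<beta> = (\<lambda>u v. \<alpha> u * \<beta> v - \<alpha> v * \<beta> u)"

definition wedge22 :: "form2 \<Rightarrow> form2 \<Rightarrow> form4" where
  "wedge22 \<alpha> \<beta> = (\<lambda>u v w x.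
       \<alpha> u v * \<beta> w x - \<alpha> u w * \<beta> v x + \<alpha> u x * \<beta> v w
     + \<alpha> v w * \<beta> u x - \<alpha> v x * \<beta> u w + \<alpha> w x * \<beta> u v)"

text \<open>$\partial/\partial z_a$ and $\partial/\partial\overline{z_a}$\<close>

definition wirtinger :: "2 \<Rightarrow> (complex^2 \<Rightarrow> complex) \<Rightarrow> complex^2 \<Rightarrow> complex" where
  "wirtinger a f z =
     (frechet_derivative f (at z) (axis a 1) - \<i> * frechet_derivative f (at z) (axis a \<i>)) / 2"

definition wirtinger_bar :: "2 \<Rightarrow> (complex^2 \<Rightarrow> complex) \<Rightarrow> complex^2 \<Rightarrow> complex" where
  "wirtinger_bar a f z =
     (frechet_derivative f (at z) (axis a 1) + \<i> * frechet_derivative f (at z) (axis a \<i>)) / 2"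

definition ddbar :: "(complex^2 \<Rightarrow> real) \<Rightarrow> complex^2 \<Rightarrow> form2" where
  "ddbar \<phi> z = (\<lambda>u v. \<Sum>a\<in>UNIV. \<Sum>b\<in>UNIV.
     wirtinger a (wirtinger_bar b (\<lambda>w. of_real (\<phi> w))) z * wedge11 (dz a) (dzbar b) u v)"

definition volume_form :: "form2 \<Rightarrow> form4" where
  "volume_form \<mu> = (\<lambda>u v w x. wedge22 \<mu> \<mu> u v w x / fact 2)"

definition hyp_metric :: "complex^2 \<Rightarrow> form2" where
  "hyp_metric z = (\<lambda>u v. - (\<i> / 2) * ddbar (\<lambda>w. ln (1 - (norm w)\<^sup>2)) z u v)"

definition hyp_vol :: "complex^2 \<Rightarrow> form4" where
  "hyp_vol z = (\<lambda>u v w x. (\<i> / 2)\<^sup>2 *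
     wedge22 (wedge11 (dz 1) (dzbar 1)) (wedge11 (dz 2) (dzbar 2)) u v w x /
     of_real ((1 - (norm z)\<^sup>2) ^ 3))"

definition bergman_metric ::
    "nat \<Rightarrow> nat \<Rightarrow> (nat \<Rightarrow> complex^2 \<Rightarrow> complex) \<Rightarrow> complex^2 \<Rightarrow> form2" where
  "bergman_metric k d f z = (\<lambda>u v. - (\<i> / (2 * of_real pi)) * ddbar (\<lambda>w. ln (bergman_norm k d f w)) z u v)"

definition bergman_vol ::
    "nat \<Rightarrow> nat \<Rightarrow> (nat \<Rightarrow> complex^2 \<Rightarrow> complex) \<Rightarrow> complex^2 \<Rightarrow> form4" where
  "bergman_vol k d f z = volume_form (bergman_metric k d f z)"

text \<open>
  The quotient of two top-degree forms at a point. It is well defined whenever the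
  denominator is nonzero, top-degree forms being a one-dimensional space.
\<close>

definition form_ratio :: "form4 \<Rightarrow> form4 \<Rightarrow> complex" where
  "form_ratio \<alpha> \<beta> = (THE r. \<forall>u v w x. \<alpha> u v w x = r * \<beta> u v w x)"


subsection \<open>Consistency of the conventions\<close>

lemma hyp_vol_standard_frame:
  "hyp_vol z (axis 1 1) (axis 1 \<i>) (axis 2 1) (axis 2 \<i>) = of_real (1 / (1 - (norm z)\<^sup>2) ^ 3)"
  unfolding hyp_vol_def wedge22_def wedge11_def dz_def dzbar_def
  by (simp add: axis_def power2_eq_square field_simps)

lemma volume_form_11:
  "volume_form (\<lambda>u v. c * (\<Sum>a\<in>UNIV. \<Sum>b\<in>UNIV. g a b * wedge11 (dz a) (dzbar b) u v)) =
   (\<lambda>u v w x. c\<^sup>2 * (g 1 1 * g 2 2 - g 1 2 * g 2 1) *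
     wedge22 (wedge11 (dz 1) (dzbar 1)) (wedge11 (dz 2) (dzbar 2)) u v w x)"
  unfolding volume_form_def wedge22_def wedge11_def dz_def dzbar_def sum_2
  by (intro ext) (simp add: fact_numeral field_simps power2_eq_square)

lemma form_ratio_eqI:
  assumes "\<And>u v w x. \<alpha> u v w x = r * \<beta> u v w x" and "\<beta> u0 v0 w0 x0 \<noteq> 0"
  shows "form_ratio \<alpha> \<beta> = r"
  unfolding form_ratio_def
proof (rule the_equality)
  show "\<forall>u v w x. \<alpha> u v w x = r * \<beta> u v w x" using assms by blast
  fix s assume "\<forall>u v w x. \<alpha> u v w x = s * \<beta> u v w x"
  then have "r * \<beta> u0 v0 w0 x0 = s * \<beta> u0 v0 w0 x0" using assms(1) by metis
  then show "s = r" using assms(2) by simp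
qed

lemma hyp_vol_eq_volume_form:
  assumes z: "z \<in> ball 0 1"
  shows "volume_form (hyp_metric z) = hyp_vol z"
proof -
  define \<rho> where "\<rho> = (\<lambda>w::complex^2. 1 - (norm w)\<^sup>2)"
  have pos: "\<rho> w > 0" if "w \<in> ball 0 1" for w
    using that by (simp add: \<rho>_def power_less_one_iff abs_square_less_1)
  have d\<rho>: "(\<rho> has_derivative (\<lambda>v. - 2 * (w \<bullet> v))) (at w)" for w
    unfolding \<rho>_def power2_norm_eq_inner
    by (auto intro!: derivative_eq_intros simp: inner_commute)
  have dln: "((\<lambda>w. complex_of_real (ln (\<rho> w))) has_derivative
      (\<lambda>v. of_real (- 2 * (w \<bullet> v) / \<rho> w))) (at w)" if "w \<in> ball 0 1" for w
    using pos[OF that]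
    by (auto intro!: derivative_eq_intros d\<rho> simp: divide_inverse mult_ac)
  have inner1: "w \<bullet> axis b c = w $ b \<bullet> c" for w :: "complex^2" and b c
    by (rule inner_axis)
  have wb: "wirtinger_bar b (\<lambda>w. of_real (ln (\<rho> w))) w = - (w $ b / of_real (\<rho> w))"
    if "w \<in> ball 0 1" for w b
    unfolding wirtinger_bar_def frechet_derivative_at[OF dln[OF that], symmetric] inner1
    using pos[OF that]
    by (simp add: complex_eq_iff inner_complex_def field_simps)
  have fd: "frechet_derivative (wirtinger_bar b (\<lambda>w. of_real (ln (\<rho> w)))) (at z) =
      (\<lambda>v. - (v $ b / of_real (\<rho> z)) - z $ b * of_real (2 * (z \<bullet> v)) / (of_real (\<rho> z))\<^sup>2)" for b
  proof (rule frechet_derivative_at[symmetric])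
    have "((\<lambda>w. - (w $ b / complex_of_real (\<rho> w))) has_derivative
      (\<lambda>v. - (v $ b / of_real (\<rho> z)) - z $ b * of_real (2 * (z \<bullet> v)) / (of_real (\<rho> z))\<^sup>2)) (at z)"
      using pos[OF z]
      by (auto intro!: derivative_eq_intros bounded_linear_vec_nth[THEN bounded_linear_imp_has_derivative] d\<rho>
          simp: field_simps power2_eq_square)
    then show "(wirtinger_bar b (\<lambda>w. of_real (ln (\<rho> w))) has_derivative
      (\<lambda>v. - (v $ b / of_real (\<rho> z)) - z $ b * of_real (2 * (z \<bullet> v)) / (of_real (\<rho> z))\<^sup>2)) (at z)"
      by (rule has_derivative_transform_within_open[OF _ open_ball z]) (use wb in auto)
  qed
  define r where "r = complex_of_real (\<rho> z)"
  have r0: "r \<noteq> 0" using pos[OF z] by (simp add: r_def)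
  define g where "g a b = wirtinger a (wirtinger_bar b (\<lambda>w. of_real (ln (\<rho> w)))) z" for a b
  have g: "g a b = - ((if a = b then 1 else 0) / r) - cnj (z $ a) * z $ b / r\<^sup>2" for a b
  proof -
    have "complex_of_real (z $ a \<bullet> 1) - \<i> * complex_of_real (z $ a \<bullet> \<i>) = cnj (z $ a)"
      by (simp add: complex_eq_iff inner_complex_def)
    then have cn: "complex_of_real (z $ a \<bullet> 1) = cnj (z $ a) + \<i> * complex_of_real (z $ a \<bullet> \<i>)"
      by (simp add: algebra_simps)
    show ?thesis
      unfolding g_def wirtinger_def fd inner1 r_def[symmetric] of_real_mult cn
      using r0 by (simp add: axis_def field_simps power2_eq_square)
  qed
  have nz: "z $ 1 * cnj (z $ 1) + z $ 2 * cnj (z $ 2) = 1 - r"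
  proof -
    have "(norm z)\<^sup>2 = (cmod (z $ 1))\<^sup>2 + (cmod (z $ 2))\<^sup>2"
      by (simp add: norm_vec_def L2_set_def sum_2)
    then show ?thesis
      by (simp add: r_def \<rho>_def flip: complex_norm_square of_real_power)
  qed
  have det: "(g 1 1 * g 2 2 - g 1 2 * g 2 1) = 1 / r ^ 3"
  proof -
    have "g 1 1 * g 2 2 - g 1 2 * g 2 1 =
        (r + (z $ 1 * cnj (z $ 1) + z $ 2 * cnj (z $ 2))) / r ^ 3"
      unfolding g using r0 by (simp add: field_simps power2_eq_square power3_eq_cube)
    then show ?thesis by (simp add: nz)
  qed
  have "volume_form (hyp_metric z) = (\<lambda>u v w x. (- (\<i> / 2))\<^sup>2 * (g 1 1 * g 2 2 - g 1 2 * g 2 1) *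
     wedge22 (wedge11 (dz 1) (dzbar 1)) (wedge11 (dz 2) (dzbar 2)) u v w x)"
    unfolding hyp_metric_def ddbar_def g_def \<rho>_def[symmetric]
    by (subst volume_form_11[symmetric]) (simp add: \<rho>_def)
  also have "\<dots> = hyp_vol z"
    unfolding det hyp_vol_def by (simp add: r_def \<rho>_def)
  finally show ?thesis .
qed

end

theory Submission
  imports Defs "HOL-Complex_Analysis.Cauchy_Integral_Formula" "HOL-Real_Asymp.Real_Asymp"
begin

text \<open>
  Let \<open>b z = (1 - |z|^2)^(3k) * (|f_1 z|^2 + ... + |f_d z|^2)\<close> be the norm of the Bergman kernel on the
  diagonal. At \<open>z\<close> the ratio of the two volume forms is \<open>(1 - |z|^2)^3 / pi^2\<close> times the determinant
  of the complex Hessian of \<open>log b\<close> (\<open>form_ratio_bergman\<close>). Both \<open>b\<close> and the absolute value of the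
  ratio are invariant under the lattice, so it suffices to work on one closed ball of radius \<open>r < 1\<close>
  whose translates cover the unit ball (\<open>exhaustion\<close>). There every entry of the Hessian is at most a
  constant times \<open>k^2\<close> (\<open>pot_hess_bound\<close>), hence the determinant is at most a constant times \<open>k^4\<close>.

  The Hessian is the sum of that of \<open>3k log (1 - |z|^2)\<close>, which is of order \<open>k\<close>, and of that of
  \<open>log (|f_1|^2 + ... + |f_d|^2)\<close>, which only involves the values and first derivatives of the \<open>f_j\<close>.
  Over a ball of radius a small multiple of \<open>1/k\<close> the weight \<open>(1 - |z|^2)^(3k)\<close> changes by a bounded
  factor, so Cauchy's estimate on such a ball yields the bound \<open>k^2\<close> as soon as \<open>b\<close> varies by at most
  a factor independent of \<open>k\<close>. This is the heart of the matter: \<open>c1 k^2 \<le> b \<le> c2 k^2\<close>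
  on the whole ball for all large \<open>k\<close>, with positive constants independent of \<open>k\<close> (\<open>bergman_bounds\<close>).

  The upper bound says that an automorphic form of norm one is nowhere large
  (\<open>point_evaluation_bound\<close>). Near \<open>z\<close> one multiplies the form by \<open>(1 - \<langle>w,z\<rangle>)^(3k)\<close>, a
  frame in which the weight is constant up to a bounded factor on the ball of radius proportional to
  \<open>k^(-1/2)\<close>, and applies the mean value inequality there; that ball has volume proportional to
  \<open>k^(-2)\<close> and meets every orbit a bounded number of times.

  For the lower bound one needs a single form of small norm which is large at \<open>z\<close>. The Poincare
  series \<open>poincare\<close> with terms \<open>((1 - \<langle>\<gamma>w,z\<rangle>) j(\<gamma>,w))^(-3k)\<close> is such a form. At \<open>w = z\<close>
  the term of the identity dominates: the action is free, so by compactness all other points of the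
  orbit of \<open>z\<close> stay at a distance bounded below (\<open>systole_gap\<close>), and the sum of the remaining terms
  decays exponentially in \<open>k\<close> (\<open>poincare_diag\<close>). Unfolding the integral over the fundamental domain
  bounds the norm of the series by an integral over the whole ball with Gaussian decay at scale
  \<open>k^(-1/2)\<close>, which is of order \<open>k^(-2)\<close> (\<open>poincare_L2\<close>, \<open>proximity_integral_bound\<close>).

  Two tools support this. The hyperbolic measure is invariant under the group
  (\<open>nn_integral_act\<close>), which allows integrals to be unfolded and orbit sums to be compared with the
  volume of the ball. Functions are holomorphic here when they are complex differentiable at every
  point; Osgood's lemma (\<open>osgood\<close>) shows that partial derivatives and locally uniform limits of such
  functions are again of this kind.
\<close>

section \<open>The Hermitian form and the group SU(2,1)\<close>

definition herm :: "complex^2 \<Rightarrow> complex^2 \<Rightarrow> complex" where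
  "herm z w = z$1 * cnj (w$1) + z$2 * cnj (w$2)"

definition rho :: "complex^2 \<Rightarrow> real" where
  "rho z = 1 - (norm z)\<^sup>2"

text \<open>
  For points of the ball this is \<open>1 / cosh^2\<close> of a hyperbolic distance: it is invariant under
  SU(2,1), at most 1, and equal to 1 exactly on the diagonal.
\<close>

definition proximity :: "complex^2 \<Rightarrow> complex^2 \<Rightarrow> real" where
  "proximity z w = rho z * rho w / (cmod (1 - herm z w))\<^sup>2"

lemma norm_vec2: "(norm (z::complex^2))\<^sup>2 = (cmod (z$1))\<^sup>2 + (cmod (z$2))\<^sup>2"
  by (simp add: norm_vec_def L2_set_def sum_2)

lemma herm_self: "herm z z = of_real ((norm z)\<^sup>2)"
  unfolding herm_def norm_vec2 by (simp add: complex_norm_square del: of_real_power)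

lemma rho_herm: "of_real (rho z) = 1 - herm z z"
  by (simp add: rho_def herm_self)

lemma rho_pos: "z \<in> ball 0 1 \<Longrightarrow> rho z > 0"
  by (simp add: rho_def power_less_one_iff abs_square_less_1)

lemma rho_pos_iff: "rho z > 0 \<longleftrightarrow> z \<in> ball 0 1"
  by (simp add: rho_def power_less_one_iff abs_square_less_1)

lemma rho_le_1: "rho z \<le> 1"
  by (simp add: rho_def)

lemma cmod_herm_le: "cmod (herm z w) \<le> norm z * norm w"
proof -
  have "cmod (herm z w) \<le> cmod (z$1) * cmod (w$1) + cmod (z$2) * cmod (w$2)"
    unfolding herm_def by (metis complex_mod_cnj norm_mult norm_triangle_ineq)
  also have "\<dots> \<le> norm z * norm w"
  proof (rule power2_le_imp_le)
    have "0 \<le> (cmod (z$1) * cmod (w$2) - cmod (z$2) * cmod (w$1))\<^sup>2" by simp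
    then show "(cmod (z$1) * cmod (w$1) + cmod (z$2) * cmod (w$2))\<^sup>2 \<le> (norm z * norm w)\<^sup>2"
      unfolding power_mult_distrib norm_vec2 by (simp add: power2_eq_square algebra_simps)
  qed simp
  finally show ?thesis .
qed

lemma one_minus_herm_ge: 
  assumes "norm z \<le> 1"
  shows "cmod (1 - herm w z) \<ge> 1 - norm w"
proof -
  have "cmod (herm w z) \<le> norm w"
    using cmod_herm_le[of w z] mult_left_mono[OF assms, of "norm w"] by simp
  then show ?thesis
    using norm_triangle_ineq2[of 1 "herm w z"] by simp
qed

lemma one_minus_herm_nz:
  assumes "z \<in> ball 0 1" "w \<in> ball 0 1"
  shows "1 - herm w z \<noteq> 0"
  using one_minus_herm_ge[of z w] assms by auto

lemma herm_cnj: "herm z w = cnj (herm w z)"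
  by (simp add: herm_def mult.commute)

lemma cmod_one_minus_herm_commute: "cmod (1 - herm z w) = cmod (1 - herm w z)"
  by (subst herm_cnj) (metis complex_cnj_diff complex_cnj_one complex_mod_cnj)

text \<open>
  The term in parentheses lies between 0 and \<open>|z|^2 |w - z|^2\<close> by the Cauchy-Schwarz inequality.
  So \<open>1 - proximity w z\<close> is comparable with \<open>|w - z|^2\<close>; both directions are used below.
\<close>

lemma herm_identity:
  "(cmod (1 - herm w z))\<^sup>2 - rho z * rho w =
     (norm (w - z))\<^sup>2 - ((norm z)\<^sup>2 * (norm (w - z))\<^sup>2 - (cmod (herm (w - z) z))\<^sup>2)"
proof -
  have "complex_of_real ((cmod (1 - herm w z))\<^sup>2 - rho z * rho w) =
     of_real ((norm (w - z))\<^sup>2 - ((norm z)\<^sup>2 * (norm (w - z))\<^sup>2 - (cmod (herm (w - z) z))\<^sup>2))"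
    unfolding of_real_diff of_real_mult rho_herm herm_self[symmetric] complex_norm_square
    unfolding herm_def by (simp add: algebra_simps)
  then show ?thesis using of_real_eq_iff by blast
qed

lemma rho_rho_le: "(cmod (1 - herm w z))\<^sup>2 - rho z * rho w \<ge> rho z * (norm (w - z))\<^sup>2"
  unfolding herm_identity by (simp add: rho_def left_diff_distrib)

lemma rho_rho_ge: "(cmod (1 - herm w z))\<^sup>2 - rho z * rho w \<le> (norm (w - z))\<^sup>2"
proof -
  have "(cmod (herm (w - z) z))\<^sup>2 \<le> (norm (w - z) * norm z)\<^sup>2"
    using cmod_herm_le by (intro power_mono) auto
  then show ?thesis unfolding herm_identity by (simp add: power_mult_distrib mult.commute)
qed

lemma proximity_pos: "z \<in> ball 0 1 \<Longrightarrow> w \<in> ball 0 1 \<Longrightarrow> proximity z w > 0"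
  unfolding proximity_def using one_minus_herm_nz[of w z] rho_pos by auto

lemma proximity_le:
  assumes "z \<in> ball 0 1" "w \<in> ball 0 1"
  shows "proximity w z \<le> 1 - rho z * (norm (w - z))\<^sup>2 / 4"
proof -
  have nz: "cmod (1 - herm w z) > 0" using one_minus_herm_nz[OF assms] by simp
  have "cmod (herm w z) \<le> 1"
    using cmod_herm_le[of w z] assms mult_mono[of "norm w" 1 "norm z" 1] by auto
  then have "cmod (1 - herm w z) \<le> 2"
    using norm_triangle_ineq4[of 1 "herm w z"] by simp
  then have le4: "(cmod (1 - herm w z))\<^sup>2 \<le> 4"
    using power_mono[of "cmod (1 - herm w z)" 2 2] by simp
  have p: "rho z * (norm (w - z))\<^sup>2 \<ge> 0" using rho_pos[OF assms(1)] by simp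
  have "1 - proximity w z = ((cmod (1 - herm w z))\<^sup>2 - rho z * rho w) / (cmod (1 - herm w z))\<^sup>2"
    unfolding proximity_def using nz by (simp add: field_simps)
  also have "\<dots> \<ge> rho z * (norm (w - z))\<^sup>2 / (cmod (1 - herm w z))\<^sup>2"
    using rho_rho_le by (intro divide_right_mono) auto
  also have "rho z * (norm (w - z))\<^sup>2 / (cmod (1 - herm w z))\<^sup>2 \<ge> rho z * (norm (w - z))\<^sup>2 / 4"
    using le4 p nz by (intro divide_left_mono) auto
  finally show ?thesis by simp
qed

lemma proximity_le_1: "z \<in> ball 0 1 \<Longrightarrow> w \<in> ball 0 1 \<Longrightarrow> proximity w z \<le> 1"
  using proximity_le[of z w] rho_pos[of z] by (smt (verit) divide_nonneg_nonneg mult_nonneg_nonneg zero_le_power2)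

lemma proximity_le_rho:
  assumes "z \<in> ball 0 1" "w \<in> ball 0 1"
  shows "proximity w z \<le> rho w / (1 - norm z)\<^sup>2"
proof -
  have ge: "cmod (1 - herm w z) \<ge> 1 - norm z"
    using one_minus_herm_ge[of w z] cmod_one_minus_herm_commute[of w z] assms by simp
  have "proximity w z \<le> rho w * 1 / (cmod (1 - herm w z))\<^sup>2"
    unfolding proximity_def using rho_pos[OF assms(2)] rho_le_1[of z]
    by (intro divide_right_mono mult_left_mono) auto
  also have "\<dots> \<le> rho w / (1 - norm z)\<^sup>2"
    using ge assms rho_pos[OF assms(2)] one_minus_herm_nz[OF assms]
    by (auto intro!: divide_left_mono power_mono mult_pos_pos)
  finally show ?thesis .
qed

text \<open>
  The three coordinates of \<open>\<gamma> (z, 1)\<close>. The action divides the first two by the third, which is the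
  automorphy factor; working with the numerators avoids fractions.
\<close>

definition actnum :: "3 \<Rightarrow> complex^3^3 \<Rightarrow> complex^2 \<Rightarrow> complex" where
  "actnum i \<gamma> z = \<gamma>$i$1 * z$1 + \<gamma>$i$2 * z$2 + \<gamma>$i$3"

lemma autfactor_actnum: "autfactor \<gamma> z = actnum 3 \<gamma> z"
  by (simp add: autfactor_def actnum_def)

lemma act_1: "act \<gamma> z $ 1 = actnum 1 \<gamma> z / autfactor \<gamma> z"
  and act_2: "act \<gamma> z $ 2 = actnum 2 \<gamma> z / autfactor \<gamma> z"
  by (simp_all add: act_def actnum_def)

lemma SU21_columns:
  assumes "\<gamma> \<in> carrier SU21"
  shows "\<gamma>$1$i * cnj (\<gamma>$1$j) + \<gamma>$2$i * cnj (\<gamma>$2$j) - \<gamma>$3$i * cnj (\<gamma>$3$j) = (H21 $ i $ j)"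
proof -
  have "(conj_transpose \<gamma> ** H21 ** \<gamma>) $ j $ i = H21 $ j $ i"
    using assms by (simp add: SU21_def)
  then have "cnj (\<gamma>$1$j) * \<gamma>$1$i + cnj (\<gamma>$2$j) * \<gamma>$2$i - cnj (\<gamma>$3$j) * \<gamma>$3$i = H21 $ j $ i"
    by (simp add: matrix_matrix_mult_def sum_3 conj_transpose_def H21_def)
  moreover have "H21 $ i $ j = H21 $ j $ i" by (simp add: H21_def)
  ultimately show ?thesis by (simp add: mult.commute)
qed

text \<open>
  Invariance of the Hermitian form \<open>H21\<close>, evaluated at the vectors \<open>(z, 1)\<close> and \<open>(w, 1)\<close>.
\<close>

lemma SU21_form:
  assumes "\<gamma> \<in> carrier SU21"
  shows "actnum 1 \<gamma> z * cnj (actnum 1 \<gamma> w) + actnum 2 \<gamma> z * cnj (actnum 2 \<gamma> w)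
         - autfactor \<gamma> z * cnj (autfactor \<gamma> w) = herm z w - 1"
proof -
  note c = SU21_columns[OF assms]
  have "actnum 1 \<gamma> z * cnj (actnum 1 \<gamma> w) + actnum 2 \<gamma> z * cnj (actnum 2 \<gamma> w)
         - autfactor \<gamma> z * cnj (autfactor \<gamma> w) =
     z$1 * cnj (w$1) * (\<gamma>$1$1 * cnj (\<gamma>$1$1) + \<gamma>$2$1 * cnj (\<gamma>$2$1) - \<gamma>$3$1 * cnj (\<gamma>$3$1))
   + z$1 * cnj (w$2) * (\<gamma>$1$1 * cnj (\<gamma>$1$2) + \<gamma>$2$1 * cnj (\<gamma>$2$2) - \<gamma>$3$1 * cnj (\<gamma>$3$2))
   + z$2 * cnj (w$1) * (\<gamma>$1$2 * cnj (\<gamma>$1$1) + \<gamma>$2$2 * cnj (\<gamma>$2$1) - \<gamma>$3$2 * cnj (\<gamma>$3$1))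
   + z$2 * cnj (w$2) * (\<gamma>$1$2 * cnj (\<gamma>$1$2) + \<gamma>$2$2 * cnj (\<gamma>$2$2) - \<gamma>$3$2 * cnj (\<gamma>$3$2))
   + z$1 * (\<gamma>$1$1 * cnj (\<gamma>$1$3) + \<gamma>$2$1 * cnj (\<gamma>$2$3) - \<gamma>$3$1 * cnj (\<gamma>$3$3))
   + z$2 * (\<gamma>$1$2 * cnj (\<gamma>$1$3) + \<gamma>$2$2 * cnj (\<gamma>$2$3) - \<gamma>$3$2 * cnj (\<gamma>$3$3))
   + cnj (w$1) * (\<gamma>$1$3 * cnj (\<gamma>$1$1) + \<gamma>$2$3 * cnj (\<gamma>$2$1) - \<gamma>$3$3 * cnj (\<gamma>$3$1))
   + cnj (w$2) * (\<gamma>$1$3 * cnj (\<gamma>$1$2) + \<gamma>$2$3 * cnj (\<gamma>$2$2) - \<gamma>$3$3 * cnj (\<gamma>$3$2))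
   + (\<gamma>$1$3 * cnj (\<gamma>$1$3) + \<gamma>$2$3 * cnj (\<gamma>$2$3) - \<gamma>$3$3 * cnj (\<gamma>$3$3))"
    unfolding autfactor_actnum actnum_def by (simp add: algebra_simps)
  also have "\<dots> = herm z w - 1"
    unfolding c by (simp add: H21_def herm_def)
  finally show ?thesis .
qed

text \<open>
  \<open>(z, 1)\<close> is a negative vector of the Hermitian form, and so is its image, whose last coordinate can
  therefore not vanish.
\<close>

lemma autfactor_nz:
  assumes "\<gamma> \<in> carrier SU21" "z \<in> ball 0 1"
  shows "autfactor \<gamma> z \<noteq> 0"
proof
  assume 0: "autfactor \<gamma> z = 0"
  have "complex_of_real ((cmod (actnum 1 \<gamma> z))\<^sup>2 + (cmod (actnum 2 \<gamma> z))\<^sup>2) = of_real (- rho z)"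
    unfolding of_real_minus rho_herm of_real_add complex_norm_square
    using SU21_form[OF assms(1), of z z] 0 by simp
  then have "(cmod (actnum 1 \<gamma> z))\<^sup>2 + (cmod (actnum 2 \<gamma> z))\<^sup>2 = - rho z"
    using of_real_eq_iff by blast
  then show False using rho_pos[OF assms(2)] 
    by (smt (verit) zero_le_power2)
qed

lemma one_minus_herm_act:
  assumes "\<gamma> \<in> carrier SU21" "z \<in> ball 0 1" "w \<in> ball 0 1"
  shows "1 - herm (act \<gamma> z) (act \<gamma> w) = (1 - herm z w) / (autfactor \<gamma> z * cnj (autfactor \<gamma> w))"
proof -
  have nz: "autfactor \<gamma> z \<noteq> 0" "autfactor \<gamma> w \<noteq> 0" using autfactor_nz assms by auto
  have "1 - herm (act \<gamma> z) (act \<gamma> w) = - (actnum 1 \<gamma> z * cnj (actnum 1 \<gamma> w) + actnum 2 \<gamma> z * cnj (actnum 2 \<gamma> w)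
         - autfactor \<gamma> z * cnj (autfactor \<gamma> w)) / (autfactor \<gamma> z * cnj (autfactor \<gamma> w))"
    unfolding herm_def act_1 act_2 using nz by (simp add: field_simps)
  then show ?thesis unfolding SU21_form[OF assms(1)] by simp
qed

lemma rho_act:
  assumes "\<gamma> \<in> carrier SU21" "z \<in> ball 0 1"
  shows "rho (act \<gamma> z) = rho z / (cmod (autfactor \<gamma> z))\<^sup>2"
proof -
  have "complex_of_real (rho (act \<gamma> z)) = of_real (rho z / (cmod (autfactor \<gamma> z))\<^sup>2)"
    unfolding of_real_divide rho_herm complex_norm_square one_minus_herm_act[OF assms assms(2)] ..
  then show ?thesis using of_real_eq_iff by blast
qed

lemma act_ball:
  assumes "\<gamma> \<in> carrier SU21" "z \<in> ball 0 1"
  shows "act \<gamma> z \<in> ball 0 1"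
proof -
  have "rho (act \<gamma> z) > 0"
    unfolding rho_act[OF assms] using rho_pos[OF assms(2)] autfactor_nz[OF assms] by simp
  then show ?thesis by (simp only: rho_pos_iff)
qed

lemma actnum_mult:
  assumes "autfactor \<sigma> z \<noteq> 0"
  shows "actnum i (\<gamma> ** \<sigma>) z = actnum i \<gamma> (act \<sigma> z) * autfactor \<sigma> z"
proof -
  have "actnum i (\<gamma> ** \<sigma>) z = \<gamma>$i$1 * actnum 1 \<sigma> z + \<gamma>$i$2 * actnum 2 \<sigma> z + \<gamma>$i$3 * actnum 3 \<sigma> z"
    unfolding actnum_def by (simp add: matrix_matrix_mult_def sum_3 algebra_simps)
  also have "\<dots> = actnum i \<gamma> (act \<sigma> z) * autfactor \<sigma> z"
    unfolding actnum_def[of i] act_1 act_2 using assms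
    by (simp add: field_simps autfactor_actnum[symmetric])
  finally show ?thesis .
qed

lemma autfactor_mult:
  assumes "\<sigma> \<in> carrier SU21" "z \<in> ball 0 1"
  shows "autfactor (\<gamma> ** \<sigma>) z = autfactor \<gamma> (act \<sigma> z) * autfactor \<sigma> z"
  unfolding autfactor_actnum[of \<gamma>] autfactor_actnum[of "\<gamma> ** \<sigma>"]
  by (rule actnum_mult) (rule autfactor_nz[OF assms])

lemma vec2_eq_iff: "(x::'a^2) = y \<longleftrightarrow> x$1 = y$1 \<and> x$2 = y$2"
  by (metis exhaust_2 vec_eq_iff)

lemma act_mult:
  assumes "\<sigma> \<in> carrier SU21" "z \<in> ball 0 1"
  shows "act (\<gamma> ** \<sigma>) z = act \<gamma> (act \<sigma> z)"
  using autfactor_nz[OF assms]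
  by (simp add: vec2_eq_iff act_1 act_2 autfactor_actnum[of \<gamma>] autfactor_actnum[of "\<gamma> ** \<sigma>"] actnum_mult)

lemma autfactor_one [simp]: "autfactor (mat 1) z = 1"
  by (simp add: autfactor_def mat_def)

lemma act_one [simp]: "act (mat 1) z = z"
  by (simp add: vec2_eq_iff act_1 act_2) (simp add: actnum_def mat_def)

lemma conj_transpose_mult: "conj_transpose (A ** B) = conj_transpose B ** conj_transpose A"
  for A B :: "complex^3^3"
  by (simp add: conj_transpose_def matrix_matrix_mult_def vec_eq_iff mult.commute)

lemma H21_H21: "H21 ** H21 = mat 1"
  unfolding vec_eq_iff forall_3 by (simp add: H21_def matrix_matrix_mult_def sum_3 mat_def)

lemma conj_transpose_H21 [simp]: "conj_transpose H21 = H21"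
  unfolding vec_eq_iff forall_3 by (simp add: H21_def conj_transpose_def)

lemma conj_transpose_conj_transpose [simp]: "conj_transpose (conj_transpose A) = A"
  by (simp add: conj_transpose_def vec_eq_iff)

lemma det_conj_transpose: "det (conj_transpose A) = cnj (det A)" for A :: "complex^3^3"
  by (simp add: det_3 conj_transpose_def algebra_simps)

lemma det_H21: "det H21 = - 1"
  by (simp add: det_3 H21_def)

text \<open>
  The relation \<open>A* H A = H\<close> with \<open>H^2 = 1\<close> exhibits \<open>H A* H\<close> as inverse.
\<close>

definition SU21_inv :: "complex^3^3 \<Rightarrow> complex^3^3" where
  "SU21_inv \<gamma> = H21 ** conj_transpose \<gamma> ** H21"

lemma SU21_inv:
  assumes "\<gamma> \<in> carrier SU21"
  shows "SU21_inv \<gamma> ** \<gamma> = mat 1" "\<gamma> ** SU21_inv \<gamma> = mat 1" "SU21_inv \<gamma> \<in> carrier SU21"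
proof -
  have c: "conj_transpose \<gamma> ** H21 ** \<gamma> = H21" and d: "det \<gamma> = 1"
    using assms by (auto simp: SU21_def)
  have "SU21_inv \<gamma> ** \<gamma> = H21 ** (conj_transpose \<gamma> ** H21 ** \<gamma>)"
    by (simp add: SU21_inv_def matrix_mul_assoc)
  then show 1: "SU21_inv \<gamma> ** \<gamma> = mat 1" by (simp add: c H21_H21)
  then show 2: "\<gamma> ** SU21_inv \<gamma> = mat 1" by (simp add: matrix_left_right_inverse)
  have "conj_transpose (SU21_inv \<gamma>) ** H21 ** SU21_inv \<gamma>
      = H21 ** \<gamma> ** (H21 ** H21) ** SU21_inv \<gamma>"
    by (simp add: SU21_inv_def conj_transpose_mult matrix_mul_assoc)
  also have "\<dots> = H21 ** (\<gamma> ** SU21_inv \<gamma>)" by (simp add: H21_H21 matrix_mul_assoc)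
  also have "\<dots> = H21" by (simp add: 2)
  finally show "SU21_inv \<gamma> \<in> carrier SU21"
    by (simp add: SU21_def SU21_inv_def det_mul det_conj_transpose det_H21 d)
qed

lemma SU21_simps: "mult SU21 = (**)" "one SU21 = mat 1"
  by (simp_all add: SU21_def)

lemma SU21_mult_closed:
  assumes "\<gamma> \<in> carrier SU21" "\<sigma> \<in> carrier SU21"
  shows "\<gamma> ** \<sigma> \<in> carrier SU21"
proof -
  have "conj_transpose (\<gamma> ** \<sigma>) ** H21 ** (\<gamma> ** \<sigma>) = conj_transpose \<sigma> ** (conj_transpose \<gamma> ** H21 ** \<gamma>) ** \<sigma>"
    by (simp add: conj_transpose_mult matrix_mul_assoc)
  then show ?thesis using assms by (simp add: SU21_def det_mul)
qed

lemma conj_transpose_mat_1: "conj_transpose (mat 1) = (mat 1 :: complex^3^3)"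
  by (simp add: conj_transpose_def mat_def vec_eq_iff)

lemma group_SU21: "group SU21"
proof (rule groupI)
  show "\<exists>y\<in>carrier SU21. y \<otimes>\<^bsub>SU21\<^esub> x = \<one>\<^bsub>SU21\<^esub>" if "x \<in> carrier SU21" for x
    using SU21_inv[OF that] by (auto simp: SU21_simps)
qed (auto simp: SU21_simps SU21_mult_closed matrix_mul_assoc, simp add: SU21_def conj_transpose_mat_1)

lemma act_inv:
  assumes "\<gamma> \<in> carrier SU21" "z \<in> ball 0 1"
  shows "act (SU21_inv \<gamma>) (act \<gamma> z) = z" "act \<gamma> (act (SU21_inv \<gamma>) z) = z"
  using act_mult[OF assms, of "SU21_inv \<gamma>"] act_mult[OF SU21_inv(3)[OF assms(1)] assms(2), of \<gamma>] SU21_inv[OF assms(1)]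
  by auto

lemma SU21_inv_eq:
  assumes "\<gamma> \<in> carrier SU21"
  shows "inv\<^bsub>SU21\<^esub> \<gamma> = SU21_inv \<gamma>"
  by (rule group.inv_equality[OF group_SU21]) (use SU21_inv[OF assms] assms in \<open>auto simp: SU21_simps\<close>)

section \<open>Holomorphic functions of two variables\<close>

definition cpartial :: "2 \<Rightarrow> (complex^2 \<Rightarrow> complex) \<Rightarrow> complex^2 \<Rightarrow> complex" where
  "cpartial a f z = frechet_derivative f (at z) (axis a 1)"

lemma vec2_decompose: "(v::complex^2) = v$1 *s axis 1 1 + v$2 *s axis 2 1"
  by (simp add: vec2_eq_iff axis_def)

lemma axis_smult: "axis a c = c *s axis a (1::complex)"
  by (simp add: vec_eq_iff axis_def)

lemma holomorphic2_on_has_derivative: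
  assumes "holomorphic2_on f S" "z \<in> S"
  shows "(f has_derivative (\<lambda>v. cpartial 1 f z * v$1 + cpartial 2 f z * v$2)) (at z)"
proof -
  obtain f' where f': "(f has_derivative f') (at z)" and lin: "\<And>c v. f' (c *s v) = c * f' v"
    using assms unfolding holomorphic2_on_def by metis
  have eq: "frechet_derivative f (at z) = f'" using frechet_derivative_at[OF f'] by simp
  have add: "f' (u + v) = f' u + f' v" for u v
    using f' by (simp add: has_derivative_def linear_simps)
  have "f' v = cpartial 1 f z * v$1 + cpartial 2 f z * v$2" for v
    by (subst vec2_decompose) (simp add: add lin cpartial_def eq mult.commute del: vec.scale_one)
  then have "f' = (\<lambda>v. cpartial 1 f z * v$1 + cpartial 2 f z * v$2)" by auto
  then show ?thesis using f' by simp
qed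

lemma cpartial_eqI:
  assumes "(f has_derivative (\<lambda>v. A 1 * v$1 + A 2 * v$2)) (at z)"
  shows "cpartial a f z = A a"
proof -
  have "a = 1 \<or> a = 2" by (rule exhaust_2)
  then show ?thesis
    unfolding cpartial_def frechet_derivative_at[OF assms, symmetric] by (auto simp: axis_def)
qed

lemma holomorphic2_on_subset: "holomorphic2_on f S \<Longrightarrow> T \<subseteq> S \<Longrightarrow> holomorphic2_on f T"
  by (auto simp: holomorphic2_on_def)

lemma holomorphic2_on_imp_continuous_on: "holomorphic2_on f S \<Longrightarrow> continuous_on S f"
  by (intro continuous_at_imp_continuous_on ballI has_derivative_continuous[OF holomorphic2_on_has_derivative])

lemma holomorphic2_onI:
  assumes "\<And>z. z \<in> S \<Longrightarrow> (f has_derivative (\<lambda>v. A z * v$1 + B z * v$2)) (at z)"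
  shows "holomorphic2_on f S"
  unfolding holomorphic2_on_def
proof
  fix z assume "z \<in> S"
  then show "\<exists>f'. (f has_derivative f') (at z) \<and> (\<forall>c v. f' (c *s v) = c * f' v)"
    by (intro exI[of _ "\<lambda>v. A z * v$1 + B z * v$2"] conjI assms) (auto simp: algebra_simps)
qed

lemma holomorphic2_on_const: "holomorphic2_on (\<lambda>z. c) S"
  unfolding holomorphic2_on_def by (intro ballI exI[of _ "\<lambda>v. 0"]) auto

lemma holomorphic2_on_coord: "holomorphic2_on (\<lambda>z. z $ i) S"
  unfolding holomorphic2_on_def
  by (intro ballI exI[of _ "\<lambda>v. v$i"]) (auto intro!: bounded_linear_imp_has_derivative bounded_linear_vec_nth)

lemma holomorphic2_on_add:
  assumes "holomorphic2_on f S" "holomorphic2_on g S"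
  shows "holomorphic2_on (\<lambda>z. f z + g z) S"
  unfolding holomorphic2_on_def
proof
  fix z assume z: "z \<in> S"
  show "\<exists>f'. ((\<lambda>z. f z + g z) has_derivative f') (at z) \<and> (\<forall>c v. f' (c *s v) = c * f' v)"
    using holomorphic2_on_has_derivative[OF assms(1) z] holomorphic2_on_has_derivative[OF assms(2) z]
    by (intro exI[of _ "\<lambda>v. (cpartial 1 f z * v$1 + cpartial 2 f z * v$2) + (cpartial 1 g z * v$1 + cpartial 2 g z * v$2)"] conjI has_derivative_add)
       (auto simp: algebra_simps)
qed

lemma holomorphic2_on_mult:
  assumes "holomorphic2_on f S" "holomorphic2_on g S"
  shows "holomorphic2_on (\<lambda>z. f z * g z) S"
  unfolding holomorphic2_on_def
proof
  fix z assume z: "z \<in> S"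
  show "\<exists>f'. ((\<lambda>z. f z * g z) has_derivative f') (at z) \<and> (\<forall>c v. f' (c *s v) = c * f' v)"
    using holomorphic2_on_has_derivative[OF assms(1) z] holomorphic2_on_has_derivative[OF assms(2) z]
    by (intro exI[of _ "\<lambda>v. f z * (cpartial 1 g z * v$1 + cpartial 2 g z * v$2) + (cpartial 1 f z * v$1 + cpartial 2 f z * v$2) * g z"] conjI has_derivative_mult)
       (auto simp: algebra_simps)
qed

lemma holomorphic2_on_inverse:
  assumes "holomorphic2_on f S" "\<And>z. z \<in> S \<Longrightarrow> f z \<noteq> 0"
  shows "holomorphic2_on (\<lambda>z. inverse (f z)) S"
  unfolding holomorphic2_on_def
proof
  fix z assume z: "z \<in> S"
  show "\<exists>f'. ((\<lambda>z. inverse (f z)) has_derivative f') (at z) \<and> (\<forall>c v. f' (c *s v) = c * f' v)"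
    using holomorphic2_on_has_derivative[OF assms(1) z] assms(2)[OF z]
    by (intro exI[of _ "\<lambda>v. - (inverse (f z) * (cpartial 1 f z * v$1 + cpartial 2 f z * v$2) * inverse (f z))"] conjI Deriv.has_derivative_inverse)
       (auto simp: algebra_simps)
qed

lemma holomorphic2_on_diff:
  "holomorphic2_on f S \<Longrightarrow> holomorphic2_on g S \<Longrightarrow> holomorphic2_on (\<lambda>z. f z - g z) S"
  using holomorphic2_on_add[of f S "\<lambda>z. - 1 * g z"] holomorphic2_on_mult[OF holomorphic2_on_const[of "-1"], of g S]
  by simp

lemma holomorphic2_on_power: "holomorphic2_on f S \<Longrightarrow> holomorphic2_on (\<lambda>z. f z ^ n) S"
  by (induction n) (auto intro: holomorphic2_on_const holomorphic2_on_mult)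

lemma holomorphic2_on_sum:
  "(\<And>i. i \<in> I \<Longrightarrow> holomorphic2_on (f i) S) \<Longrightarrow> holomorphic2_on (\<lambda>z. \<Sum>i\<in>I. f i z) S"
  by (induction I rule: infinite_finite_induct) (auto intro: holomorphic2_on_const holomorphic2_on_add)

lemma holomorphic2_on_divide:
  "holomorphic2_on f S \<Longrightarrow> holomorphic2_on g S \<Longrightarrow> (\<And>z. z \<in> S \<Longrightarrow> g z \<noteq> 0) \<Longrightarrow>
   holomorphic2_on (\<lambda>z. f z / g z) S"
  unfolding divide_inverse by (intro holomorphic2_on_mult holomorphic2_on_inverse)

lemmas holomorphic2_intros = holomorphic2_on_const holomorphic2_on_coord holomorphic2_on_add
  holomorphic2_on_diff holomorphic2_on_mult holomorphic2_on_power holomorphic2_on_sum holomorphic2_on_divide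

lemma norm_axis: "norm (axis a (c::complex) :: complex^2) = cmod c"
  using exhaust_2[of a] by (auto simp: norm_vec_def L2_set_def sum_2 axis_def)

lemma axis_0: "axis a 0 = (0 :: complex^2)"
  by (simp add: vec_eq_iff axis_def)

lemma half_ball_subset: "x \<in> ball c (r/2) \<Longrightarrow> ball x (r/2) \<subseteq> ball c (r::real)"
proof
  fix y assume "x \<in> ball c (r/2)" "y \<in> ball x (r/2)"
  then show "y \<in> ball c r" using dist_triangle[of c y x] by auto
qed

lemma bounded_linear_smult: "bounded_linear (\<lambda>t. t *s (v :: complex^2))"
  by (rule bounded_linear_intro[where K="norm v"])
     (auto simp: vec_eq_iff algebra_simps norm_vec_def L2_set_def norm_mult power_mult_distrib
        real_sqrt_mult sum_distrib_left[symmetric])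

lemma slice_derivative:
  assumes "holomorphic2_on f S" "z + t *s v \<in> S"
  shows "((\<lambda>t. f (z + t *s v)) has_field_derivative 
           (cpartial 1 f (z + t *s v) * v$1 + cpartial 2 f (z + t *s v) * v$2)) (at t)"
proof -
  have 1: "((\<lambda>t. z + t *s v) has_derivative (\<lambda>t. t *s v)) (at t)"
    using bounded_linear_imp_has_derivative[OF bounded_linear_smult] 
    by (auto intro!: derivative_eq_intros)
  have "((\<lambda>t. f (z + t *s v)) has_derivative (\<lambda>s. cpartial 1 f (z + t *s v) * (s *s v)$1 + cpartial 2 f (z + t *s v) * (s *s v)$2)) (at t)"
    using has_derivative_compose[OF 1 holomorphic2_on_has_derivative[OF assms]] by simp
  moreover have "(\<lambda>s. cpartial 1 f (z + t *s v) * (s *s v)$1 + cpartial 2 f (z + t *s v) * (s *s v)$2) =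
     (*) (cpartial 1 f (z + t *s v) * v$1 + cpartial 2 f (z + t *s v) * v$2)"
    by (auto simp: algebra_simps)
  ultimately show ?thesis
    by (simp add: has_field_derivative_def)
qed

lemma slice_holomorphic:
  assumes "holomorphic2_on f S" "\<And>t. t \<in> T \<Longrightarrow> z + t *s v \<in> S"
  shows "(\<lambda>t. f (z + t *s v)) holomorphic_on T"
  unfolding holomorphic_on_def field_differentiable_def
  using slice_derivative[OF assms(1) assms(2)] has_field_derivative_at_within by blast

lemma slice_axis_holomorphic:
  assumes "holomorphic2_on f S" "\<And>t. t \<in> T \<Longrightarrow> z + axis a t \<in> S"
  shows "(\<lambda>t. f (z + axis a t)) holomorphic_on T"
proof -
  have e: "(t *s axis a 1 :: complex^2) = axis a t" for t by (rule axis_smult[symmetric])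
  show ?thesis using slice_holomorphic[OF assms(1), of T z "axis a 1"] assms(2) by (simp add: e)
qed

lemma cpartial_deriv_slice:
  assumes "holomorphic2_on f S" "z + axis a t \<in> S"
  shows "deriv (\<lambda>t. f (z + axis a t)) t = cpartial a f (z + axis a t)"
proof -
  have a: "a = 1 \<or> a = 2" by (rule exhaust_2)
  have e: "axis a t = t *s axis a 1" for t :: complex by (rule axis_smult)
  have "((\<lambda>t. f (z + axis a t)) has_field_derivative cpartial a f (z + axis a t)) (at t)"
    using slice_derivative[OF assms(1), of z t "axis a 1"] assms(2) a
    by (auto simp: e[symmetric]) (auto simp: axis_def)
  then show ?thesis by (rule DERIV_imp_deriv)
qed

lemma deriv_bound:
  assumes "f holomorphic_on ball c r" "r > 0" "\<And>x. x \<in> ball c r \<Longrightarrow> cmod (f x) \<le> M"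
  shows "cmod (deriv f c) \<le> 2 * M / r" and "cmod (deriv (deriv f) c) \<le> 8 * M / r\<^sup>2"
proof -
  have h: "f holomorphic_on ball c (r/2)" "continuous_on (cball c (r/2)) f"
    using assms(1,2) by (auto intro!: holomorphic_on_subset[OF assms(1)] 
       continuous_on_subset[OF holomorphic_on_imp_continuous_on[OF assms(1)]])
  have "cmod ((deriv ^^ n) f c) \<le> fact n * M / (r/2) ^ n" for n
    by (rule Cauchy_inequality[OF h]) (use assms(2) in \<open>auto intro!: assms(3) simp: dist_norm norm_minus_commute\<close>)
  from this[of 1] this[of 2] assms(2)
  show "cmod (deriv f c) \<le> 2 * M / r" "cmod (deriv (deriv f) c) \<le> 8 * M / r\<^sup>2"
    by (auto simp: numeral_2_eq_2 field_simps)
qed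

lemma lipschitz_bound:
  assumes "f holomorphic_on ball 0 r" "r > 0" "\<And>x. x \<in> ball 0 r \<Longrightarrow> cmod (f x) \<le> M"
     and "cmod h < r/2"
  shows "cmod (f h - f 0) \<le> 4 * M / r * cmod h"
proof -
  have "cmod (f h - f 0) \<le> 4 * M / r * cmod (h - 0)"
  proof (rule field_differentiable_bound[where S = "ball 0 (r/2)"])
    fix x :: complex assume x: "x \<in> ball 0 (r/2)"
    have sub: "ball x (r/2) \<subseteq> ball 0 r" by (rule half_ball_subset[OF x])
    then have "cmod (deriv f x) \<le> 2 * M / (r/2)"
      by (intro deriv_bound(1)) (use assms in \<open>auto intro: holomorphic_on_subset\<close>)
    then show "cmod (deriv f x) \<le> 4 * M / r" by simp
    have "x \<in> ball 0 r" using x assms(2) by simp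
    then show "(f has_field_derivative deriv f x) (at x within ball 0 (r/2))"
      using holomorphic_derivI[OF assms(1)] has_field_derivative_at_within by blast
  qed (use assms in auto)
  then show ?thesis by simp
qed

lemma taylor_bound:
  assumes "f holomorphic_on ball 0 r" "r > 0" "\<And>x. x \<in> ball 0 r \<Longrightarrow> cmod (f x) \<le> M"
     and "cmod h < r/2"
  shows "cmod (f h - f 0 - deriv f 0 * h) \<le> 32 * M / r\<^sup>2 * (cmod h)\<^sup>2"
proof -
  have h: "deriv f holomorphic_on ball 0 r" by (rule holomorphic_deriv[OF assms(1)]) auto
  have "cmod ((deriv ^^ 0) f h - (\<Sum>i\<le>1. (deriv ^^ i) f 0 * (h - 0) ^ i / fact i)) \<le> 32 * M / r\<^sup>2 * cmod (h - 0) ^ Suc 1 / fact 1"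
  proof (rule complex_Taylor[where S = "ball 0 (r/2)"])
    fix x :: complex assume x: "x \<in> ball 0 (r/2)"
    have sub: "ball x (r/2) \<subseteq> ball 0 r" by (rule half_ball_subset[OF x])
    then have "cmod (deriv (deriv f) x) \<le> 8 * M / (r/2)\<^sup>2"
      by (intro deriv_bound(2)) (use assms in \<open>auto intro: holomorphic_on_subset\<close>)
    then show "cmod ((deriv ^^ Suc 1) f x) \<le> 32 * M / r\<^sup>2" by (simp add: field_simps)
  next
    fix i x assume i: "i \<le> (1::nat)" and x: "x \<in> ball (0::complex) (r/2)"
    have x: "x \<in> ball 0 r" using x assms(2) by simp
    have "i = 0 \<or> i = 1" using i by auto
    then show "((deriv ^^ i) f has_field_derivative (deriv ^^ Suc i) f x) (at x within ball 0 (r/2))"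
      using has_field_derivative_at_within[OF holomorphic_derivI[OF assms(1) _ x]]
        has_field_derivative_at_within[OF holomorphic_derivI[OF h _ x]] by auto
  qed (use assms in auto)
  then show ?thesis by (simp add: power2_eq_square algebra_simps)
qed

text \<open>
  The error in the first-order expansion of a bounded separately holomorphic function is quadratic.
  It splits into a one-variable Taylor error in each direction and the variation of the partial
  derivative in the first variable along the second one; the last is controlled because a bounded
  holomorphic function of the second variable is Lipschitz and Cauchy's estimate transfers this to the
  derivative in the first. The derivative in the first variable is a uniform limit of difference
  quotients, hence holomorphic in the second.
\<close>

lemma separately_holomorphic_bounds:
  fixes g :: "complex \<Rightarrow> complex \<Rightarrow> complex"
  assumes r: "r > 0"
    and h1: "\<And>t. t \<in> ball 0 r \<Longrightarrow> (\<lambda>s. g s t) holomorphic_on ball 0 r"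
    and h2: "\<And>s. s \<in> ball 0 r \<Longrightarrow> (\<lambda>t. g s t) holomorphic_on ball 0 r"
    and M: "\<And>s t. s \<in> ball 0 r \<Longrightarrow> t \<in> ball 0 r \<Longrightarrow> cmod (g s t) \<le> M"
  shows osgood_taylor: "\<And>s t. cmod s < r/2 \<Longrightarrow> cmod t < r/2 \<Longrightarrow> 
     cmod (g s t - g 0 0 - (deriv (\<lambda>s. g s 0) 0 * s + deriv (\<lambda>t. g 0 t) 0 * t))
       \<le> 32 * M / r\<^sup>2 * (cmod s)\<^sup>2 + 32 * M / r\<^sup>2 * (cmod t)\<^sup>2 + 8 * M / r\<^sup>2 * cmod s * cmod t"
   and osgood_deriv: "(\<lambda>t. deriv (\<lambda>s. g s t) 0) holomorphic_on ball 0 r"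
proof -
  fix s t :: complex assume s: "cmod s < r/2" and t: "cmod t < r/2"
  have t0: "t \<in> ball 0 r" "0 \<in> ball (0::complex) r" using t r by auto
  define D where "D t = deriv (\<lambda>s. g s t) 0" for t
  have e1: "cmod (g s t - g 0 t - D t * s) \<le> 32 * M / r\<^sup>2 * (cmod s)\<^sup>2"
    unfolding D_def by (rule taylor_bound[OF h1[OF t0(1)] r M s]) (use t0 in auto)
  have e3: "cmod (g 0 t - g 0 0 - deriv (\<lambda>t. g 0 t) 0 * t) \<le> 32 * M / r\<^sup>2 * (cmod t)\<^sup>2"
    by (rule taylor_bound[OF h2[OF t0(2)] r M t]) (use t0 in auto)
  have hol: "(\<lambda>s. g s t - g s 0) holomorphic_on ball 0 r"
    using h1 t0 by (intro holomorphic_intros) auto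
  have "D t - D 0 = deriv (\<lambda>s. g s t - g s 0) 0"
    unfolding D_def using t0
    by (intro deriv_diff[symmetric] holomorphic_on_imp_differentiable_at[OF h1]) auto
  also have "cmod \<dots> \<le> 2 * (4 * M / r * cmod t) / r"
    by (rule deriv_bound(1)[OF hol r], rule lipschitz_bound[OF h2 r _ t]) (use M in auto)
  finally have e2: "cmod (D t - D 0) \<le> 8 * M / r\<^sup>2 * cmod t" by (simp add: power2_eq_square)
  have e2': "cmod ((D t - D 0) * s) \<le> 8 * M / r\<^sup>2 * cmod s * cmod t"
    using mult_right_mono[OF e2, of "cmod s"] by (simp add: norm_mult mult_ac)
  have "g s t - g 0 0 - (D 0 * s + deriv (\<lambda>t. g 0 t) 0 * t) =
     (g s t - g 0 t - D t * s) + (g 0 t - g 0 0 - deriv (\<lambda>t. g 0 t) 0 * t) + (D t - D 0) * s"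
    by (simp add: algebra_simps)
  also have "cmod \<dots> \<le> 32 * M / r\<^sup>2 * (cmod s)\<^sup>2 + 32 * M / r\<^sup>2 * (cmod t)\<^sup>2 + 8 * M / r\<^sup>2 * cmod s * cmod t"
    using e1 e2' e3 by (intro norm_triangle_le add_mono) auto
  finally show "cmod (g s t - g 0 0 - (deriv (\<lambda>s. g s 0) 0 * s + deriv (\<lambda>t. g 0 t) 0 * t))
       \<le> 32 * M / r\<^sup>2 * (cmod s)\<^sup>2 + 32 * M / r\<^sup>2 * (cmod t)\<^sup>2 + 8 * M / r\<^sup>2 * cmod s * cmod t"
    unfolding D_def .
next
  (* Step sizes below r/2, so that the Taylor bound applies to every difference quotient. *)
  define \<delta> where "\<delta> n = r / (real n + 3)" for n :: nat
  have \<delta>: "\<delta> n > 0" "\<delta> n < r/2" for n using r by (auto simp: \<delta>_def field_simps intro!: add_pos_nonneg)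
  have lim: "\<delta> \<longlonglongrightarrow> 0" unfolding \<delta>_def by real_asymp
  define q where "q n t = (g (of_real (\<delta> n)) t - g 0 t) / of_real (\<delta> n)" for n :: nat and t
  have \<delta>b: "complex_of_real (\<delta> n) \<in> ball 0 r" for n using \<delta>[of n] r by simp
  have ql: "cmod (q n t - deriv (\<lambda>s. g s t) 0) \<le> 32 * M / r\<^sup>2 * \<delta> n" if t: "t \<in> ball 0 r" for n t
  proof -
    have "cmod (g (of_real (\<delta> n)) t - g 0 t - deriv (\<lambda>s. g s t) 0 * of_real (\<delta> n)) \<le> 32 * M / r\<^sup>2 * (cmod (of_real (\<delta> n)))\<^sup>2"
      by (rule taylor_bound[OF h1[OF t] r M]) (use t \<delta>[of n] in auto)
    moreover have "g (of_real (\<delta> n)) t - g 0 t - deriv (\<lambda>s. g s t) 0 * of_real (\<delta> n) = 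
        (q n t - deriv (\<lambda>s. g s t) 0) * of_real (\<delta> n)"
      unfolding q_def using \<delta>(1)[of n] by (simp add: field_simps)
    ultimately have "cmod (q n t - deriv (\<lambda>s. g s t) 0) * \<delta> n \<le> (32 * M / r\<^sup>2 * \<delta> n) * \<delta> n"
      using \<delta>(1)[of n] by (simp add: norm_mult power2_eq_square mult.assoc)
    then show ?thesis by (rule mult_right_le_imp_le) (rule \<delta>(1))
  qed
  have ul: "uniform_limit (ball 0 r) q (\<lambda>t. deriv (\<lambda>s. g s t) 0) sequentially"
  proof (rule uniform_limitI)
    fix e :: real assume "e > 0"
    have "(\<lambda>n. 32 * M / r\<^sup>2 * \<delta> n) \<longlonglongrightarrow> 0" using tendsto_mult_right_zero[OF lim, of "32 * M / r\<^sup>2"] by simp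
    then have "\<forall>\<^sub>F n in sequentially. 32 * M / r\<^sup>2 * \<delta> n < e" using \<open>e > 0\<close> by (rule order_tendstoD)
    then show "\<forall>\<^sub>F n in sequentially. \<forall>x\<in>ball 0 r. dist (q n x) (deriv (\<lambda>s. g s x) 0) < e"
    proof eventually_elim
      case (elim n)
      show ?case using ql[of _ n] elim unfolding dist_norm by (blast intro: le_less_trans)
    qed
  qed
  show "(\<lambda>t. deriv (\<lambda>s. g s t) 0) holomorphic_on ball 0 r"
  proof (rule holomorphic_uniform_sequence)
    show "q n holomorphic_on ball 0 r" for n
      unfolding q_def using h2[OF \<delta>b] h2[of 0] r \<delta>(1)[of n] by (intro holomorphic_intros) auto
    fix x :: complex assume "x \<in> ball 0 r"
    then obtain d where "d > 0" "cball x d \<subseteq> ball 0 r" by (meson open_ball open_contains_cball)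
    then show "\<exists>d>0. cball x d \<subseteq> ball 0 r \<and> uniform_limit (cball x d) q (\<lambda>t. deriv (\<lambda>s. g s t) 0) sequentially"
      using uniform_limit_on_subset[OF ul] by blast
  qed auto
qed

lemma bidisc_in_ball:
  assumes "cmod s < r/2" "cmod t < r/2"
  shows "z + (axis 1 s + axis 2 t) \<in> ball (z::complex^2) r"
proof -
  have "norm (axis 1 s + axis 2 t :: complex^2) \<le> cmod s + cmod t"
    by (metis norm_axis norm_triangle_ineq)
  moreover have "dist z (z + (axis 1 s + axis 2 t)) = norm (axis 1 s + axis 2 t :: complex^2)"
    by (metis add_diff_cancel_left' dist_commute dist_norm)
  ultimately show ?thesis using assms by simp
qed

text \<open>
  Osgood's lemma: local boundedness turns holomorphy along the coordinate directions into complex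
  differentiability, by the quadratic error bound above.
\<close>

lemma osgood:
  fixes f :: "complex^2 \<Rightarrow> complex"
  assumes S: "open S"
    and sl: "\<And>z a. z \<in> S \<Longrightarrow> (\<lambda>t. f (z + axis a t)) field_differentiable at 0"
    and lb: "\<And>z. z \<in> S \<Longrightarrow> \<exists>r>0. \<exists>M. \<forall>w\<in>ball z r. cmod (f w) \<le> M"
  shows "holomorphic2_on f S"
proof (rule holomorphic2_onI)
  fix z assume z: "z \<in> S"
  obtain r1 where r1: "r1 > 0" "ball z r1 \<subseteq> S" using S z openE by blast
  obtain r2 M where r2: "r2 > 0" "\<And>w. w \<in> ball z r2 \<Longrightarrow> cmod (f w) \<le> M" using lb[OF z] by blast
  define r where "r = min r1 r2 / 2"
  have r: "r > 0" using r1 r2 by (simp add: r_def)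
  define g where "g s t = f (z + (axis 1 s + axis 2 t))" for s t
  have inb: "z + (axis 1 s + axis 2 t) \<in> ball z r1 \<inter> ball z r2" if "s \<in> ball 0 r" "t \<in> ball 0 r" for s t
    using bidisc_in_ball[of s "min r1 r2" t z] that r1 r2 by (auto simp: r_def)
  have d1: "(\<lambda>s. g s t) holomorphic_on ball 0 r" if t: "t \<in> ball 0 r" for t
  proof -
    have "(\<lambda>s. g s t) field_differentiable at s" if s: "s \<in> ball 0 r" for s
    proof -
      have "(\<lambda>x. f ((z + (axis 1 s + axis 2 t)) + axis 1 x)) field_differentiable at (s - s)"
        using sl[of "z + (axis 1 s + axis 2 t)" 1] inb[OF s t] r1 by auto
      then have "((\<lambda>x. f ((z + (axis 1 s + axis 2 t)) + axis 1 x)) \<circ> (\<lambda>x. x - s)) field_differentiable at s"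
        by (intro field_differentiable_compose) (auto intro!: derivative_intros)
      moreover have "((\<lambda>x. f ((z + (axis 1 s + axis 2 t)) + axis 1 x)) \<circ> (\<lambda>x. x - s)) = (\<lambda>s. g s t)"
        by (auto simp: g_def fun_eq_iff intro!: arg_cong[of _ _ f]) (simp add: vec2_eq_iff axis_def)
      ultimately show ?thesis by simp
    qed
    then show ?thesis by (simp add: holomorphic_on_def field_differentiable_at_within)
  qed
  have d2: "(\<lambda>t. g s t) holomorphic_on ball 0 r" if s: "s \<in> ball 0 r" for s
  proof -
    have "(\<lambda>t. g s t) field_differentiable at t" if t: "t \<in> ball 0 r" for t
    proof -
      have "(\<lambda>x. f ((z + (axis 1 s + axis 2 t)) + axis 2 x)) field_differentiable at (t - t)"
        using sl[of "z + (axis 1 s + axis 2 t)" 2] inb[OF s t] r1 by auto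
      then have "((\<lambda>x. f ((z + (axis 1 s + axis 2 t)) + axis 2 x)) \<circ> (\<lambda>x. x - t)) field_differentiable at t"
        by (intro field_differentiable_compose) (auto intro!: derivative_intros)
      moreover have "((\<lambda>x. f ((z + (axis 1 s + axis 2 t)) + axis 2 x)) \<circ> (\<lambda>x. x - t)) = (\<lambda>t. g s t)"
        by (auto simp: g_def fun_eq_iff intro!: arg_cong[of _ _ f]) (simp add: vec2_eq_iff axis_def)
      ultimately show ?thesis by simp
    qed
    then show ?thesis by (simp add: holomorphic_on_def field_differentiable_at_within)
  qed
  have Mb: "cmod (g s t) \<le> M" if "s \<in> ball 0 r" "t \<in> ball 0 r" for s t
    using r2(2) inb[OF that] by (auto simp: g_def)
  have M0: "M \<ge> 0" using Mb[of 0 0] r by (meson centre_in_ball norm_ge_zero order_trans)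
  define A where "A = deriv (\<lambda>s. g s 0) 0"
  define B where "B = deriv (\<lambda>t. g 0 t) 0"
  define C where "C = 72 * M / r\<^sup>2"
  have C0: "C \<ge> 0" using M0 by (simp add: C_def)
  have est: "cmod (f (z + h) - f z - (A * h$1 + B * h$2)) \<le> C * (norm h)\<^sup>2" if h: "norm h < r/2" for h
  proof -
    have hn: "cmod (h$1) \<le> norm h" "cmod (h$2) \<le> norm h" by (rule Finite_Cartesian_Product.norm_nth_le)+
    have hh: "h = axis 1 (h$1) + axis 2 (h$2)" by (simp add: vec2_eq_iff axis_def)
    have "cmod (g (h$1) (h$2) - g 0 0 - (A * h$1 + B * h$2)) \<le> 
       32 * M / r\<^sup>2 * (cmod (h$1))\<^sup>2 + 32 * M / r\<^sup>2 * (cmod (h$2))\<^sup>2 + 8 * M / r\<^sup>2 * cmod (h$1) * cmod (h$2)"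
      unfolding A_def B_def by (rule osgood_taylor[OF r d1 d2 Mb]) (use hn h in auto)
    also have "\<dots> \<le> 32 * M / r\<^sup>2 * (norm h)\<^sup>2 + 32 * M / r\<^sup>2 * (norm h)\<^sup>2 + 8 * M / r\<^sup>2 * norm h * norm h"
      using hn M0 by (intro add_mono mult_mono power_mono) auto
    also have "\<dots> = C * (norm h)\<^sup>2" by (simp add: C_def power2_eq_square algebra_simps add_divide_distrib[symmetric])
    finally have "cmod (f (z + (axis 1 (h$1) + axis 2 (h$2))) - f (z + (axis 1 0 + axis 2 0)) - (A * h$1 + B * h$2)) \<le> C * (norm h)\<^sup>2"
      by (simp add: g_def)
    moreover have "axis 1 0 + axis 2 0 = (0 :: complex^2)" by (simp add: vec2_eq_iff axis_def)
    ultimately show ?thesis using hh by simp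
  qed
  show "(f has_derivative (\<lambda>v. A * v$1 + B * v$2)) (at z)"
    unfolding has_derivative_at_alt
  proof (intro conjI allI impI)
    show "bounded_linear (\<lambda>v. A * v$1 + B * v$2)"
      by (intro bounded_linear_add bounded_linear_const_mult bounded_linear_vec_nth)
    fix e :: real assume e: "e > 0"
    show "\<exists>d>0. \<forall>y. norm (y - z) < d \<longrightarrow> norm (f y - f z - (A * (y - z)$1 + B * (y - z)$2)) \<le> e * norm (y - z)"
    proof (intro exI[of _ "min (r/2) (e/(C+1))"] conjI allI impI)
      show "min (r/2) (e/(C+1)) > 0" using r e C0 by simp
      fix y assume y: "norm (y - z) < min (r/2) (e/(C+1))"
      have "norm (y - z) * (C + 1) \<le> e" using y C0 by (simp add: pos_less_divide_eq)
      then have ce: "C * norm (y - z) \<le> e" using mult_left_mono[of C "C+1" "norm (y-z)"] by (simp add: mult.commute)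
      have "norm (f y - f z - (A * (y - z)$1 + B * (y - z)$2)) \<le> C * (norm (y-z))\<^sup>2"
        using est[of "y - z"] y by simp
      also have "\<dots> \<le> e * norm (y - z)" using mult_right_mono[OF ce, of "norm (y - z)"] by (simp add: power2_eq_square mult_ac)
      finally show "norm (f y - f z - (A * (y - z)$1 + B * (y - z)$2)) \<le> e * norm (y - z)" .
    qed
  qed
qed

lemma cpartial_bound:
  assumes "holomorphic2_on f S" "ball z r \<subseteq> S" "r > 0" "\<And>w. w \<in> ball z r \<Longrightarrow> cmod (f w) \<le> M"
  shows "cmod (cpartial a f z) \<le> 2 * M / r"
proof -
  have in': "z + axis a t \<in> ball z r" if "t \<in> ball 0 r" for t :: complex
    using that by (simp add: dist_norm norm_axis)
  have h: "(\<lambda>t. f (z + axis a t)) holomorphic_on ball 0 r"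
    by (rule slice_axis_holomorphic[OF assms(1)]) (use in' assms(2) in auto)
  have "cmod (deriv (\<lambda>t. f (z + axis a t)) 0) \<le> 2 * M / r"
    by (rule deriv_bound(1)[OF h assms(3)]) (use in' assms(4) in auto)
  moreover have "z \<in> S" using assms(2,3) by auto
  ultimately show ?thesis using cpartial_deriv_slice[OF assms(1), of z a 0] by (simp add: axis_0)
qed

lemma holomorphic2_locally_bounded:
  fixes f :: "complex^2 \<Rightarrow> complex"
  assumes "continuous_on S f" "open S" "z \<in> S"
  shows "\<exists>r>0. ball z r \<subseteq> S \<and> (\<exists>M. \<forall>w\<in>ball z r. cmod (f w) \<le> M)"
proof -
  obtain r where r: "r > 0" "cball z r \<subseteq> S" using assms open_contains_cball by blast
  have "compact (f ` cball z r)" 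
    by (rule compact_continuous_image[OF continuous_on_subset[OF assms(1) r(2)] compact_cball])
  then obtain M where "\<forall>x\<in>f ` cball z r. cmod x \<le> M" using compact_imp_bounded bounded_iff by metis
  then show ?thesis using r by (intro exI[of _ r]) (auto intro!: exI[of _ M])
qed

text \<open>
  The derivative in direction \<open>a\<close> is locally bounded by Cauchy's estimate. It is holomorphic in
  direction \<open>a\<close> as a derivative of a function of one variable and in the other direction as a limit of
  difference quotients, so Osgood's lemma applies.
\<close>

lemma holomorphic2_on_cpartial:
  assumes f: "holomorphic2_on f S" and S: "open S"
  shows "holomorphic2_on (cpartial a f) S"
proof (rule osgood[OF S])
  fix z assume z: "z \<in> S"
  obtain r M where r: "r > 0" "ball z r \<subseteq> S" "\<And>w. w \<in> ball z r \<Longrightarrow> cmod (f w) \<le> M"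
    using holomorphic2_locally_bounded[OF holomorphic2_on_imp_continuous_on[OF f] S z] by blast
  have "cmod (cpartial a f w) \<le> 2 * M / (r/2)" if w: "w \<in> ball z (r/2)" for w
  proof -
    have "ball w (r/2) \<subseteq> ball z r" by (rule half_ball_subset[OF w])
    then show ?thesis using r by (intro cpartial_bound[OF f]) auto
  qed
  then show "\<exists>r>0. \<exists>M. \<forall>w\<in>ball z r. cmod (cpartial a f w) \<le> M" using r(1) half_gt_zero by blast
next
  fix z b assume z: "z \<in> S"
  obtain r M where r: "r > 0" "ball z r \<subseteq> S" "\<And>w. w \<in> ball z r \<Longrightarrow> cmod (f w) \<le> M"
    using holomorphic2_locally_bounded[OF holomorphic2_on_imp_continuous_on[OF f] S z] by blast
  show "(\<lambda>t. cpartial a f (z + axis b t)) field_differentiable at 0"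
  proof (cases "a = b")
    case True
    have in': "z + axis b t \<in> S" if "t \<in> ball 0 r" for t :: complex
      using that r(2) by (auto simp: dist_norm norm_axis)
    have "(\<lambda>t. f (z + axis b t)) holomorphic_on ball 0 r"
      by (rule slice_axis_holomorphic[OF f]) (use in' in auto)
    then have "deriv (\<lambda>t. f (z + axis b t)) holomorphic_on ball 0 r" by (rule holomorphic_deriv) auto
    then have "(\<lambda>t. cpartial a f (z + axis b t)) holomorphic_on ball 0 r"
      by (rule holomorphic_transform) (use in' True cpartial_deriv_slice[OF f] in auto)
    then show ?thesis using r(1) by (intro holomorphic_on_imp_differentiable_at) auto
  next
    case False
    define R where "R = r/2"
    have R: "R > 0" using r by (simp add: R_def)
    have in': "z + (axis a s + axis b t) \<in> ball z r" if "s \<in> ball 0 R" "t \<in> ball 0 R" for s t :: complex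
    proof -
      have "norm (axis a s + axis b t :: complex^2) \<le> cmod s + cmod t"
        by (metis norm_axis norm_triangle_ineq)
      moreover have "dist z (z + (axis a s + axis b t)) = norm (axis a s + axis b t :: complex^2)"
        by (metis add_diff_cancel_left' dist_commute dist_norm)
      ultimately show ?thesis using that by (simp add: R_def)
    qed
    define g where "g s t = f (z + (axis a s + axis b t))" for s t
    have "(\<lambda>t. deriv (\<lambda>s. g s t) 0) holomorphic_on ball 0 R"
    proof (rule osgood_deriv[OF R])
      show "(\<lambda>s. g s t) holomorphic_on ball 0 R" if t: "t \<in> ball 0 R" for t
      proof -
        have "(\<lambda>s. f ((z + axis b t) + axis a s)) holomorphic_on ball 0 R"
          by (rule slice_axis_holomorphic[OF f]) (use in'[OF _ t] r(2) in \<open>auto simp: add_ac\<close>)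
        then show ?thesis by (simp add: g_def add_ac)
      qed
      show "(\<lambda>t. g s t) holomorphic_on ball 0 R" if s: "s \<in> ball 0 R" for s
      proof -
        have "(\<lambda>t. f ((z + axis a s) + axis b t)) holomorphic_on ball 0 R"
          by (rule slice_axis_holomorphic[OF f]) (use in'[OF s] r(2) in \<open>auto simp: add_ac\<close>)
        then show ?thesis by (simp add: g_def add_ac)
      qed
      show "cmod (g s t) \<le> M" if "s \<in> ball 0 R" "t \<in> ball 0 R" for s t
        using r(3) in'[OF that] by (simp add: g_def)
    qed
    then have "(\<lambda>t. cpartial a f (z + axis b t)) holomorphic_on ball 0 R"
    proof (rule holomorphic_transform)
      fix t :: complex assume t: "t \<in> ball 0 R"
      have "z + axis b t \<in> S" using in'[of 0 t] t R r(2) by (auto simp: axis_0)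
      then show "deriv (\<lambda>s. g s t) 0 = cpartial a f (z + axis b t)"
        using cpartial_deriv_slice[OF f, of "z + axis b t" a 0] by (simp add: g_def axis_0 add_ac)
    qed
    then show ?thesis using R by (intro holomorphic_on_imp_differentiable_at) auto
  qed
qed

lemma holomorphic2_uniform_limit:
  assumes S: "open S" and F: "F \<noteq> bot"
    and hol: "\<forall>\<^sub>F n in F. holomorphic2_on (f n) S"
    and ul: "\<And>z. z \<in> S \<Longrightarrow> \<exists>r>0. uniform_limit (ball z r) f g F"
  shows "holomorphic2_on g S"
proof (rule osgood[OF S])
  fix z assume z: "z \<in> S"
  obtain r1 where r1: "r1 > 0" "uniform_limit (ball z r1) f g F" using ul[OF z] by blast
  obtain r2 where r2: "r2 > 0" "ball z r2 \<subseteq> S" using S z openE by blast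
  define r where "r = min r1 r2"
  have r: "r > 0" "ball z r \<subseteq> S" using r1 r2 by (auto simp: r_def)
  have u: "uniform_limit (ball z r) f g F" by (rule uniform_limit_on_subset[OF r1(2)]) (auto simp: r_def)
  have "\<forall>\<^sub>F n in F. continuous_on (ball z r) (f n)"
    using hol by eventually_elim (use r in \<open>auto intro: holomorphic2_on_imp_continuous_on holomorphic2_on_subset\<close>)
  then have c: "continuous_on (ball z r) g" by (rule uniform_limit_theorem[OF _ u F])
  show "\<exists>r>0. \<exists>M. \<forall>w\<in>ball z r. cmod (g w) \<le> M"
    using holomorphic2_locally_bounded[OF c] r by (metis centre_in_ball open_ball)
  fix a
  have in': "z + axis a t \<in> ball z r" if "t \<in> cball 0 (r/2)" for t :: complex
    using that r by (simp add: dist_norm norm_axis)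
  have "\<forall>\<^sub>F n in F. continuous_on (cball 0 (r/2)) (\<lambda>t. f n (z + axis a t)) \<and> (\<lambda>t. f n (z + axis a t)) holomorphic_on ball 0 (r/2)"
    using hol
  proof eventually_elim
    case (elim n)
    have "(\<lambda>t. f n (z + axis a t)) holomorphic_on cball 0 (r/2)"
      by (rule slice_axis_holomorphic[OF elim]) (use in' r in auto)
    then show ?case by (auto intro: holomorphic_on_imp_continuous_on holomorphic_on_subset)
  qed
  moreover have "uniform_limit (cball 0 (r/2)) (\<lambda>n t. f n (z + axis a t)) (\<lambda>t. g (z + axis a t)) F"
    unfolding uniform_limit_iff
  proof (intro allI impI)
    fix e :: real assume "e > 0"
    then have "\<forall>\<^sub>F n in F. \<forall>x\<in>ball z r. dist (f n x) (g x) < e" using u by (simp add: uniform_limit_iff)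
    then show "\<forall>\<^sub>F n in F. \<forall>x\<in>cball 0 (r/2). dist (f n (z + axis a x)) (g (z + axis a x)) < e"
      by eventually_elim (use in' in blast)
  qed
  ultimately obtain "(\<lambda>t. g (z + axis a t)) holomorphic_on ball 0 (r/2)"
    using holomorphic_uniform_limit[OF _ _ F, of 0 "r/2" "\<lambda>n t. f n (z + axis a t)" "\<lambda>t. g (z + axis a t)"] by metis
  then show "(\<lambda>t. g (z + axis a t)) field_differentiable at 0"
    using r by (intro holomorphic_on_imp_differentiable_at) auto
qed

section \<open>Invariance of the hyperbolic measure\<close>

text \<open>
  The change of variables theorem is about real coordinate spaces, so the complex plane squared is
  identified with them by this isometry.
\<close>

definition to_C2 :: "real^4 \<Rightarrow> complex^2" where
  "to_C2 x = (\<chi> i. if i = 1 then Complex (x$1) (x$2) else Complex (x$3) (x$4))"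

definition of_C2 :: "complex^2 \<Rightarrow> real^4" where
  "of_C2 z = (\<chi> i. if i = 1 then Re (z$1) else if i = 2 then Im (z$1) else if i = 3 then Re (z$2) else Im (z$2))"

lemma of_C2_nth: "of_C2 z $ 1 = Re (z$1)" "of_C2 z $ 2 = Im (z$1)" "of_C2 z $ 3 = Re (z$2)" "of_C2 z $ 4 = Im (z$2)"
  by (simp_all add: of_C2_def)

lemma to_C2_nth: "to_C2 x $ 1 = Complex (x$1) (x$2)" "to_C2 x $ 2 = Complex (x$3) (x$4)"
  by (simp_all add: to_C2_def)

lemma to_of_C2 [simp]: "to_C2 (of_C2 z) = z"
  by (simp add: vec2_eq_iff to_C2_nth of_C2_nth)

lemma of_to_C2 [simp]: "of_C2 (to_C2 z) = z"
  by (simp add: vec_eq_iff forall_4 to_C2_nth of_C2_nth)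

lemma bounded_linear_to_C2: "bounded_linear to_C2"
  by (rule linear_conv_bounded_linear[THEN iffD1])
     (auto intro!: linearI simp: vec2_eq_iff to_C2_nth complex_eq_iff)

lemma bounded_linear_of_C2: "bounded_linear of_C2"
  by (rule linear_conv_bounded_linear[THEN iffD1])
     (auto intro!: linearI simp: vec_eq_iff forall_4 of_C2_nth)

lemma measurable_of_C2 [measurable]: "of_C2 \<in> borel_measurable borel"
  by (intro borel_measurable_continuous_onI linear_continuous_on bounded_linear_of_C2)

lemma measurable_to_C2 [measurable]: "to_C2 \<in> borel_measurable borel"
  by (intro borel_measurable_continuous_onI linear_continuous_on bounded_linear_to_C2)

lemma Basis_R4: "(Basis :: (real^4) set) = {axis 1 1, axis 2 1, axis 3 1, axis 4 1}"
  by (auto simp: Basis_vec_def UNIV_4)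

lemma Basis_C2: "(Basis :: (complex^2) set) = {axis 1 1, axis 1 \<i>, axis 2 1, axis 2 \<i>}"
  by (auto simp: Basis_vec_def Basis_complex_def UNIV_2)

lemma of_C2_inner: "of_C2 z \<bullet> of_C2 w = z \<bullet> w"
  by (simp add: inner_vec_def sum_2 sum_4 of_C2_nth inner_complex_def)

lemma Basis_of_C2: "(Basis :: (real^4) set) = of_C2 ` Basis"
  unfolding Basis_R4 Basis_C2 image_insert image_empty
  by (intro arg_cong2[where f=insert] refl) (auto simp: vec_eq_iff forall_4 of_C2_nth axis_def)

lemma inj_of_C2: "inj of_C2"
  by (metis injI to_of_C2)

lemma distr_of_C2: "distr lborel borel of_C2 = lborel"
proof (rule lborel_eqI[symmetric])
  fix l u :: "real^4" assume le: "\<And>b. b \<in> Basis \<Longrightarrow> l \<bullet> b \<le> u \<bullet> b"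
  have iw: "w \<bullet> of_C2 b = to_C2 w \<bullet> b" for w b
    by (metis of_C2_inner of_to_C2)
  have to_diff: "to_C2 (u - l) = to_C2 u - to_C2 l"
    by (simp add: vec2_eq_iff to_C2_nth complex_eq_iff)
  have pre: "of_C2 -` box l u = box (to_C2 l) (to_C2 u)"
    by (auto simp: box_def Basis_of_C2 iw)
  have "emeasure (distr lborel borel of_C2) (box l u) = emeasure lborel (box (to_C2 l) (to_C2 u))"
    by (simp add: emeasure_distr pre)
  also have "\<dots> = (\<Prod>b\<in>Basis. (to_C2 u - to_C2 l) \<bullet> b)"
    by (rule emeasure_lborel_box) (use le in \<open>force simp: Basis_of_C2 iw\<close>)
  also have "(\<Prod>b\<in>Basis. (to_C2 u - to_C2 l) \<bullet> b) = (\<Prod>b\<in>(Basis :: (real^4) set). (u - l) \<bullet> b)"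
    unfolding Basis_of_C2 
    by (subst prod.reindex) (auto simp: inj_on_def iw to_diff dest: injD[OF inj_of_C2])
  finally show "emeasure (distr lborel borel of_C2) (box l u) = (\<Prod>b\<in>Basis. (u - l) \<bullet> b)" .
qed simp

lemma nn_integral_of_C2:
  assumes [measurable]: "f \<in> borel_measurable borel"
  shows "(\<integral>\<^sup>+x. f x \<partial>lborel) = (\<integral>\<^sup>+z. f (of_C2 z) \<partial>lborel)"
  by (subst distr_of_C2[symmetric], subst nn_integral_distr) simp_all

lemma det_4:
  fixes A :: "'a::comm_ring_1^4^4"
  shows "det A = 
    A$1$1 * (A$2$2 * A$3$3 * A$4$4 + A$2$3 * A$3$4 * A$4$2 + A$2$4 * A$3$2 * A$4$3
           - A$2$2 * A$3$4 * A$4$3 - A$2$3 * A$3$2 * A$4$4 - A$2$4 * A$3$3 * A$4$2)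
  - A$1$2 * (A$2$1 * A$3$3 * A$4$4 + A$2$3 * A$3$4 * A$4$1 + A$2$4 * A$3$1 * A$4$3
           - A$2$1 * A$3$4 * A$4$3 - A$2$3 * A$3$1 * A$4$4 - A$2$4 * A$3$3 * A$4$1)
  + A$1$3 * (A$2$1 * A$3$2 * A$4$4 + A$2$2 * A$3$4 * A$4$1 + A$2$4 * A$3$1 * A$4$2
           - A$2$1 * A$3$4 * A$4$2 - A$2$2 * A$3$1 * A$4$4 - A$2$4 * A$3$2 * A$4$1)
  - A$1$4 * (A$2$1 * A$3$2 * A$4$3 + A$2$2 * A$3$3 * A$4$1 + A$2$3 * A$3$1 * A$4$2
           - A$2$1 * A$3$3 * A$4$2 - A$2$2 * A$3$1 * A$4$3 - A$2$3 * A$3$2 * A$4$1)"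
proof -
  have f1: "finite {2::4, 3, 4}" "1 \<notin> {2::4, 3, 4}" by auto
  have f2: "finite {3::4, 4}" "2 \<notin> {3::4, 4}" by auto
  have f3: "finite {4::4}" "3 \<notin> {4::4}" by auto
  show ?thesis
    unfolding det_def UNIV_4
    unfolding sum_over_permutations_insert[OF f1]
    unfolding sum_over_permutations_insert[OF f2]
    unfolding sum_over_permutations_insert[OF f3]
    unfolding permutes_sing
    by (simp add: sign_swap_id permutation_swap_id sign_compose sign_id swap_id_eq permutation_compose algebra_simps)
qed

text \<open>
  This turns the real change of variables formula into one with the complex Jacobian.
\<close>

lemma det_complex_linear:
  fixes a b c d :: complex
  defines "L \<equiv> (\<lambda>v :: complex^2. (\<chi> i. if i = 1 then a * v$1 + b * v$2 else c * v$1 + d * v$2) :: complex^2)"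
  shows "det (matrix (\<lambda>x. of_C2 (L (to_C2 x)))) = (cmod (a * d - b * c))\<^sup>2"
proof -
  have L: "L v $ 1 = a * v$1 + b * v$2" "L v $ 2 = c * v$1 + d * v$2" for v
    by (simp_all add: L_def)
  have cols: "to_C2 (axis 1 1) $ 1 = 1" "to_C2 (axis 1 1) $ 2 = 0" "to_C2 (axis 2 1) $ 1 = \<i>" "to_C2 (axis 2 1) $ 2 = 0"
     "to_C2 (axis 3 1) $ 1 = 0" "to_C2 (axis 3 1) $ 2 = 1" "to_C2 (axis 4 1) $ 1 = 0" "to_C2 (axis 4 1) $ 2 = \<i>"
    by (simp_all add: to_C2_nth axis_def complex_eq_iff)
  show ?thesis
    unfolding det_4 matrix_def vec_lambda_beta of_C2_nth L cols
    unfolding cmod_power2 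
    by (simp add: algebra_simps power2_eq_square)
qed

definition jacobian :: "2 \<Rightarrow> 2 \<Rightarrow> complex^3^3 \<Rightarrow> complex^2 \<Rightarrow> complex" where
  "jacobian a b \<gamma> z = cpartial b (\<lambda>z. act \<gamma> z $ a) z"

lemma holomorphic2_actnum: "holomorphic2_on (actnum i \<gamma>) S"
  unfolding actnum_def[abs_def] by (intro holomorphic2_intros)

lemma holomorphic2_autfactor: "holomorphic2_on (autfactor \<gamma>) S"
  unfolding autfactor_actnum[abs_def] by (rule holomorphic2_actnum)

lemma holomorphic2_act:
  assumes "\<gamma> \<in> carrier SU21"
  shows "holomorphic2_on (\<lambda>z. act \<gamma> z $ a) (ball 0 1)"
proof -
  have "a = 1 \<or> a = 2" by (rule exhaust_2)
  then show ?thesis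
    using autfactor_nz[OF assms]
    by (auto simp: act_1 act_2 intro!: holomorphic2_on_divide holomorphic2_actnum holomorphic2_autfactor)
qed

lemma bounded_linear_vec2I:
  "bounded_linear (\<lambda>x. f x $ 1) \<Longrightarrow> bounded_linear (\<lambda>x. f x $ 2) \<Longrightarrow> bounded_linear (f :: complex^2 \<Rightarrow> complex^2)"
  by (auto simp: linear_conv_bounded_linear[symmetric] linear_iff vec2_eq_iff)

lemma has_derivative_vec2I:
  fixes f :: "complex^2 \<Rightarrow> complex^2"
  assumes "\<And>i. ((\<lambda>x. f x $ i) has_derivative (\<lambda>v. f' v $ i)) (at z within S)"
  shows "(f has_derivative f') (at z within S)"
proof -
  have "bounded_linear f'"
    by (rule bounded_linear_vec2I) (rule has_derivative_bounded_linear[OF assms])+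
  moreover have "((\<lambda>y. (1 / norm (y - z)) *\<^sub>R (f y - (f z + f' (y - z)))) \<longlongrightarrow> 0) (at z within S)"
    by (rule vec_tendstoI) (use assms in \<open>simp add: has_derivative_within\<close>)
  ultimately show ?thesis by (simp add: has_derivative_within)
qed

lemma act_has_derivative:
  assumes "\<gamma> \<in> carrier SU21" "z \<in> ball 0 1"
  shows "(act \<gamma> has_derivative (\<lambda>v. \<chi> i. if i = 1 then jacobian 1 1 \<gamma> z * v$1 + jacobian 1 2 \<gamma> z * v$2
            else jacobian 2 1 \<gamma> z * v$1 + jacobian 2 2 \<gamma> z * v$2)) (at z)"
proof (rule has_derivative_vec2I)
  fix i :: 2
  have "i = 1 \<or> i = 2" by (rule exhaust_2)
  then show "((\<lambda>x. act \<gamma> x $ i) has_derivative (\<lambda>v. (\<chi> i. if i = 1 then jacobian 1 1 \<gamma> z * v$1 + jacobian 1 2 \<gamma> z * v$2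
            else jacobian 2 1 \<gamma> z * v$1 + jacobian 2 2 \<gamma> z * v$2) $ i)) (at z)"
    using holomorphic2_on_has_derivative[OF holomorphic2_act[OF assms(1)] assms(2)]
    by (auto simp: jacobian_def)
qed

lemma actnum_has_derivative:
  "(actnum i \<gamma> has_derivative (\<lambda>v. \<gamma>$i$1 * v$1 + \<gamma>$i$2 * v$2)) (at z)"
  unfolding actnum_def[abs_def] 
  by (auto intro!: derivative_eq_intros bounded_linear_imp_has_derivative bounded_linear_vec_nth)

lemma jacobian_eq:
  assumes "\<gamma> \<in> carrier SU21" "z \<in> ball 0 1"
  defines "j \<equiv> autfactor \<gamma> z"
  shows "jacobian 1 1 \<gamma> z = (\<gamma>$1$1 * j - actnum 1 \<gamma> z * \<gamma>$3$1) / j\<^sup>2"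
    "jacobian 1 2 \<gamma> z = (\<gamma>$1$2 * j - actnum 1 \<gamma> z * \<gamma>$3$2) / j\<^sup>2"
    "jacobian 2 1 \<gamma> z = (\<gamma>$2$1 * j - actnum 2 \<gamma> z * \<gamma>$3$1) / j\<^sup>2"
    "jacobian 2 2 \<gamma> z = (\<gamma>$2$2 * j - actnum 2 \<gamma> z * \<gamma>$3$2) / j\<^sup>2"
proof -
  have nz: "j \<noteq> 0" unfolding j_def by (rule autfactor_nz[OF assms(1,2)])
  have *: "((\<lambda>z. actnum i \<gamma> z / autfactor \<gamma> z) has_derivative
        (\<lambda>v::complex^2. (\<lambda>b. (\<gamma>$i$b' b * j - actnum i \<gamma> z * \<gamma>$3$b' b) / j\<^sup>2) 1 * v$1 +
             (\<lambda>b. (\<gamma>$i$b' b * j - actnum i \<gamma> z * \<gamma>$3$b' b) / j\<^sup>2) 2 * v$2)) (at z)"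
     if b': "b' = (\<lambda>b::2. if b = 1 then 1 else 2 :: 3)" for i b'
  proof -
    have "((\<lambda>z. actnum i \<gamma> z / autfactor \<gamma> z) has_derivative
        (\<lambda>v::complex^2. - actnum i \<gamma> z * (inverse (autfactor \<gamma> z) * (\<gamma>$3$1 * v$1 + \<gamma>$3$2 * v$2) * inverse (autfactor \<gamma> z)) +
          (\<gamma>$i$1 * v$1 + \<gamma>$i$2 * v$2) / autfactor \<gamma> z)) (at z)"
      using nz unfolding j_def autfactor_actnum
      by (intro has_derivative_divide actnum_has_derivative)
    moreover have "(\<lambda>v::complex^2. - actnum i \<gamma> z * (inverse (autfactor \<gamma> z) * (\<gamma>$3$1 * v$1 + \<gamma>$3$2 * v$2) * inverse (autfactor \<gamma> z)) +
          (\<gamma>$i$1 * v$1 + \<gamma>$i$2 * v$2) / autfactor \<gamma> z) = 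
        (\<lambda>v::complex^2. (\<lambda>b. (\<gamma>$i$b' b * j - actnum i \<gamma> z * \<gamma>$3$b' b) / j\<^sup>2) 1 * v$1 +
             (\<lambda>b. (\<gamma>$i$b' b * j - actnum i \<gamma> z * \<gamma>$3$b' b) / j\<^sup>2) 2 * v$2)"
      using nz unfolding j_def[symmetric] b' by (auto simp: fun_eq_iff field_simps power2_eq_square)
    ultimately show ?thesis by simp
  qed
  show "jacobian 1 1 \<gamma> z = (\<gamma>$1$1 * j - actnum 1 \<gamma> z * \<gamma>$3$1) / j\<^sup>2"
    "jacobian 1 2 \<gamma> z = (\<gamma>$1$2 * j - actnum 1 \<gamma> z * \<gamma>$3$2) / j\<^sup>2"
    "jacobian 2 1 \<gamma> z = (\<gamma>$2$1 * j - actnum 2 \<gamma> z * \<gamma>$3$1) / j\<^sup>2"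
    "jacobian 2 2 \<gamma> z = (\<gamma>$2$2 * j - actnum 2 \<gamma> z * \<gamma>$3$2) / j\<^sup>2"
    unfolding jacobian_def act_1 act_2 
    using cpartial_eqI[where A="\<lambda>b. (\<gamma>$1$(if b = 1 then 1 else 2) * j - actnum 1 \<gamma> z * \<gamma>$3$(if b = 1 then 1 else 2)) / j\<^sup>2", OF *[OF refl]]
      cpartial_eqI[where A="\<lambda>b. (\<gamma>$2$(if b = 1 then 1 else 2) * j - actnum 2 \<gamma> z * \<gamma>$3$(if b = 1 then 1 else 2)) / j\<^sup>2", OF *[OF refl]]
    by auto
qed

text \<open>
  Up to the power of the automorphy factor, the numerator of the Jacobian is the determinant of
  \<open>\<gamma>\<close> expanded along its action on \<open>(z, 1)\<close>, and \<open>\<gamma>\<close> has determinant 1.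
\<close>

lemma jacobian_det:
  assumes "\<gamma> \<in> carrier SU21" "z \<in> ball 0 1"
  shows "jacobian 1 1 \<gamma> z * jacobian 2 2 \<gamma> z - jacobian 1 2 \<gamma> z * jacobian 2 1 \<gamma> z = 1 / autfactor \<gamma> z ^ 3"
proof -
  define j where "j = autfactor \<gamma> z"
  have nz: "j \<noteq> 0" unfolding j_def by (rule autfactor_nz[OF assms])
  have d: "det \<gamma> = 1" using assms(1) by (simp add: SU21_def)
  have "(\<gamma>$1$1 * j - actnum 1 \<gamma> z * \<gamma>$3$1) * (\<gamma>$2$2 * j - actnum 2 \<gamma> z * \<gamma>$3$2) -
        (\<gamma>$1$2 * j - actnum 1 \<gamma> z * \<gamma>$3$2) * (\<gamma>$2$1 * j - actnum 2 \<gamma> z * \<gamma>$3$1) = j * det \<gamma>"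
    unfolding j_def det_3 actnum_def autfactor_def by (simp add: algebra_simps)
  then have *: "(\<gamma>$1$1 * j - actnum 1 \<gamma> z * \<gamma>$3$1) * (\<gamma>$2$2 * j - actnum 2 \<gamma> z * \<gamma>$3$2) -
        (\<gamma>$1$2 * j - actnum 1 \<gamma> z * \<gamma>$3$2) * (\<gamma>$2$1 * j - actnum 2 \<gamma> z * \<gamma>$3$1) = j"
    by (simp add: d)
  have "a / j\<^sup>2 * (b / j\<^sup>2) - c / j\<^sup>2 * (e / j\<^sup>2) = (a * b - c * e) / j ^ 4" for a b c e
    by (simp add: diff_divide_distrib flip: power_add)
  moreover have "j / j ^ 4 = 1 / j ^ 3" using nz by (simp add: power_eq_if)
  ultimately show ?thesis
    unfolding jacobian_eq[OF assms] j_def[symmetric] using * by simp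
qed

lemma measurable_act [measurable]: "act \<gamma> \<in> borel_measurable borel"
proof -
  have m: "actnum i \<gamma> \<in> borel_measurable borel" for i
    unfolding actnum_def[abs_def] by (intro borel_measurable_continuous_onI continuous_intros)
  have "(\<lambda>z. act \<gamma> z $ i) \<in> borel_measurable borel" for i
    using exhaust_2[of i] m by (auto simp: act_1 act_2 autfactor_actnum)
  then have "(\<lambda>z. act \<gamma> z \<bullet> axis i u) \<in> borel_measurable borel" for i u
    by (simp add: inner_axis borel_measurable_inner)
  then have "\<forall>b\<in>Basis. (\<lambda>z. act \<gamma> z \<bullet> b) \<in> borel_measurable borel"
    unfolding Basis_C2 by simp
  then show ?thesis by (simp only: borel_measurable_euclidean_space[symmetric])
qed

lemma measurable_autfactor [measurable]: "autfactor \<gamma> \<in> borel_measurable borel"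
  unfolding autfactor_def[abs_def] by (intro borel_measurable_continuous_onI continuous_intros)

lemma measurable_rho [measurable]: "rho \<in> borel_measurable borel"
  unfolding rho_def[abs_def] by measurable

lemma borel_ball [measurable]: "ball a r \<in> sets (borel :: (complex^2) measure)"
  by (intro borel_open open_ball)

lemma inj_on_act: "\<gamma> \<in> carrier SU21 \<Longrightarrow> inj_on (act \<gamma>) (ball 0 1)"
  by (metis act_inv(1) inj_onI)

lemma act_image_eq_vimage:
  assumes "\<gamma> \<in> carrier SU21" "A \<subseteq> ball 0 1"
  shows "act \<gamma> ` A = act (SU21_inv \<gamma>) -` A \<inter> ball 0 1"
  using act_inv[OF assms(1)] act_ball[OF assms(1)] act_inv[OF SU21_inv(3)[OF assms(1)]] assms(2)
  by (auto simp: image_iff) (metis subsetD)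

lemma borel_act_image:
  assumes "\<gamma> \<in> carrier SU21" "A \<subseteq> ball 0 1" "A \<in> sets borel"
  shows "act \<gamma> ` A \<in> sets borel"
  unfolding act_image_eq_vimage[OF assms(1,2)]
  using measurable_sets[OF measurable_act assms(3), of "SU21_inv \<gamma>"] by simp

text \<open>
  The real Jacobian of the action is \<open>1 / |j|^6\<close> by \<open>jacobian_det\<close> and \<open>det_complex_linear\<close>.
\<close>

lemma emeasure_act_image:
  assumes \<gamma>: "\<gamma> \<in> carrier SU21" and A: "A \<in> sets borel" "A \<subseteq> ball 0 1"
  shows "emeasure lborel (act \<gamma> ` A) = (\<integral>\<^sup>+z. ennreal (indicator A z / cmod (autfactor \<gamma> z) ^ 6) \<partial>lborel)"
proof -
  define A' where "A' = to_C2 -` A"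
  have A'm [measurable]: "A' \<in> sets borel" 
    unfolding A'_def using measurable_sets[OF measurable_to_C2 A(1)] by simp
  have A'l: "A' \<in> sets lebesgue" using A'm sets_completionI_sets[of A' lborel] by simp
  have mm: "(\<lambda>x. indicator A' x / cmod (autfactor \<gamma> (to_C2 x)) ^ 6) \<in> borel_measurable borel"
    by (intro borel_measurable_divide borel_measurable_indicator A'm borel_measurable_power
          measurable_compose[OF measurable_compose[OF measurable_to_C2 measurable_autfactor] borel_measurable_norm])
  define g where "g x = of_C2 (act \<gamma> (to_C2 x))" for x
  define J where "J z = (\<lambda>v :: complex^2. (\<chi> i. if i = 1 then jacobian 1 1 \<gamma> z * v$1 + jacobian 1 2 \<gamma> z * v$2
            else jacobian 2 1 \<gamma> z * v$1 + jacobian 2 2 \<gamma> z * v$2) :: complex^2)" for z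
  define g' where "g' x = (\<lambda>v. of_C2 (J (to_C2 x) (to_C2 v)))" for x
  have der: "(g has_derivative g' x) (at x within A')" if "x \<in> A'" for x
  proof -
    have "to_C2 x \<in> ball 0 1" using that A by (auto simp: A'_def)
    then have d: "(act \<gamma> has_derivative J (to_C2 x)) (at (to_C2 x))"
      unfolding J_def by (rule act_has_derivative[OF \<gamma>])
    have "(g has_derivative g' x) (at x)"
      unfolding g_def[abs_def] g'_def
      by (intro has_derivative_compose[OF _ bounded_linear_imp_has_derivative[OF bounded_linear_of_C2]]
            has_derivative_compose[OF bounded_linear_imp_has_derivative[OF bounded_linear_to_C2] d])
    then show ?thesis by (rule has_derivative_at_withinI)
  qed
  have inj: "inj_on g A'"
  proof (rule inj_onI)
    fix x y assume "x \<in> A'" "y \<in> A'" "g x = g y"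
    then have "act \<gamma> (to_C2 x) = act \<gamma> (to_C2 y)" "to_C2 x \<in> ball 0 1" "to_C2 y \<in> ball 0 1"
      using A injD[OF inj_of_C2] by (auto simp: A'_def g_def)
    then have "to_C2 x = to_C2 y" by (rule inj_onD[OF inj_on_act[OF \<gamma>]])
    then show "x = y" by (metis of_to_C2)
  qed
  have img: "g ` A' = of_C2 ` act \<gamma> ` A"
    unfolding g_def A'_def by (auto simp: image_iff intro!: bexI[of _ "of_C2 _"])
  have img2: "of_C2 ` act \<gamma> ` A = to_C2 -` (act \<gamma> ` A)"
    by (auto simp: image_iff) (metis of_to_C2)
  have Bm [measurable]: "act \<gamma> ` A \<in> sets borel" by (rule borel_act_image[OF \<gamma> A(2,1)])
  have gm: "g ` A' \<in> sets borel" unfolding img img2 using measurable_sets[OF measurable_to_C2 Bm] by simp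
  have bdd: "bounded (act \<gamma> ` A)" 
    by (rule bounded_subset[OF bounded_ball[of 0 1]]) (use act_ball[OF \<gamma>] A in auto)
  have "bounded (g ` A')" unfolding img
    by (rule bounded_linear_image[OF bdd bounded_linear_of_C2])
  then have lm: "g ` A' \<in> lmeasurable" using gm by (intro bounded_set_imp_lmeasurable) auto
  have det: "\<bar>det (matrix (g' x))\<bar> = 1 / cmod (autfactor \<gamma> (to_C2 x)) ^ 6" if "x \<in> A'" for x
  proof -
    have z: "to_C2 x \<in> ball 0 1" using that A by (auto simp: A'_def)
    have "det (matrix (g' x)) = (cmod (1 / autfactor \<gamma> (to_C2 x) ^ 3))\<^sup>2"
      unfolding g'_def J_def det_complex_linear jacobian_det[OF \<gamma> z] ..
    then show ?thesis by (simp add: norm_divide norm_power power_divide flip: power_mult)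
  qed
  have "((\<lambda>x. \<bar>det (matrix (g' x))\<bar>) has_integral measure lebesgue (g ` A')) A'"
    using has_measure_differentiable_image[OF A'l der inj] lm by blast
  then have "((\<lambda>x. 1 / cmod (autfactor \<gamma> (to_C2 x)) ^ 6) has_integral measure lebesgue (g ` A')) A'"
    by (rule has_integral_eq[rotated]) (use det in auto)
  then have hi: "((\<lambda>x. indicator A' x / cmod (autfactor \<gamma> (to_C2 x)) ^ 6) has_integral measure lebesgue (g ` A')) UNIV"
    by (intro has_integral_eq[rotated, OF has_integral_restrict_UNIV[THEN iffD2]]) (auto simp: indicator_def)
  have "(\<integral>\<^sup>+x. ennreal (indicator A' x / cmod (autfactor \<gamma> (to_C2 x)) ^ 6) \<partial>lborel) = measure lebesgue (g ` A')"
    by (rule nn_integral_has_integral_lborel[OF mm _ hi]) simp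
  also have "\<dots> = emeasure lborel (g ` A')"
    using emeasure_eq_measure2[OF lm] gm by simp
  also have "\<dots> = emeasure (distr lborel borel of_C2) (g ` A')" by (simp add: distr_of_C2)
  also have "\<dots> = emeasure lborel (of_C2 -` (g ` A'))" using gm by (simp add: emeasure_distr)
  also have "of_C2 -` (g ` A') = act \<gamma> ` A" unfolding img by (auto dest: injD[OF inj_of_C2])
  finally have "emeasure lborel (act \<gamma> ` A) = (\<integral>\<^sup>+x. ennreal (indicator A' x / cmod (autfactor \<gamma> (to_C2 x)) ^ 6) \<partial>lborel)" ..
  also have "\<dots> = (\<integral>\<^sup>+z. ennreal (indicator A' (of_C2 z) / cmod (autfactor \<gamma> (to_C2 (of_C2 z))) ^ 6) \<partial>lborel)"
    using nn_integral_of_C2[OF measurable_compose[OF mm measurable_ennreal]] by simp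
  also have "\<dots> = (\<integral>\<^sup>+z. ennreal (indicator A z / cmod (autfactor \<gamma> z) ^ 6) \<partial>lborel)"
    by (simp add: A'_def indicator_def)
  finally show ?thesis .
qed

definition hyp_measure :: "(complex^2) measure" where
  "hyp_measure = density lborel (\<lambda>z. ennreal (indicator (ball 0 1) z / rho z ^ 3))"

lemma sets_hyp_measure [measurable_cong, simp]: "sets hyp_measure = sets borel"
  by (simp add: hyp_measure_def)

lemma space_hyp_measure [simp]: "space hyp_measure = UNIV"
  by (simp add: hyp_measure_def)

lemma nn_integral_hyp_measure:
  assumes [measurable]: "u \<in> borel_measurable borel"
  shows "(\<integral>\<^sup>+z. u z \<partial>hyp_measure) = (\<integral>\<^sup>+z. ennreal (indicator (ball 0 1) z / rho z ^ 3) * u z \<partial>lborel)"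
  unfolding hyp_measure_def by (subst nn_integral_density) measurable

lemma hyp_density_cancel:
  assumes "w \<notin> ball 0 1 \<Longrightarrow> y = 0"
  shows "ennreal (indicator (ball 0 1) w / rho w ^ 3) * (ennreal (rho w ^ 3) * y) = y"
proof (cases "w \<in> ball 0 1")
  case True
  then have "rho w > 0" by (rule rho_pos)
  then have "ennreal (1 / rho w ^ 3) * ennreal (rho w ^ 3) = 1"
    by (subst ennreal_mult[symmetric]) auto
  then show ?thesis using True by (simp add: mult.assoc[symmetric])
qed (use assms in simp)

lemma distr_act:
  assumes \<gamma>: "\<gamma> \<in> carrier SU21"
  shows "distr (density lborel (\<lambda>z. ennreal (indicator (ball 0 1) z / cmod (autfactor \<gamma> z) ^ 6))) borel (act \<gamma>)
       = density lborel (indicator (ball 0 1))" (is "?L = ?R")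
proof (rule measure_eqI)
  fix A assume "A \<in> sets ?L"
  then have A [measurable]: "A \<in> sets borel" by simp
  define A0 where "A0 = act \<gamma> -` A \<inter> ball 0 1"
  have A0 [measurable]: "A0 \<in> sets borel" 
    unfolding A0_def using measurable_sets[OF measurable_act A] by simp
  have img: "act \<gamma> ` A0 = A \<inter> ball 0 1"
  proof
    show "act \<gamma> ` A0 \<subseteq> A \<inter> ball 0 1" unfolding A0_def using act_ball[OF \<gamma>] by blast
    show "A \<inter> ball 0 1 \<subseteq> act \<gamma> ` A0"
    proof
      fix w assume w: "w \<in> A \<inter> ball 0 1"
      then have "act (SU21_inv \<gamma>) w \<in> A0" "w = act \<gamma> (act (SU21_inv \<gamma>) w)"
        unfolding A0_def using act_inv(2)[OF \<gamma>, of w] act_ball[OF SU21_inv(3)[OF \<gamma>], of w] by auto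
      then show "w \<in> act \<gamma> ` A0" by blast
    qed
  qed
  have "emeasure ?L A = (\<integral>\<^sup>+z. ennreal (indicator (ball 0 1) z / cmod (autfactor \<gamma> z) ^ 6) * indicator (act \<gamma> -` A) z \<partial>lborel)"
    by (subst emeasure_distr, simp, simp, subst emeasure_density) (simp_all add: measurable_sets[OF measurable_act A, simplified])
  also have "\<dots> = (\<integral>\<^sup>+z. ennreal (indicator A0 z / cmod (autfactor \<gamma> z) ^ 6) \<partial>lborel)"
    by (intro nn_integral_cong) (auto simp: A0_def split: split_indicator)
  also have "\<dots> = emeasure lborel (act \<gamma> ` A0)"
    by (rule emeasure_act_image[symmetric, OF \<gamma> A0]) (simp add: A0_def)
  also have "\<dots> = emeasure ?R A"
    unfolding img by (subst emeasure_density) (simp_all add: indicator_inter_arith[symmetric] Int_commute)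
  finally show "emeasure ?L A = emeasure ?R A" .
qed simp

text \<open>
  The density \<open>(1 - |z|^2)^(-3)\<close> transforms by \<open>|j|^6\<close>, which cancels the Jacobian.
\<close>

lemma nn_integral_act:
  assumes \<gamma>: "\<gamma> \<in> carrier SU21" and [measurable]: "u \<in> borel_measurable borel"
  shows "(\<integral>\<^sup>+z. u (act \<gamma> z) \<partial>hyp_measure) = (\<integral>\<^sup>+z. u z \<partial>hyp_measure)"
proof -
  have "(\<integral>\<^sup>+z. u z \<partial>hyp_measure) = (\<integral>\<^sup>+z. indicator (ball 0 1) z * (ennreal (1 / rho z ^ 3) * u z) \<partial>lborel)"
    by (subst nn_integral_hyp_measure) (auto intro!: nn_integral_cong split: split_indicator)
  also have "\<dots> = (\<integral>\<^sup>+z. ennreal (1 / rho z ^ 3) * u z \<partial>density lborel (indicator (ball 0 1)))"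
    by (subst nn_integral_density) simp_all
  also have "\<dots> = (\<integral>\<^sup>+z. ennreal (1 / rho (act \<gamma> z) ^ 3) * u (act \<gamma> z) 
       \<partial>density lborel (\<lambda>z. ennreal (indicator (ball 0 1) z / cmod (autfactor \<gamma> z) ^ 6)))"
    by (subst distr_act[OF \<gamma>, symmetric], subst nn_integral_distr) simp_all
  also have "\<dots> = (\<integral>\<^sup>+z. ennreal (indicator (ball 0 1) z / cmod (autfactor \<gamma> z) ^ 6) * 
        (ennreal (1 / rho (act \<gamma> z) ^ 3) * u (act \<gamma> z)) \<partial>lborel)"
    by (subst nn_integral_density) simp_all
  also have "\<dots> = (\<integral>\<^sup>+z. ennreal (indicator (ball 0 1) z / rho z ^ 3) * u (act \<gamma> z) \<partial>lborel)"
  proof (intro nn_integral_cong)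
    fix z :: "complex^2"
    show "ennreal (indicator (ball 0 1) z / cmod (autfactor \<gamma> z) ^ 6) * 
        (ennreal (1 / rho (act \<gamma> z) ^ 3) * u (act \<gamma> z)) = ennreal (indicator (ball 0 1) z / rho z ^ 3) * u (act \<gamma> z)"
    proof (cases "z \<in> ball 0 1")
      case True
      have nz: "cmod (autfactor \<gamma> z) > 0" using autfactor_nz[OF \<gamma> True] by simp
      have r: "rho z > 0" by (rule rho_pos[OF True])
      have "1 / cmod (autfactor \<gamma> z) ^ 6 * (1 / rho (act \<gamma> z) ^ 3) = 1 / rho z ^ 3"
        unfolding rho_act[OF \<gamma> True] using nz r by (simp add: power_divide flip: power_mult)
      moreover have "rho (act \<gamma> z) > 0" using rho_pos act_ball[OF \<gamma> True] by simp
      ultimately show ?thesis using True nz r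
        by (simp add: mult.assoc[symmetric] ennreal_mult[symmetric])
    qed simp
  qed
  also have "\<dots> = (\<integral>\<^sup>+z. u (act \<gamma> z) \<partial>hyp_measure)"
    by (subst nn_integral_hyp_measure) simp_all
  finally show ?thesis ..
qed

section \<open>Cocompact torsion-free lattices\<close>

locale cocompact_lattice =
  fixes \<Gamma> :: "(complex^3^3) set"
  assumes subgroup: "subgroup \<Gamma> SU21"
    and discrete: "discrete \<Gamma>"
    and torsion_free: "torsion_free \<Gamma>"
    and cocompact: "cocompact \<Gamma>"
begin

lemma in_SU21: "\<gamma> \<in> \<Gamma> \<Longrightarrow> \<gamma> \<in> carrier SU21"
  using subgroup.subset[OF subgroup] by auto

lemma one_mem: "mat 1 \<in> \<Gamma>"
  using subgroup.one_closed[OF subgroup] by (simp add: SU21_simps)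

lemma mult_mem: "\<gamma> \<in> \<Gamma> \<Longrightarrow> \<sigma> \<in> \<Gamma> \<Longrightarrow> \<gamma> ** \<sigma> \<in> \<Gamma>"
  using subgroup.m_closed[OF subgroup] by (simp add: SU21_simps)

lemma inv_mem: "\<gamma> \<in> \<Gamma> \<Longrightarrow> SU21_inv \<gamma> \<in> \<Gamma>"
  using subgroup.m_inv_closed[OF subgroup] SU21_inv_eq[OF in_SU21] by metis

lemma inv_mult_eq: "\<gamma> \<in> \<Gamma> \<Longrightarrow> SU21_inv \<gamma> ** (\<gamma> ** \<sigma>) = \<sigma>" "\<gamma> \<in> \<Gamma> \<Longrightarrow> \<gamma> ** (SU21_inv \<gamma> ** \<sigma>) = \<sigma>"
  using SU21_inv[OF in_SU21] by (auto simp: matrix_mul_assoc)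

lemma mult_inv_eq: "\<gamma> \<in> \<Gamma> \<Longrightarrow> \<sigma> ** SU21_inv \<gamma> ** \<gamma> = \<sigma>" "\<gamma> \<in> \<Gamma> \<Longrightarrow> \<sigma> ** \<gamma> ** SU21_inv \<gamma> = \<sigma>"
  using SU21_inv[OF in_SU21] by (auto simp: matrix_mul_assoc[symmetric])

lemma bij_mult_right:
  assumes "\<sigma> \<in> \<Gamma>"
  shows "bij_betw (\<lambda>\<gamma>. \<gamma> ** \<sigma>) \<Gamma> \<Gamma>"
  by (rule bij_betwI[where g = "\<lambda>\<gamma>. \<gamma> ** SU21_inv \<sigma>"])
     (use assms mult_mem inv_mem mult_inv_eq in auto)

lemma act_mem: "\<gamma> \<in> \<Gamma> \<Longrightarrow> z \<in> ball 0 1 \<Longrightarrow> act \<gamma> z \<in> ball 0 1"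
  using act_ball[OF in_SU21] .

end

lemma SU21_row3:
  assumes "\<gamma> \<in> carrier SU21"
  shows "(cmod (\<gamma>$3$1))\<^sup>2 + (cmod (\<gamma>$3$2))\<^sup>2 = (cmod (\<gamma>$3$3))\<^sup>2 - 1"
proof -
  have "SU21_inv \<gamma> $ 1 $ 3 = - cnj (\<gamma>$3$1)" "SU21_inv \<gamma> $ 2 $ 3 = - cnj (\<gamma>$3$2)" "SU21_inv \<gamma> $ 3 $ 3 = cnj (\<gamma>$3$3)"
    by (simp_all add: SU21_inv_def matrix_matrix_mult_def sum_3 H21_def conj_transpose_def)
  then have "\<gamma>$3$1 * cnj (\<gamma>$3$1) + \<gamma>$3$2 * cnj (\<gamma>$3$2) - \<gamma>$3$3 * cnj (\<gamma>$3$3) = - 1"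
    using SU21_columns[OF SU21_inv(3)[OF assms], of 3 3] by (simp add: H21_def mult.commute)
  then have "complex_of_real ((cmod (\<gamma>$3$1))\<^sup>2 + (cmod (\<gamma>$3$2))\<^sup>2 - (cmod (\<gamma>$3$3))\<^sup>2) = of_real (- 1)"
    unfolding of_real_diff of_real_add complex_norm_square by simp
  then show ?thesis using of_real_eq_iff by (smt (verit))
qed

lemma SU21_column_norm:
  assumes "\<gamma> \<in> carrier SU21"
  shows "(cmod (\<gamma>$1$i))\<^sup>2 + (cmod (\<gamma>$2$i))\<^sup>2 = (cmod (\<gamma>$3$i))\<^sup>2 + (if i = 3 then - 1 else 1)"
proof -
  have "complex_of_real ((cmod (\<gamma>$1$i))\<^sup>2 + (cmod (\<gamma>$2$i))\<^sup>2 - (cmod (\<gamma>$3$i))\<^sup>2) = of_real (if i = 3 then - 1 else 1)"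
    unfolding of_real_diff of_real_add complex_norm_square SU21_columns[OF assms] by (simp add: H21_def)
  then show ?thesis using of_real_eq_iff by (smt (verit))
qed

text \<open>
  The rows and columns of \<open>\<gamma>\<close> are unit vectors of an indefinite form, so the corner entry controls
  all others. Its absolute value serves as the height of \<open>\<gamma>\<close> in what follows.
\<close>

lemma SU21_entry_le:
  assumes "\<gamma> \<in> carrier SU21"
  shows "cmod (\<gamma>$i$j) \<le> cmod (\<gamma>$3$3)"
proof -
  note r = SU21_row3[OF assms] and c = SU21_column_norm[OF assms, of j]
  have 3: "(cmod (\<gamma>$3$j))\<^sup>2 + (if j = 3 then - 1 else 1) \<le> (cmod (\<gamma>$3$3))\<^sup>2"
    using r exhaust_3[of j] by (smt (verit) zero_le_power2)
  have "(cmod (\<gamma>$3$j))\<^sup>2 \<le> (cmod (\<gamma>$3$3))\<^sup>2"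
    using r exhaust_3[of j] by (smt (verit) zero_le_power2)
  then have "(cmod (\<gamma>$i$j))\<^sup>2 \<le> (cmod (\<gamma>$3$3))\<^sup>2"
    using 3 c exhaust_3[of i] by (smt (verit) zero_le_power2)
  then show ?thesis by (rule power2_le_imp_le) simp
qed

lemma SU21_33_ge_1:
  assumes "\<gamma> \<in> carrier SU21"
  shows "cmod (\<gamma>$3$3) \<ge> 1"
proof (rule power2_le_imp_le)
  show "1\<^sup>2 \<le> (cmod (\<gamma>$3$3))\<^sup>2"
    using SU21_row3[OF assms] zero_le_power2[of "cmod (\<gamma>$3$1)"] zero_le_power2[of "cmod (\<gamma>$3$2)"] unfolding one_power2 by linarith
qed simp

lemma norm_vec_le_sum: "norm (x :: 'a::real_normed_vector^'n) \<le> (\<Sum>i\<in>UNIV. norm (x $ i))"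
  unfolding norm_vec_def by (rule L2_set_le_sum) simp

lemma SU21_norm_le:
  assumes "\<gamma> \<in> carrier SU21"
  shows "norm \<gamma> \<le> 9 * cmod (\<gamma>$3$3)"
proof -
  have "norm (\<gamma>$i) \<le> 3 * cmod (\<gamma>$3$3)" for i
    using norm_vec_le_sum[of "\<gamma>$i"] SU21_entry_le[OF assms, of i 1] SU21_entry_le[OF assms, of i 2] SU21_entry_le[OF assms, of i 3]
    by (simp add: sum_3)
  then show ?thesis using norm_vec_le_sum[of \<gamma>] unfolding sum_3 by (smt (verit))
qed

text \<open>
  By the relation for the third row, \<open>(\<gamma>_31, \<gamma>_32)\<close> is no longer than the corner entry.
\<close>

lemma autfactor_bounds:
  assumes "\<gamma> \<in> carrier SU21"
  shows autfactor_ge: "cmod (autfactor \<gamma> z) \<ge> cmod (\<gamma>$3$3) * (1 - norm z)"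
    and autfactor_le: "cmod (autfactor \<gamma> z) \<le> cmod (\<gamma>$3$3) * (1 + norm z)"
proof -
  define w :: "complex^2" where "w = vector [cnj (\<gamma>$3$1), cnj (\<gamma>$3$2)]"
  have "(norm w)\<^sup>2 \<le> (cmod (\<gamma>$3$3))\<^sup>2"
    unfolding norm_vec2 w_def using SU21_row3[OF assms] by simp
  then have nw: "norm w \<le> cmod (\<gamma>$3$3)" by (rule power2_le_imp_le) simp
  have eq: "autfactor \<gamma> z = \<gamma>$3$3 + herm z w" by (simp add: autfactor_def herm_def w_def mult.commute)
  have "cmod (autfactor \<gamma> z) \<ge> cmod (\<gamma>$3$3) - cmod (herm z w)"
    unfolding eq by (rule norm_diff_ineq)
  moreover have "cmod (autfactor \<gamma> z) \<le> cmod (\<gamma>$3$3) + cmod (herm z w)"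
    unfolding eq by (rule norm_triangle_ineq)
  moreover have "cmod (herm z w) \<le> norm z * cmod (\<gamma>$3$3)"
    using cmod_herm_le[of z w] mult_left_mono[OF nw, of "norm z"] by simp
  ultimately show "cmod (autfactor \<gamma> z) \<ge> cmod (\<gamma>$3$3) * (1 - norm z)"
    "cmod (autfactor \<gamma> z) \<le> cmod (\<gamma>$3$3) * (1 + norm z)"
    by (simp_all add: algebra_simps)
qed

lemma continuous_on_act:
  assumes "\<gamma> \<in> carrier SU21" "S \<subseteq> ball 0 1"
  shows "continuous_on S (act \<gamma>)"
  using act_has_derivative[OF assms(1)] assms(2)
  by (intro continuous_at_imp_continuous_on ballI has_derivative_continuous) blast

context cocompact_lattice
begin

text \<open>
  An infinite bounded subset would accumulate somewhere; quotients of nearby distinct elements would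
  then be elements of the lattice different from, but arbitrarily close to, the identity.
\<close>

lemma finite_bounded: "finite {\<gamma>\<in>\<Gamma>. cmod (\<gamma>$3$3) \<le> R}" (is "finite ?S")
proof (rule ccontr)
  assume inf: "infinite ?S"
  define F where "F p = SU21_inv (fst p) ** snd p" for p :: "(complex^3^3) \<times> (complex^3^3)"
  have "?S \<subseteq> cball 0 (9 * R)"
    using SU21_norm_le[OF in_SU21] by force
  then obtain x where x: "x islimpt ?S"
    using Heine_Borel_imp_Bolzano_Weierstrass[OF compact_cball inf] by blast
  have "continuous_on UNIV F"
    unfolding F_def SU21_inv_def matrix_matrix_mult_def conj_transpose_def
    by (intro continuous_intros continuous_on_vec_lambda)
  then have cont: "isCont F p" for p
    by (metis continuous_on_eq_continuous_at open_UNIV UNIV_I)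
  obtain T where T: "open T" "T \<inter> \<Gamma> = {mat 1}"
    using discreteD[OF discrete one_mem] unfolding isolated_in_def by blast
  have FT: "F (x, x) = mat 1"
  proof -
    obtain f where f: "\<And>n. f n \<in> ?S" "f \<longlonglongrightarrow> x" using x unfolding islimpt_sequential by blast
    have "(\<lambda>n. F (f n, f n)) \<longlonglongrightarrow> F (x, x)"
      by (rule isCont_tendsto_compose[OF cont]) (intro tendsto_Pair f)
    moreover have "F (f n, f n) = mat 1" for n
      using f(1)[of n] SU21_inv(1)[OF in_SU21] by (simp add: F_def)
    ultimately show ?thesis using LIMSEQ_unique[OF _ tendsto_const] by auto
  qed
  have "(F \<longlongrightarrow> mat 1) (nhds (x, x))" 
    using cont[of "(x, x)"] FT unfolding isCont_def tendsto_at_iff_tendsto_nhds by simp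
  then have "\<forall>\<^sub>F p in nhds (x, x). F p \<in> T" using T topological_tendstoD by blast
  then obtain W where W: "open W" "(x, x) \<in> W" "\<And>p. p \<in> W \<Longrightarrow> F p \<in> T"
    unfolding eventually_nhds by blast
  obtain U V where UV': "open U" "open V" "(x, x) \<in> U \<times> V" "U \<times> V \<subseteq> W"
    using open_prod_elim[OF W(1,2)] by blast
  have UV: "open U" "x \<in> U" "open V" "x \<in> V" "\<And>a b. a \<in> U \<Longrightarrow> b \<in> V \<Longrightarrow> F (a, b) \<in> T"
    using UV' W(3) by auto
  obtain a where a: "a \<in> ?S" "a \<in> U \<inter> V" "a \<noteq> x" 
    using islimptE[OF x, of "U \<inter> V"] UV(1-4) open_Int by blast
  obtain b where b: "b \<in> ?S" "b \<in> (U \<inter> V) - {a}" 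
  proof -
    have "open ((U \<inter> V) - {a})" using UV by (intro open_Diff open_Int) auto
    then show ?thesis using islimptE[OF x, of "(U \<inter> V) - {a}"] UV(2,4) a(3) that by blast
  qed
  have "F (a, b) \<in> T" using UV(5) a b by blast
  moreover have "F (a, b) \<in> \<Gamma>" unfolding F_def using a b mult_mem inv_mem by simp
  ultimately have "SU21_inv a ** b = mat 1" using T unfolding F_def by auto
  then have "b = a" using inv_mult_eq(2)[of a b] a(1) by simp
  then show False using b by simp
qed

text \<open>
  The images of the balls of radius \<open>r < 1\<close> are open in the orbit space and increase to all of it,
  so by compactness one of them is everything.
\<close>

lemma exhaustion: "\<exists>r. 0 < r \<and> r < 1 \<and> (\<forall>z\<in>ball 0 1. \<exists>\<gamma>\<in>\<Gamma>. act \<gamma> z \<in> cball 0 r)"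
proof -
  define U where "U r = orbit \<Gamma> ` ball 0 r" for r :: real
  have pre: "{z \<in> ball 0 1. orbit \<Gamma> z \<in> U r} = (\<Union>\<gamma>\<in>\<Gamma>. ball 0 1 \<inter> act \<gamma> -` ball 0 r)" if r: "r \<le> 1" for r
  proof (intro equalityI subsetI)
    fix z assume "z \<in> {z \<in> ball 0 1. orbit \<Gamma> z \<in> U r}"
    then obtain w where z: "z \<in> ball 0 1" and w: "w \<in> ball 0 r" "orbit \<Gamma> z = orbit \<Gamma> w" by (auto simp: U_def)
    have "z \<in> orbit \<Gamma> z" unfolding orbit_def using one_mem by (metis act_one imageI)
    then obtain \<gamma> where g: "\<gamma> \<in> \<Gamma>" "z = act \<gamma> w" using w unfolding orbit_def by auto
    have "w \<in> ball 0 1" using w r by auto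
    then have "act (SU21_inv \<gamma>) z = w" using act_inv(1)[OF in_SU21[OF g(1)]] g by simp
    then show "z \<in> (\<Union>\<gamma>\<in>\<Gamma>. ball 0 1 \<inter> act \<gamma> -` ball 0 r)" using z w inv_mem[OF g(1)] by blast
  next
    fix z assume "z \<in> (\<Union>\<gamma>\<in>\<Gamma>. ball 0 1 \<inter> act \<gamma> -` ball 0 r)"
    then obtain \<gamma> where g: "\<gamma> \<in> \<Gamma>" and z: "z \<in> ball 0 1" "act \<gamma> z \<in> ball 0 r" by auto
    have "orbit \<Gamma> (act \<gamma> z) = (\<lambda>\<sigma>. act (\<sigma> ** \<gamma>) z) ` \<Gamma>"
      unfolding orbit_def using act_mult[OF in_SU21[OF g] z(1)] by simp
    also have "\<dots> = (\<lambda>\<sigma>. act \<sigma> z) ` ((\<lambda>\<sigma>. \<sigma> ** \<gamma>) ` \<Gamma>)" by (simp add: image_image)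
    also have "\<dots> = orbit \<Gamma> z" using bij_mult_right[OF g] by (simp add: orbit_def bij_betw_def)
    finally show "z \<in> {z \<in> ball 0 1. orbit \<Gamma> z \<in> U r}" using z unfolding U_def by (metis (mono_tags, lifting) image_eqI mem_Collect_eq)
  qed
  have op: "openin (quotient_space \<Gamma>) (U r)" if r: "r \<le> 1" for r
    unfolding openin_quotient_space
  proof
    show "U r \<subseteq> orbit \<Gamma> ` ball 0 1" unfolding U_def using r by (intro image_mono) auto
    have "open (\<Union>\<gamma>\<in>\<Gamma>. ball 0 1 \<inter> act \<gamma> -` ball 0 r)"
      by (intro open_UN ballI continuous_open_preimage continuous_on_act in_SU21) auto
    then show "openin (top_of_set (ball 0 1)) {z \<in> ball 0 1. orbit \<Gamma> z \<in> U r}"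
      unfolding pre[OF r] by (rule open_openin_trans[rotated 1]) auto
  qed
  have cov: "topspace (quotient_space \<Gamma>) \<subseteq> \<Union> (U ` {0<..<1})"
  proof -
    have "\<exists>r\<in>{0<..<1}. z \<in> ball 0 r" if "z \<in> ball 0 1" for z :: "complex^2"
    proof -
      have "norm z < 1" using that by simp
      then obtain r where "norm z < r" "r < 1" using dense by blast
      moreover have "0 < r" using \<open>norm z < r\<close> norm_ge_zero[of z] by linarith
      ultimately show ?thesis by auto
    qed
    then show ?thesis unfolding topspace_quotient_space U_def by blast
  qed
  have "compact_space (quotient_space \<Gamma>)" using cocompact by (simp add: cocompact_def)
  moreover have "\<forall>V\<in>U ` {0<..<1}. openin (quotient_space \<Gamma>) V" using op by auto
  ultimately obtain \<F> where F: "finite \<F>" "\<F> \<subseteq> U ` {0<..<1}" and FT: "topspace (quotient_space \<Gamma>) \<subseteq> \<Union>\<F>"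
    using cov unfolding compact_space_alt by meson
  obtain Rs where Rs: "Rs \<subseteq> {0<..<1}" "finite Rs" and FR: "\<F> = U ` Rs"
    using finite_subset_image[OF F] by blast
  have Rs3: "topspace (quotient_space \<Gamma>) \<subseteq> \<Union> (U ` Rs)" using FT FR by simp
  define r where "r = Max (insert (1/2) Rs)"
  have r: "r \<in> insert (1/2) Rs" "\<And>s. s \<in> Rs \<Longrightarrow> s \<le> r" "1/2 \<le> r"
  proof -
    have fin': "finite (insert (1/2) Rs)" using Rs(2) by simp
    show "r \<in> insert (1/2) Rs" unfolding r_def by (rule Max_in[OF fin']) simp
    show "\<And>s. s \<in> Rs \<Longrightarrow> s \<le> r" "1/2 \<le> r"
      unfolding r_def by (rule Max_ge[OF fin'], simp)+
  qed
  have r1: "0 < r" "r < 1" using r Rs(1) by auto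
  have "\<exists>\<gamma>\<in>\<Gamma>. act \<gamma> z \<in> cball 0 r" if z: "z \<in> ball 0 1" for z
  proof -
    have "orbit \<Gamma> z \<in> topspace (quotient_space \<Gamma>)" unfolding topspace_quotient_space using z by auto
    then obtain s where s: "s \<in> Rs" "orbit \<Gamma> z \<in> U s" using Rs3 by auto
    have "s \<le> 1" using s Rs by auto
    then obtain \<gamma> where "\<gamma> \<in> \<Gamma>" "act \<gamma> z \<in> ball 0 s" using pre[of s] z s by blast
    then show ?thesis using r(2)[OF s(1)] by (intro bexI[of _ \<gamma>]) auto
  qed
  then show ?thesis using r1 by blast
qed

lemma pow_mem: "\<gamma> \<in> \<Gamma> \<Longrightarrow> \<gamma> [^]\<^bsub>SU21\<^esub> (n::nat) \<in> \<Gamma>"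
  by (induction n) (auto simp: SU21_simps one_mem intro: mult_mem)

text \<open>
  All powers of an element fixing \<open>z\<close> fix \<open>z\<close> and hence have bounded height. By discreteness two of
  them coincide, and absence of torsion leaves only the identity.
\<close>

lemma free_action:
  assumes g: "\<gamma> \<in> \<Gamma>" and z: "z \<in> ball 0 1" and fix_z: "act \<gamma> z = z"
  shows "\<gamma> = mat 1"
proof -
  interpret group SU21 by (rule group_SU21)
  have fixn: "act (\<gamma> [^]\<^bsub>SU21\<^esub> (n::nat)) z = z" for n
    by (induction n) (auto simp: SU21_simps act_mult[OF in_SU21[OF g] z] fix_z)
  have "cmod ((\<gamma> [^]\<^bsub>SU21\<^esub> (n::nat))$3$3) \<le> 1 / (1 - norm z)" for n
  proof -
    define \<sigma> where "\<sigma> = \<gamma> [^]\<^bsub>SU21\<^esub> n"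
    have s: "\<sigma> \<in> carrier SU21" unfolding \<sigma>_def using in_SU21[OF pow_mem[OF g]] .
    have "rho z = rho z / (cmod (autfactor \<sigma> z))\<^sup>2" using rho_act[OF s z] fixn[of n] by (simp add: \<sigma>_def)
    then have "(cmod (autfactor \<sigma> z))\<^sup>2 = 1" using rho_pos[OF z] autfactor_nz[OF s z] by (simp add: field_simps)
    then have "cmod (autfactor \<sigma> z) = 1" using norm_ge_zero power2_eq_1_iff by (smt (verit))
    then have "cmod (\<sigma>$3$3) * (1 - norm z) \<le> 1" using autfactor_ge[OF s, of z] by simp
    then show ?thesis using z unfolding \<sigma>_def[symmetric] by (simp add: pos_le_divide_eq)
  qed
  then have "range (\<lambda>n::nat. \<gamma> [^]\<^bsub>SU21\<^esub> n) \<subseteq> {\<sigma>\<in>\<Gamma>. cmod (\<sigma>$3$3) \<le> 1 / (1 - norm z)}"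
    using pow_mem[OF g] by auto
  then have "finite (range (\<lambda>n::nat. \<gamma> [^]\<^bsub>SU21\<^esub> n))" using finite_bounded finite_subset by blast
  then have "\<not> inj (\<lambda>n::nat. \<gamma> [^]\<^bsub>SU21\<^esub> n)" using finite_imageD infinite_UNIV_nat by blast
  then obtain m n :: nat where mn: "m < n" "\<gamma> [^]\<^bsub>SU21\<^esub> m = \<gamma> [^]\<^bsub>SU21\<^esub> n"
    unfolding inj_def by (metis linorder_neqE_nat)
  have gc: "\<gamma> \<in> carrier SU21" using in_SU21[OF g] .
  have "\<gamma> [^]\<^bsub>SU21\<^esub> m \<otimes>\<^bsub>SU21\<^esub> \<gamma> [^]\<^bsub>SU21\<^esub> (n - m) = \<gamma> [^]\<^bsub>SU21\<^esub> m"
    using nat_pow_mult[OF gc, of m "n - m"] mn gc by simp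
  then have "\<gamma> [^]\<^bsub>SU21\<^esub> (n - m) = \<one>\<^bsub>SU21\<^esub>" using gc by (simp only: l_cancel_one nat_pow_closed)
  then show ?thesis using torsion_free g mn(1) unfolding torsion_free_def 
    by (metis SU21_simps(2) zero_less_diff)
qed

lemma proximity_orbit_le:
  assumes g: "\<gamma> \<in> \<Gamma>" and z: "z \<in> cball 0 r" and w: "w \<in> cball 0 r" and r: "r < 1"
  shows "proximity (act \<gamma> w) z \<le> 1 / ((cmod (\<gamma>$3$3))\<^sup>2 * (1 - r) ^ 4)"
proof -
  have zb: "z \<in> ball 0 1" "w \<in> ball 0 1" using z w r by auto
  have D: "cmod (\<gamma>$3$3) \<ge> 1" by (rule SU21_33_ge_1[OF in_SU21[OF g]])
  have 1: "cmod (autfactor \<gamma> w) \<ge> cmod (\<gamma>$3$3) * (1 - r)"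
  proof -
    have "cmod (\<gamma>$3$3) * (1 - r) \<le> cmod (\<gamma>$3$3) * (1 - norm w)" using w by (intro mult_left_mono) auto
    then show ?thesis using autfactor_ge[OF in_SU21[OF g], of w] by simp
  qed
  have p: "cmod (\<gamma>$3$3) * (1 - r) > 0" using D r by (intro mult_pos_pos) linarith+
  have "rho (act \<gamma> w) \<le> 1 / (cmod (\<gamma>$3$3) * (1 - r))\<^sup>2"
    unfolding rho_act[OF in_SU21[OF g] zb(2)] using rho_le_1[of w] 1 p
    by (intro frac_le power_mono) auto
  moreover have "proximity (act \<gamma> w) z \<le> rho (act \<gamma> w) / (1 - norm z)\<^sup>2"
    by (rule proximity_le_rho[OF zb(1) act_mem[OF g zb(2)]])
  moreover have "rho (act \<gamma> w) / (1 - norm z)\<^sup>2 \<le> rho (act \<gamma> w) / (1 - r)\<^sup>2"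
    using rho_pos[OF act_mem[OF g zb(2)]] z r by (intro divide_left_mono power_mono mult_pos_pos) auto
  moreover have "rho (act \<gamma> w) / (1 - r)\<^sup>2 \<le> 1 / (cmod (\<gamma>$3$3) * (1 - r))\<^sup>2 / (1 - r)\<^sup>2"
    using calculation(1) by (intro divide_right_mono) auto
  moreover have "1 / (cmod (\<gamma>$3$3) * (1 - r))\<^sup>2 / (1 - r)\<^sup>2 = 1 / ((cmod (\<gamma>$3$3))\<^sup>2 * (1 - r) ^ 4)"
    by (simp add: power_mult_distrib flip: power_add)
  ultimately show ?thesis by linarith
qed

lemma continuous_on_proximity_orbit:
  assumes "\<gamma> \<in> \<Gamma>" "S \<subseteq> ball 0 1"
  shows "continuous_on S (\<lambda>z. proximity (act \<gamma> z) z)"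
proof -
  have "continuous_on S (act \<gamma>)" by (rule continuous_on_act[OF in_SU21[OF assms(1)] assms(2)])
  then show ?thesis
    unfolding proximity_def rho_def herm_def
    by (intro continuous_intros) 
       (use one_minus_herm_nz[of _ "act \<gamma> _"] act_mem[OF assms(1)] assms(2) in \<open>auto simp: herm_def\<close>)
qed

text \<open>
  Elements of large height move the ball of radius \<open>r\<close> far away from itself. For each of the finitely
  many others the function \<open>proximity (act \<gamma> z) z\<close> is continuous and, the action being free, less than 1
  everywhere, so it has a maximum less than 1 on the compact ball.
\<close>

lemma systole_gap:
  assumes r: "0 < r" "r < 1"
  shows "\<exists>\<delta>. 0 < \<delta> \<and> \<delta> < 1 \<and> (\<forall>\<gamma>\<in>\<Gamma>. \<forall>z\<in>cball 0 r. \<gamma> \<noteq> mat 1 \<longrightarrow> proximity (act \<gamma> z) z \<le> 1 - \<delta>)"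
proof -
  (* Outside T the height is so large that proximity_orbit_le gives the bound 1/4. *)
  define T where "T = {\<gamma>\<in>\<Gamma>. cmod (\<gamma>$3$3) \<le> 2 / (1 - r)\<^sup>2} - {mat 1}"
  have fin: "finite T" unfolding T_def using finite_bounded by simp
  have "\<exists>\<delta>>0. \<forall>z\<in>cball 0 r. proximity (act \<gamma> z) z \<le> 1 - \<delta>" if g: "\<gamma> \<in> T" for \<gamma>
  proof -
    have gG: "\<gamma> \<in> \<Gamma>" "\<gamma> \<noteq> mat 1" using g by (auto simp: T_def)
    have "continuous_on (cball 0 r) (\<lambda>z. proximity (act \<gamma> z) z)"
      by (rule continuous_on_proximity_orbit[OF gG(1)]) (use r in auto)
    then obtain x where x: "x \<in> cball 0 r" "\<And>z. z \<in> cball 0 r \<Longrightarrow> proximity (act \<gamma> z) z \<le> proximity (act \<gamma> x) x"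
      using continuous_attains_sup[OF compact_cball _ \<open>continuous_on (cball 0 r) _\<close>] r by auto
    have xb: "x \<in> ball 0 1" using x r by auto
    have "act \<gamma> x \<noteq> x" using free_action[OF gG(1) xb] gG(2) by blast
    then have "rho x * (norm (act \<gamma> x - x))\<^sup>2 / 4 > 0" using rho_pos[OF xb] by simp
    then show ?thesis using proximity_le[OF xb act_mem[OF gG(1) xb]] x(2)
      by (intro exI[of _ "rho x * (norm (act \<gamma> x - x))\<^sup>2 / 4"]) (meson order_trans)
  qed
  then obtain \<delta> where \<delta>: "\<And>\<gamma>. \<gamma> \<in> T \<Longrightarrow> \<delta> \<gamma> > 0 \<and> (\<forall>z\<in>cball 0 r. proximity (act \<gamma> z) z \<le> 1 - \<delta> \<gamma>)"
    by metis
  define d where "d = Min (insert (1/2) (\<delta> ` T))"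
  have d: "d \<in> insert (1/2) (\<delta> ` T)" "d \<le> 1/2" "\<And>\<gamma>. \<gamma> \<in> T \<Longrightarrow> d \<le> \<delta> \<gamma>"
  proof -
    have fin': "finite (insert (1/2) (\<delta> ` T))" using fin by simp
    show "d \<in> insert (1/2) (\<delta> ` T)" unfolding d_def by (rule Min_in[OF fin']) simp
    show "d \<le> 1/2" "\<And>\<gamma>. \<gamma> \<in> T \<Longrightarrow> d \<le> \<delta> \<gamma>"
      unfolding d_def by (rule Min_le[OF fin'], simp)+
  qed
  have d0: "d > 0" using d(1) \<delta> by auto
  have "proximity (act \<gamma> z) z \<le> 1 - d" if "\<gamma> \<in> \<Gamma>" "z \<in> cball 0 r" "\<gamma> \<noteq> mat 1" for \<gamma> z
  proof (cases "\<gamma> \<in> T")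
    case True
    then show ?thesis using \<delta>[OF True] d(3)[OF True] that(2) by force
  next
    case False
    then have big: "cmod (\<gamma>$3$3) > 2 / (1 - r)\<^sup>2" using that by (auto simp: T_def)
    have "4 = (2 / (1 - r)\<^sup>2)\<^sup>2 * (1 - r) ^ 4" using r by (simp add: power_divide flip: power_mult)
    also have "\<dots> \<le> (cmod (\<gamma>$3$3))\<^sup>2 * (1 - r) ^ 4"
      using big r by (intro mult_right_mono power_mono) auto
    finally have "1 / ((cmod (\<gamma>$3$3))\<^sup>2 * (1 - r) ^ 4) \<le> 1 / 4" by (intro divide_left_mono) auto
    then show ?thesis using proximity_orbit_le[OF that(1) that(2) that(2) r(2)] d(2) by linarith
  qed
  then show ?thesis using d0 d(2) by (intro exI[of _ d]) auto
qed

end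

section \<open>Unfolding over a fundamental domain\<close>

lemma AE_hyp_ball: "AE z in hyp_measure. z \<in> ball 0 1"
  unfolding hyp_measure_def
  by (subst AE_density) (measurable, auto intro!: AE_I2 split: split_indicator simp: indicator_def)

lemma AE_hyp_negligible:
  assumes "negligible S"
  shows "AE z in hyp_measure. z \<notin> S"
proof -
  obtain N where N: "N \<in> null_sets lborel" "S \<subseteq> N"
    using assms unfolding negligible_iff_null_sets null_sets_completion_iff2 by blast
  have "AE z in lborel. z \<notin> S"
    using AE_not_in[OF N(1)] N(2) by auto
  then have "AE z in lborel. 0 < ennreal (indicator (ball 0 1) z / rho z ^ 3) \<longrightarrow> z \<notin> S" by auto
  then show ?thesis
    unfolding hyp_measure_def by (subst AE_density) measurable
qed

lemma negligible_act_image: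
  assumes "\<gamma> \<in> carrier SU21" "negligible S" "S \<subseteq> ball 0 1"
  shows "negligible (act \<gamma> ` S)"
proof (rule negligible_differentiable_image_negligible[OF _ assms(2)])
  show "act \<gamma> differentiable_on S"
    unfolding differentiable_on_def differentiable_def
    using act_has_derivative[OF assms(1)] assms(3) has_derivative_at_withinI by blast
qed simp

lemma ennreal_infsum_le:
  assumes "f summable_on A" "\<And>x. x \<in> A \<Longrightarrow> f x \<ge> 0"
  shows "ennreal (infsum f A) \<le> (\<integral>\<^sup>+x. ennreal (f x) \<partial>count_space A)"
proof (subst infsum_nonneg_is_SUPREMUM_ennreal, rule assms(1), erule assms(2), rule SUP_least)
  fix F assume "F \<in> {F. finite F \<and> F \<subseteq> A}"
  then have F: "finite F" "F \<subseteq> A" by auto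
  have "ennreal (sum f F) = (\<Sum>x\<in>F. ennreal (f x))" using F assms(2) by (intro sum_ennreal[symmetric]) auto
  also have "\<dots> = (\<integral>\<^sup>+x. ennreal (f x) * indicator F x \<partial>count_space A)"
    using F by (subst nn_integral_count_space'[where A=F]) auto
  also have "\<dots> \<le> (\<integral>\<^sup>+x. ennreal (f x) \<partial>count_space A)"
    by (intro nn_integral_mono) (auto split: split_indicator)
  finally show "ennreal (sum f F) \<le> (\<integral>\<^sup>+x. ennreal (f x) \<partial>count_space A)" .
qed

context cocompact_lattice
begin

lemma countable_\<Gamma>: "countable \<Gamma>"
proof -
  have "\<Gamma> \<subseteq> (\<Union>n::nat. {\<gamma>\<in>\<Gamma>. cmod (\<gamma>$3$3) \<le> real n})" using real_arch_simple by blast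
  moreover have "countable (\<Union>n::nat. {\<gamma>\<in>\<Gamma>. cmod (\<gamma>$3$3) \<le> real n})"
    by (rule countable_UN[OF countableI_type]) (rule countable_finite[OF finite_bounded])
  ultimately show ?thesis by (rule countable_subset)
qed

text \<open>
  All that unfolding needs to know about a fundamental domain.
\<close>

abbreviation tiles :: "(complex^2) set \<Rightarrow> bool" where
  "tiles F' \<equiv> (AE z in hyp_measure. \<exists>\<gamma>\<in>\<Gamma>. act \<gamma> z \<in> F' \<and> (\<forall>\<sigma>\<in>\<Gamma>. act \<sigma> z \<in> F' \<longrightarrow> \<sigma> = \<gamma>))"

text \<open>
  Passing to a Borel subset of full measure keeps all later integrals with respect to the Borel
  measure. The exceptional points lie in countably many images of null sets under the action.
\<close>

lemma borel_fundamental: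
  assumes "fundamental_domain \<Gamma> F"
  obtains F' where "F' \<in> sets borel" "F' \<subseteq> F" "negligible (F - F')" "F' \<subseteq> ball 0 1"
    "tiles F'"
proof -
  have F: "F \<in> sets lebesgue" "F \<subseteq> ball 0 1" "\<And>z. z \<in> ball 0 1 \<Longrightarrow> \<exists>\<gamma>\<in>\<Gamma>. act \<gamma> z \<in> F"
     "\<And>\<gamma>. \<gamma> \<in> \<Gamma> \<Longrightarrow> \<gamma> \<noteq> mat 1 \<Longrightarrow> negligible (F \<inter> act \<gamma> ` F)"
    using assms unfolding fundamental_domain_def by auto
  obtain F' N N' where d: "F = F' \<union> N" "N \<subseteq> N'" "N' \<in> null_sets lborel" "F' \<in> sets lborel"
    using sets_completionE[OF F(1)] by metis
  have negN: "negligible N'"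
    using d(3) unfolding negligible_iff_null_sets by (rule null_sets_completionI)
  have neg: "negligible (F - F')"
    by (rule negligible_subset[OF negN]) (use d in auto)
  (* Points whose translate in F misses F', and points with two translates in F. *)
  define Z where "Z = (\<Union>\<sigma>\<in>\<Gamma>. act \<sigma> ` (F - F')) \<union> (\<Union>\<sigma>\<in>\<Gamma>. \<Union>\<tau>\<in>\<Gamma> - {mat 1}. act \<sigma> ` (F \<inter> act \<tau> ` F))"
  have "negligible Z"
    unfolding Z_def
  proof (intro negligible_Un negligible_countable_Union)
    fix S assume "S \<in> (\<lambda>\<sigma>. act \<sigma> ` (F - F')) ` \<Gamma>"
    then show "negligible S" using neg F(2) by (auto intro!: negligible_act_image in_SU21)
  next
    fix S assume "S \<in> (\<lambda>\<sigma>. \<Union>\<tau>\<in>\<Gamma> - {mat 1}. act \<sigma> ` (F \<inter> act \<tau> ` F)) ` \<Gamma>"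
    then obtain \<sigma> where s: "\<sigma> \<in> \<Gamma>" and S: "S = (\<Union>\<tau>\<in>\<Gamma> - {mat 1}. act \<sigma> ` (F \<inter> act \<tau> ` F))" by auto
    show "negligible S" unfolding S
    proof (intro negligible_countable_Union)
      fix T assume "T \<in> (\<lambda>\<tau>. act \<sigma> ` (F \<inter> act \<tau> ` F)) ` (\<Gamma> - {mat 1})"
      then show "negligible T" using F(2,4) by (auto intro!: negligible_act_image in_SU21 s)
    qed (use countable_\<Gamma> in auto)
  qed (use countable_\<Gamma> in auto)
  then have "AE z in hyp_measure. z \<notin> Z" by (rule AE_hyp_negligible)
  with AE_hyp_ball have ae: "tiles F'"
  proof eventually_elim
    case (elim z)
    obtain \<gamma> where g: "\<gamma> \<in> \<Gamma>" "act \<gamma> z \<in> F" using F(3)[OF elim(1)] by blast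
    have bk: "z = act (SU21_inv \<gamma>) (act \<gamma> z)" using act_inv(1)[OF in_SU21[OF g(1)] elim(1)] by simp
    have "act \<gamma> z \<in> F'"
    proof (rule ccontr)
      assume "act \<gamma> z \<notin> F'"
      then have "z \<in> act (SU21_inv \<gamma>) ` (F - F')" using bk g(2) by blast
      then have "z \<in> (\<Union>\<sigma>\<in>\<Gamma>. act \<sigma> ` (F - F'))" by (rule UN_I[OF inv_mem[OF g(1)]])
      then show False using elim(2) unfolding Z_def by (simp only: Un_iff simp_thms)
    qed
    moreover have "\<sigma> = \<gamma>" if s: "\<sigma> \<in> \<Gamma>" "act \<sigma> z \<in> F'" for \<sigma>
    proof (rule ccontr)
      assume ne: "\<sigma> \<noteq> \<gamma>"
      define \<tau> where "\<tau> = \<gamma> ** SU21_inv \<sigma>"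
      have t: "\<tau> \<in> \<Gamma>" unfolding \<tau>_def by (intro mult_mem inv_mem g s)
      have ts: "\<tau> ** \<sigma> = \<gamma>" unfolding \<tau>_def by (rule mult_inv_eq(1)[OF s(1)])
      have "\<tau> \<noteq> mat 1" using ts ne by auto
      have "act \<gamma> z = act \<tau> (act \<sigma> z)" using act_mult[OF in_SU21[OF s(1)] elim(1), of \<tau>] ts by simp
      then have "act \<gamma> z \<in> F \<inter> act \<tau> ` F" using g(2) s(2) d(1) by blast
      then have "z \<in> act (SU21_inv \<gamma>) ` (F \<inter> act \<tau> ` F)" using bk by blast
      then have "z \<in> (\<Union>\<tau>\<in>\<Gamma> - {mat 1}. act (SU21_inv \<gamma>) ` (F \<inter> act \<tau> ` F))"
        using t \<open>\<tau> \<noteq> mat 1\<close> by (intro UN_I[of \<tau>]) simp_all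
      then have "z \<in> (\<Union>\<sigma>\<in>\<Gamma>. \<Union>\<tau>\<in>\<Gamma> - {mat 1}. act \<sigma> ` (F \<inter> act \<tau> ` F))"
        by (rule UN_I[OF inv_mem[OF g(1)]])
      then show False using elim(2) unfolding Z_def by (simp only: Un_iff simp_thms)
    qed
    ultimately show ?case using g(1) by blast
  qed
  show ?thesis
    by (rule that[OF _ _ neg _ ae]) (use d F(2) in auto)
qed

lemma bij_inv: "bij_betw SU21_inv \<Gamma> \<Gamma>"
proof (rule bij_betwI[where g = SU21_inv])
  have "SU21_inv (SU21_inv \<gamma>) = \<gamma>" if "\<gamma> \<in> \<Gamma>" for \<gamma>
    using inv_mult_eq(1)[OF that, of "SU21_inv (SU21_inv \<gamma>)"] SU21_inv(2)[OF in_SU21[OF that]]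
      SU21_inv(2)[OF in_SU21[OF inv_mem[OF that]]] inv_mult_eq(2)[OF that, of "SU21_inv (SU21_inv \<gamma>)"]
    by simp
  then show "\<And>x. x \<in> \<Gamma> \<Longrightarrow> SU21_inv (SU21_inv x) = x" "\<And>x. x \<in> \<Gamma> \<Longrightarrow> SU21_inv (SU21_inv x) = x" by auto
qed (use inv_mem in auto)

lemma nn_integral_translate:
  assumes g: "\<gamma> \<in> \<Gamma>" and [measurable]: "E \<in> sets borel" "u \<in> borel_measurable borel"
  shows "(\<integral>\<^sup>+z. indicator E z * u (act \<gamma> z) \<partial>hyp_measure) = (\<integral>\<^sup>+z. indicator E (act (SU21_inv \<gamma>) z) * u z \<partial>hyp_measure)"
proof -
  have "(\<integral>\<^sup>+z. indicator E (act (SU21_inv \<gamma>) z) * u z \<partial>hyp_measure) = 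
     (\<integral>\<^sup>+z. indicator E (act (SU21_inv \<gamma>) (act \<gamma> z)) * u (act \<gamma> z) \<partial>hyp_measure)"
    by (rule nn_integral_act[OF in_SU21[OF g], symmetric]) measurable
  also have "\<dots> = (\<integral>\<^sup>+z. indicator E z * u (act \<gamma> z) \<partial>hyp_measure)"
    using AE_hyp_ball by (intro nn_integral_cong_AE) (auto simp: act_inv(1)[OF in_SU21[OF g]])
  finally show ?thesis ..
qed

text \<open>
  Tonelli's theorem and invariance of the measure, applied term by term to the sum over the lattice.
\<close>

lemma nn_integral_unfold_gen:
  assumes [measurable]: "E \<in> sets borel" "u \<in> borel_measurable borel"
  shows "(\<integral>\<^sup>+z. indicator E z * (\<integral>\<^sup>+\<gamma>. u (act \<gamma> z) \<partial>count_space \<Gamma>) \<partial>hyp_measure)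
       = (\<integral>\<^sup>+z. (\<integral>\<^sup>+\<gamma>. indicator E (act \<gamma> z) \<partial>count_space \<Gamma>) * u z \<partial>hyp_measure)"
proof -
  have "(\<integral>\<^sup>+z. indicator E z * (\<integral>\<^sup>+\<gamma>. u (act \<gamma> z) \<partial>count_space \<Gamma>) \<partial>hyp_measure) =
     (\<integral>\<^sup>+z. (\<integral>\<^sup>+\<gamma>. indicator E z * u (act \<gamma> z) \<partial>count_space \<Gamma>) \<partial>hyp_measure)"
    by (intro nn_integral_cong) (subst nn_integral_cmult, auto)
  also have "\<dots> = (\<integral>\<^sup>+\<gamma>. (\<integral>\<^sup>+z. indicator E z * u (act \<gamma> z) \<partial>hyp_measure) \<partial>count_space \<Gamma>)"
    by (rule nn_integral_count_space_nn_integral[OF countable_\<Gamma>]) measurable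
  also have "\<dots> = (\<integral>\<^sup>+\<gamma>. (\<integral>\<^sup>+z. indicator E (act (SU21_inv \<gamma>) z) * u z \<partial>hyp_measure) \<partial>count_space \<Gamma>)"
    by (intro nn_integral_cong nn_integral_translate) auto
  also have "\<dots> = (\<integral>\<^sup>+\<gamma>. (\<integral>\<^sup>+z. indicator E (act \<gamma> z) * u z \<partial>hyp_measure) \<partial>count_space \<Gamma>)"
    by (rule nn_integral_bij_count_space[OF bij_inv])
  also have "\<dots> = (\<integral>\<^sup>+z. (\<integral>\<^sup>+\<gamma>. indicator E (act \<gamma> z) * u z \<partial>count_space \<Gamma>) \<partial>hyp_measure)"
    by (rule nn_integral_count_space_nn_integral[OF countable_\<Gamma>, symmetric]) measurable
  also have "\<dots> = (\<integral>\<^sup>+z. (\<integral>\<^sup>+\<gamma>. indicator E (act \<gamma> z) \<partial>count_space \<Gamma>) * u z \<partial>hyp_measure)"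
    by (intro nn_integral_cong) (subst nn_integral_multc, auto)
  finally show ?thesis .
qed

lemma nn_integral_unfold:
  assumes [measurable]: "F' \<in> sets borel" "u \<in> borel_measurable borel"
   and ae: "tiles F'"
  shows "(\<integral>\<^sup>+z. indicator F' z * (\<integral>\<^sup>+\<gamma>. u (act \<gamma> z) \<partial>count_space \<Gamma>) \<partial>hyp_measure) = (\<integral>\<^sup>+z. u z \<partial>hyp_measure)"
proof -
  have "(\<integral>\<^sup>+z. (\<integral>\<^sup>+\<gamma>. indicator F' (act \<gamma> z) \<partial>count_space \<Gamma>) * u z \<partial>hyp_measure) = (\<integral>\<^sup>+z. u z \<partial>hyp_measure)"
  proof (rule nn_integral_cong_AE)
    show "AE z in hyp_measure. (\<integral>\<^sup>+\<gamma>. indicator F' (act \<gamma> z) \<partial>count_space \<Gamma>) * u z = u z"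
      using ae
    proof eventually_elim
      case (elim z)
      then obtain \<gamma> where g: "\<gamma> \<in> \<Gamma>" "act \<gamma> z \<in> F'" "\<And>\<sigma>. \<sigma> \<in> \<Gamma> \<Longrightarrow> act \<sigma> z \<in> F' \<Longrightarrow> \<sigma> = \<gamma>" by blast
      have "(\<integral>\<^sup>+\<gamma>. indicator F' (act \<gamma> z) \<partial>count_space \<Gamma>) = (\<Sum>\<sigma>\<in>{\<gamma>}. indicator F' (act \<sigma> z) :: ennreal)"
      proof (rule nn_integral_count_space')
        fix \<sigma> assume "\<sigma> \<in> \<Gamma>" "\<sigma> \<notin> {\<gamma>}"
        then have "act \<sigma> z \<notin> F'" using g(3) by blast
        then show "indicator F' (act \<sigma> z) = (0::ennreal)" by simp
      qed (use g(1) in auto)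
      then show ?case using g(2) by simp
    qed
  qed
  then show ?thesis using nn_integral_unfold_gen[of F' u] by simp
qed

text \<open>
  If \<open>w\<close> and \<open>\<gamma> w\<close> both stay away from the boundary, the automorphy factor at \<open>w\<close> is bounded, and it
  is comparable with the height.
\<close>

lemma return_bound:
  assumes g: "\<gamma> \<in> \<Gamma>" and w: "w \<in> cball 0 r" "act \<gamma> w \<in> cball 0 r" and r: "r < 1"
  shows "cmod (\<gamma>$3$3) \<le> 1 / (1 - r)\<^sup>2"
proof -
  have wb: "w \<in> ball 0 1" using w r by auto
  have r0: "0 \<le> r" using w(1) norm_ge_zero[of w] by (simp del: norm_ge_zero) 
  have ng: "norm (act \<gamma> w) \<le> r" using w by simp
  have "(norm (act \<gamma> w))\<^sup>2 \<le> r\<^sup>2" by (rule power_mono[OF ng]) simp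
  then have ge: "rho (act \<gamma> w) \<ge> 1 - r\<^sup>2" unfolding rho_def by simp
  have "(1 - r)\<^sup>2 \<le> 1 - r\<^sup>2"
    using r r0 mult_nonneg_nonneg[of r "1 - r"] by (simp add: power2_eq_square algebra_simps)
  then have "(1 - r)\<^sup>2 \<le> rho w / (cmod (autfactor \<gamma> w))\<^sup>2" using ge rho_act[OF in_SU21[OF g] wb] by simp
  then have "(1 - r)\<^sup>2 * (cmod (autfactor \<gamma> w))\<^sup>2 \<le> 1"
    using rho_le_1[of w] autfactor_nz[OF in_SU21[OF g] wb] by (simp add: pos_le_divide_eq)
  then have "((1 - r) * cmod (autfactor \<gamma> w))\<^sup>2 \<le> 1\<^sup>2" by (simp add: power_mult_distrib)
  then have "(1 - r) * cmod (autfactor \<gamma> w) \<le> 1" by (rule power2_le_imp_le) simp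
  moreover have "(1 - r) * (cmod (\<gamma>$3$3) * (1 - r)) \<le> (1 - r) * cmod (autfactor \<gamma> w)"
  proof (intro mult_left_mono)
    have "cmod (\<gamma>$3$3) * (1 - r) \<le> cmod (\<gamma>$3$3) * (1 - norm w)" using w by (intro mult_left_mono) auto
    then show "cmod (\<gamma>$3$3) * (1 - r) \<le> cmod (autfactor \<gamma> w)" using autfactor_ge[OF in_SU21[OF g], of w] by simp
  qed (use r in auto)
  ultimately have "cmod (\<gamma>$3$3) * (1 - r)\<^sup>2 \<le> 1" by (simp add: power2_eq_square mult_ac)
  then show ?thesis using r by (simp add: pos_le_divide_eq)
qed

text \<open>
  A bound for the number of points of an orbit in the ball of radius \<open>r\<close>.
\<close>

definition mult_bound :: "real \<Rightarrow> nat" where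
  "mult_bound r = card {\<gamma>\<in>\<Gamma>. cmod (\<gamma>$3$3) \<le> 1 / (1 - r)\<^sup>2}"

lemma overlap:
  assumes z: "z \<in> ball 0 1" and r: "r < 1"
  shows "finite {\<gamma>\<in>\<Gamma>. act \<gamma> z \<in> cball 0 r}" "card {\<gamma>\<in>\<Gamma>. act \<gamma> z \<in> cball 0 r} \<le> mult_bound r"
proof -
  have "finite {\<gamma>\<in>\<Gamma>. act \<gamma> z \<in> cball 0 r} \<and> card {\<gamma>\<in>\<Gamma>. act \<gamma> z \<in> cball 0 r} \<le> mult_bound r"
  proof (cases "{\<gamma>\<in>\<Gamma>. act \<gamma> z \<in> cball 0 r} = {}")
    case False
    then obtain \<sigma> where s: "\<sigma> \<in> \<Gamma>" "act \<sigma> z \<in> cball 0 r" by blast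
    let ?T = "{\<gamma>\<in>\<Gamma>. cmod (\<gamma>$3$3) \<le> 1 / (1 - r)\<^sup>2}"
    have sub: "{\<gamma>\<in>\<Gamma>. act \<gamma> z \<in> cball 0 r} \<subseteq> (\<lambda>\<tau>. \<tau> ** \<sigma>) ` ?T"
    proof
      fix \<gamma> assume "\<gamma> \<in> {\<gamma>\<in>\<Gamma>. act \<gamma> z \<in> cball 0 r}"
      then have g: "\<gamma> \<in> \<Gamma>" "act \<gamma> z \<in> cball 0 r" by auto
      define \<tau> where "\<tau> = \<gamma> ** SU21_inv \<sigma>"
      have t: "\<tau> \<in> \<Gamma>" unfolding \<tau>_def by (intro mult_mem inv_mem g s)
      have ts: "\<tau> ** \<sigma> = \<gamma>" unfolding \<tau>_def by (rule mult_inv_eq(1)[OF s(1)])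
      have "act \<tau> (act \<sigma> z) \<in> cball 0 r" using act_mult[OF in_SU21[OF s(1)] z, of \<tau>] ts g by simp
      then have "\<tau> \<in> ?T" using return_bound[OF t s(2) _ r] t by simp
      then show "\<gamma> \<in> (\<lambda>\<tau>. \<tau> ** \<sigma>) ` ?T" using ts by blast
    qed
    have fin: "finite ?T" by (rule finite_bounded)
    show ?thesis using finite_subset[OF sub] fin card_mono[OF _ sub] card_image_le[OF fin, of "\<lambda>\<tau>. \<tau> ** \<sigma>"]
      unfolding mult_bound_def by auto
  next
    case True
    show ?thesis unfolding True by simp
  qed
  then show "finite {\<gamma>\<in>\<Gamma>. act \<gamma> z \<in> cball 0 r}" "card {\<gamma>\<in>\<Gamma>. act \<gamma> z \<in> cball 0 r} \<le> mult_bound r" by auto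
qed

lemma overlap_nn:
  assumes z: "z \<in> ball 0 1" and r: "r < 1" and E: "E \<subseteq> cball 0 r"
  shows "(\<integral>\<^sup>+\<gamma>. indicator E (act \<gamma> z) \<partial>count_space \<Gamma>) \<le> ennreal (mult_bound r)"
proof -
  let ?S = "{\<gamma>\<in>\<Gamma>. act \<gamma> z \<in> cball 0 r}"
  have "(\<integral>\<^sup>+\<gamma>. indicator E (act \<gamma> z) \<partial>count_space \<Gamma>) \<le> (\<integral>\<^sup>+\<gamma>. indicator ?S \<gamma> \<partial>count_space \<Gamma>)"
    using E by (intro nn_integral_mono) (auto split: split_indicator)
  also have "\<dots> = (\<Sum>\<gamma>\<in>?S. indicator ?S \<gamma>)"
    by (rule nn_integral_count_space') (use overlap(1)[OF z r] in auto)
  also have "\<dots> = of_nat (card ?S)" by simp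
  also have "\<dots> \<le> of_nat (mult_bound r)" using overlap(2)[OF z r] by (simp only: of_nat_le_iff)
  finally show ?thesis by (simp add: ennreal_of_nat_eq_real_of_nat)
qed

text \<open>
  Integrate \<open>\<Sum>\<gamma>. (1 - |\<gamma> z|^2)^3\<close> over the ball of radius 1/2. After unfolding this is at most the
  volume of the unit ball times the overlap multiplicity, hence finite; on the other hand each summand
  is bounded below by a multiple of the inverse sixth power of the height.
\<close>

lemma summable_orbit: "(\<lambda>\<gamma>. 1 / cmod (\<gamma>$3$3) ^ 6) summable_on \<Gamma>"
proof -
  define E :: "(complex^2) set" where "E = ball 0 (1/2)"
  have Em [measurable]: "E \<in> sets borel" unfolding E_def by simp
  define u where "u z = ennreal (rho z ^ 3)" for z
  have um [measurable]: "u \<in> borel_measurable borel" unfolding u_def by measurable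
  have "(\<integral>\<^sup>+z. (\<integral>\<^sup>+\<gamma>. indicator E (act \<gamma> z) \<partial>count_space \<Gamma>) * u z \<partial>hyp_measure)
       \<le> (\<integral>\<^sup>+z. ennreal (mult_bound (1/2)) * u z \<partial>hyp_measure)"
  proof (rule nn_integral_mono_AE)
    show "AE z in hyp_measure. (\<integral>\<^sup>+\<gamma>. indicator E (act \<gamma> z) \<partial>count_space \<Gamma>) * u z \<le> ennreal (mult_bound (1/2)) * u z"
      using AE_hyp_ball by eventually_elim (intro mult_right_mono overlap_nn, auto simp: E_def)
  qed
  also have "\<dots> = ennreal (mult_bound (1/2)) * (\<integral>\<^sup>+z. u z \<partial>hyp_measure)"
    by (subst nn_integral_cmult) measurable
  also have "(\<integral>\<^sup>+z. u z \<partial>hyp_measure) = (\<integral>\<^sup>+z. indicator (ball 0 1) z \<partial>(lborel :: (complex^2) measure))"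
  proof (subst nn_integral_hyp_measure[OF um], intro nn_integral_cong)
    fix z :: "complex^2"
    show "ennreal (indicator (ball 0 1) z / rho z ^ 3) * u z = indicator (ball 0 1) z"
      using hyp_density_cancel[of z 1] by (cases "z \<in> ball 0 1") (auto simp: u_def)
  qed
  also have "\<dots> = emeasure lborel (ball (0::complex^2) 1)" by simp
  finally have le1: "(\<integral>\<^sup>+z. indicator E z * (\<integral>\<^sup>+\<gamma>. u (act \<gamma> z) \<partial>count_space \<Gamma>) \<partial>hyp_measure)
      \<le> ennreal (mult_bound (1/2)) * emeasure lborel (ball (0::complex^2) 1)"
    unfolding nn_integral_unfold_gen[OF Em um] .
  have lt: "ennreal (mult_bound (1/2)) * emeasure lborel (ball (0::complex^2) 1) < \<infinity>"
    using emeasure_lborel_ball_finite[of "0::complex^2" 1] by (auto simp: ennreal_mult_less_top)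
  (* On E, 1 - |z|^2 is at least 3/4 and the automorphy factor at most 3/2 times the height. *)
  define c where "c = (3/4 / (3/2)\<^sup>2 :: real)^3"
  have c: "c > 0" by (simp add: c_def)
  have low: "u (act \<gamma> z) \<ge> ennreal (c * (1 / cmod (\<gamma>$3$3) ^ 6))" if z: "z \<in> E" and g: "\<gamma> \<in> \<Gamma>" for z \<gamma>
  proof -
    have zb: "z \<in> ball 0 1" using z by (auto simp: E_def)
    have "(norm z)\<^sup>2 \<le> (1/2)\<^sup>2" using z by (intro power_mono) (auto simp: E_def)
    then have rz: "rho z \<ge> 3/4" unfolding rho_def by (simp add: power2_eq_square)
    have "cmod (\<gamma>$3$3) * (1 + norm z) \<le> cmod (\<gamma>$3$3) * (3/2)"
      using z by (intro mult_left_mono) (auto simp: E_def)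
    then have j: "cmod (autfactor \<gamma> z) \<le> 3/2 * cmod (\<gamma>$3$3)"
      using autfactor_le[OF in_SU21[OF g], of z] by linarith
    have D: "cmod (\<gamma>$3$3) > 0" using SU21_33_ge_1[OF in_SU21[OF g]] by linarith
    have jp: "cmod (autfactor \<gamma> z) > 0" using autfactor_nz[OF in_SU21[OF g] zb] by simp
    have "3/4 / (3/2 * cmod (\<gamma>$3$3))\<^sup>2 \<le> rho (act \<gamma> z)"
      unfolding rho_act[OF in_SU21[OF g] zb] using rz j jp D by (intro frac_le power_mono) auto
    then have "(3/4 / (3/2 * cmod (\<gamma>$3$3))\<^sup>2)^3 \<le> rho (act \<gamma> z)^3" by (rule power_mono) simp
    moreover have "(3/4 / (3/2 * cmod (\<gamma>$3$3))\<^sup>2)^3 = c * (1 / cmod (\<gamma>$3$3) ^ 6)"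
      by (simp add: c_def power_divide power_mult_distrib flip: power_mult)
    ultimately show ?thesis unfolding u_def by (intro ennreal_leI) simp
  qed
  define s where "s = (\<integral>\<^sup>+\<gamma>. ennreal (c * (1 / cmod (\<gamma>$3$3) ^ 6)) \<partial>count_space \<Gamma>)"
  have "(\<integral>\<^sup>+z. indicator E z * s \<partial>hyp_measure) \<le> (\<integral>\<^sup>+z. indicator E z * (\<integral>\<^sup>+\<gamma>. u (act \<gamma> z) \<partial>count_space \<Gamma>) \<partial>hyp_measure)"
    unfolding s_def by (intro nn_integral_mono) (auto split: split_indicator intro!: nn_integral_mono low[simplified])
  also have "\<dots> < \<infinity>" using le1 lt by (rule le_less_trans)
  finally have "(\<integral>\<^sup>+z. indicator E z * s \<partial>hyp_measure) < \<infinity>" .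
  moreover have "(\<integral>\<^sup>+z. indicator E z * s \<partial>hyp_measure) = emeasure hyp_measure E * s"
    by (subst nn_integral_multc) (simp_all)
  moreover have "emeasure hyp_measure E > 0"
  proof -
    have "emeasure lborel E \<le> emeasure hyp_measure E"
    proof -
      have "emeasure lborel E = (\<integral>\<^sup>+z. indicator E z \<partial>lborel)" by simp
      also have "\<dots> \<le> (\<integral>\<^sup>+z. ennreal (indicator (ball 0 1) z / rho z ^ 3) * indicator E z \<partial>lborel)"
      proof (intro nn_integral_mono)
        fix z :: "complex^2"
        show "indicator E z \<le> ennreal (indicator (ball 0 1) z / rho z ^ 3) * indicator E z"
        proof (cases "z \<in> E")
          case True
          then have "z \<in> ball 0 1" by (auto simp: E_def)
          moreover have "1 \<le> 1 / rho z ^ 3" using rho_pos[OF \<open>z \<in> ball 0 1\<close>] rho_le_1[of z] by (simp add: power_le_one)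
          ultimately show ?thesis using True by simp
        qed simp
      qed
      also have "\<dots> = emeasure hyp_measure E"
        using nn_integral_hyp_measure[of "indicator E"] by simp
      finally show ?thesis .
    qed
    moreover have "emeasure lborel E > 0"
      unfolding E_def by (subst emeasure_ball) (auto intro!: ennreal_less_zero_iff[THEN iffD2] mult_pos_pos unit_ball_vol_pos)
    ultimately show ?thesis by (rule less_le_trans[rotated])
  qed
  ultimately have sfin: "s < \<infinity>" by (metis ennreal_mult_eq_top_iff infinity_ennreal_def less_top not_gr_zero)
  have bd: "(\<Sum>\<gamma>\<in>T. 1 / cmod (\<gamma>$3$3) ^ 6) \<le> enn2real s / c" if T: "T \<subseteq> \<Gamma>" "finite T" for T
  proof -
    have "ennreal (\<Sum>\<gamma>\<in>T. c * (1 / cmod (\<gamma>$3$3) ^ 6)) = (\<Sum>\<gamma>\<in>T. ennreal (c * (1 / cmod (\<gamma>$3$3) ^ 6)))"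
      using c by (intro sum_ennreal[symmetric]) auto
    also have "\<dots> = (\<integral>\<^sup>+\<gamma>. ennreal (c * (1 / cmod (\<gamma>$3$3) ^ 6)) * indicator T \<gamma> \<partial>count_space \<Gamma>)"
      using T by (subst nn_integral_count_space'[where A=T]) auto
    also have "\<dots> \<le> s" unfolding s_def by (intro nn_integral_mono) (auto split: split_indicator)
    also have "s = ennreal (enn2real s)" using sfin by simp
    finally have "(\<Sum>\<gamma>\<in>T. c * (1 / cmod (\<gamma>$3$3) ^ 6)) \<le> enn2real s" by (simp add: ennreal_le_iff)
    then have "c * (\<Sum>\<gamma>\<in>T. 1 / cmod (\<gamma>$3$3) ^ 6) \<le> enn2real s" by (simp only: sum_distrib_left)
    then show ?thesis using c by (simp add: pos_le_divide_eq mult.commute)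
  qed
  show ?thesis
    by (rule nonneg_bdd_above_summable_on) (use bd in \<open>auto intro!: bdd_aboveI\<close>)
qed

end

section \<open>Poincare series\<close>

text \<open>
  The Gaussian is dominated by a sum over \<open>n\<close> of \<open>exp (- n)\<close> times the indicator of a ball of radius
  \<open>(n + 1) / sqrt a\<close>, and balls of radius \<open>R\<close> have volume proportional to \<open>R^4\<close>.
\<close>

lemma gaussian_integral_bound:
  "\<exists>G>0. \<forall>a>0. \<forall>z::complex^2. (\<integral>\<^sup>+w. ennreal (exp (- a * (norm (w - z))\<^sup>2)) \<partial>lborel) \<le> ennreal (G / a\<^sup>2)"
proof -
  define V where "V = (unit_ball_vol 4 :: real)"
  have V: "V > 0" unfolding V_def by (rule unit_ball_vol_pos) simp
  define t where "t n = exp (- real n) * V * (real n + 1) ^ 4" for n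
  have summ: "summable t"
  proof (rule summable_comparison_test_bigo)
    show "summable (\<lambda>n. norm (inverse (real n ^ 2)))" using inverse_power_summable[of 2, where 'a=real] by simp
    have "(\<lambda>n. exp (- real n) * (real n + 1) ^ 4) \<in> O(\<lambda>n. inverse (real n ^ 2))" by real_asymp
    then have "(\<lambda>n. V * (exp (- real n) * (real n + 1) ^ 4)) \<in> O(\<lambda>n. inverse (real n ^ 2))" using V by simp
    then show "t \<in> O(\<lambda>n. inverse (real n ^ 2))" unfolding t_def[abs_def] by (simp only: mult_ac)
  qed
  have t0: "t n \<ge> 0" for n using V by (simp add: t_def)
  define G where "G = suminf t + 1"
  have G: "G > 0" unfolding G_def using suminf_nonneg[OF summ t0] by simp
  have "(\<integral>\<^sup>+w. ennreal (exp (- a * (norm (w - z))\<^sup>2)) \<partial>lborel) \<le> ennreal (G / a\<^sup>2)" if a: "a > 0" for a and z :: "complex^2"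
  proof -
    define b where "b n = ball z ((real n + 1) / sqrt a)" for n
    have pt: "ennreal (exp (- a * (norm (w - z))\<^sup>2)) \<le> (\<Sum>n. ennreal (exp (- real n)) * indicator (b n) w)" for w
    proof -
      define x where "x = sqrt a * norm (w - z)"
      have x0: "x \<ge> 0" using a by (simp add: x_def)
      (* The summand of this index alone dominates the Gaussian at w. *)
      define n where "n = nat \<lfloor>x\<rfloor>"
      have n: "real n \<le> x" "x < real n + 1" using x0 unfolding n_def by linarith+
      have "real n \<le> (real n)\<^sup>2" by (cases n) (auto simp: power2_eq_square)
      also have "\<dots> \<le> x\<^sup>2" using n by (intro power_mono) auto
      also have "x\<^sup>2 = a * (norm (w - z))\<^sup>2" using a by (simp add: x_def power_mult_distrib)
      finally have "exp (- a * (norm (w - z))\<^sup>2) \<le> exp (- real n)" by simp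
      moreover have "w \<in> b n" using n(2) a unfolding b_def x_def by (simp add: dist_norm norm_minus_commute pos_less_divide_eq mult.commute)
      ultimately have "ennreal (exp (- a * (norm (w - z))\<^sup>2)) \<le> ennreal (exp (- real n)) * indicator (b n) w"
        by (simp add: ennreal_leI)
      also have "\<dots> = (\<Sum>m\<in>{n}. ennreal (exp (- real m)) * indicator (b m) w)"
        by (subst sum.insert) (simp_all only: sum.empty add_0_right finite.emptyI empty_iff not_False_eq_True)
      also have "\<dots> \<le> (\<Sum>n. ennreal (exp (- real n)) * indicator (b n) w)" by (rule sum_le_suminf) auto
      finally show ?thesis .
    qed
    have "(\<integral>\<^sup>+w. ennreal (exp (- a * (norm (w - z))\<^sup>2)) \<partial>lborel) \<le> (\<integral>\<^sup>+w. (\<Sum>n. ennreal (exp (- real n)) * indicator (b n) w) \<partial>lborel)"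
      by (intro nn_integral_mono pt)
    also have "\<dots> = (\<Sum>n. \<integral>\<^sup>+w. ennreal (exp (- real n)) * indicator (b n) w \<partial>lborel)"
      by (rule nn_integral_suminf) (simp add: b_def)
    also have "\<dots> = (\<Sum>n. ennreal (t n / a\<^sup>2))"
    proof (intro suminf_cong)
      fix n
      have "(\<integral>\<^sup>+w. ennreal (exp (- real n)) * indicator (b n) w \<partial>lborel) = ennreal (exp (- real n)) * emeasure lborel (b n)"
        by (rule nn_integral_cmult_indicator) (simp add: b_def)
      also have "emeasure lborel (b n) = ennreal (V * ((real n + 1) / sqrt a) ^ 4)"
        unfolding b_def using a by (subst emeasure_ball) (auto simp: V_def)
      also have "sqrt a ^ 4 = a\<^sup>2"
        using a real_sqrt_pow2[of a] by (simp add: power4_eq_xxxx power2_eq_square)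
      then have "((real n + 1) / sqrt a) ^ 4 = (real n + 1) ^ 4 / a\<^sup>2" by (simp add: power_divide)
      finally show "(\<integral>\<^sup>+w. ennreal (exp (- real n)) * indicator (b n) w \<partial>lborel) = ennreal (t n / a\<^sup>2)"
        using V by (simp add: t_def ennreal_mult[symmetric] mult_ac)
    qed
    also have "\<dots> = ennreal (\<Sum>n. t n / a\<^sup>2)"
      by (rule suminf_ennreal2) (use t0 summable_divide[OF summ] in auto)
    also have "\<dots> \<le> ennreal (G / a\<^sup>2)"
      using suminf_divide[OF summ, of "a\<^sup>2"] a by (intro ennreal_leI) (simp add: G_def divide_right_mono)
    finally show ?thesis .
  qed
  then show ?thesis using G by blast
qed

lemma measurable_herm [measurable]: "(\<lambda>w. herm w z) \<in> borel_measurable borel"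
  unfolding herm_def by (intro borel_measurable_continuous_onI continuous_intros)

lemma measurable_proximity [measurable]: "(\<lambda>w. proximity w z) \<in> borel_measurable borel"
  unfolding proximity_def by measurable

lemma rho_ge: "z \<in> cball 0 r \<Longrightarrow> 0 \<le> r \<Longrightarrow> r \<le> 1 \<Longrightarrow> rho z \<ge> 1 - r"
  unfolding rho_def using power_mono[of "norm z" r 2] mult_left_le[of r r] by (simp add: power2_eq_square)

text \<open>
  Since \<open>proximity w z \<le> 1 - c |w - z|^2\<close>, its powers are dominated by Gaussians. Three of the \<open>k\<close> factors are
  set aside to cancel the density \<open>(1 - |w|^2)^(-3)\<close>.
\<close>

lemma proximity_integral_bound:
  assumes r: "0 < r" "r < 1"
  shows "\<exists>C>0. \<forall>k\<ge>6. \<forall>z\<in>cball 0 r. (\<integral>\<^sup>+w. ennreal (proximity w z ^ k) \<partial>hyp_measure) \<le> ennreal (C / (real k)\<^sup>2)"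
proof -
  obtain G where G: "G > 0" "\<And>a z. a > 0 \<Longrightarrow> (\<integral>\<^sup>+w. ennreal (exp (- a * (norm (w - z))\<^sup>2)) \<partial>(lborel :: (complex^2) measure)) \<le> ennreal (G / a\<^sup>2)"
    using gaussian_integral_bound by blast
  define c where "c = (1 - r) / 8"
  have c: "c > 0" using r by (simp add: c_def)
  have main: "(\<integral>\<^sup>+w. ennreal (proximity w z ^ k) \<partial>hyp_measure) \<le> ennreal (G / (c\<^sup>2 * (1 - r) ^ 6) / (real k)\<^sup>2)"
    if k: "k \<ge> 6" and z: "z \<in> cball 0 r" for k z
  proof -
    have zb: "z \<in> ball 0 1" using z r by auto
    have pt: "ennreal (indicator (ball 0 1) w / rho w ^ 3) * ennreal (proximity w z ^ k) \<le> 
        ennreal (1 / (1 - r) ^ 6) * ennreal (exp (- (c * real k) * (norm (w - z))\<^sup>2))" for w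
    proof (cases "w \<in> ball 0 1")
      case True
      have rw: "rho w > 0" by (rule rho_pos[OF True])
      have q0: "proximity w z \<ge> 0" using proximity_pos[OF True zb] by simp
      have "proximity w z \<le> rho w / (1 - norm z)\<^sup>2" by (rule proximity_le_rho[OF zb True])
      also have "\<dots> \<le> rho w / (1 - r)\<^sup>2" using rw z r by (intro divide_left_mono power_mono mult_pos_pos) auto
      finally have q1: "proximity w z ^ 3 \<le> (rho w / (1 - r)\<^sup>2) ^ 3" by (intro power_mono q0)
      have "proximity w z \<le> 1 - 2 * c * (norm (w - z))\<^sup>2"
      proof -
        have "(1 - r) * (norm (w - z))\<^sup>2 \<le> rho z * (norm (w - z))\<^sup>2"
          using rho_ge[OF z] r by (intro mult_right_mono) auto
        moreover have "2 * c * (norm (w - z))\<^sup>2 = (1 - r) * (norm (w - z))\<^sup>2 / 4" by (simp add: c_def)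
        ultimately show ?thesis using proximity_le[OF zb True] by linarith
      qed
      also have "\<dots> \<le> exp (- (2 * c * (norm (w - z))\<^sup>2))" using exp_ge_add_one_self[of "- (2 * c * (norm (w - z))\<^sup>2)"] by simp
      finally have "proximity w z ^ (k - 3) \<le> exp (- (2 * c * (norm (w - z))\<^sup>2)) ^ (k - 3)" by (intro power_mono q0)
      also have "\<dots> = exp (- (2 * c * (norm (w - z))\<^sup>2) * real (k - 3))" by (rule exp_of_nat2_mult[symmetric])
      also have "\<dots> \<le> exp (- (c * real k) * (norm (w - z))\<^sup>2)"
      proof -
        have "c * (norm (w - z))\<^sup>2 * real k \<le> c * (norm (w - z))\<^sup>2 * (2 * real (k - 3))"
          using k c by (intro mult_left_mono) auto
        then show ?thesis by (simp add: mult_ac)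
      qed
      finally have q2: "proximity w z ^ (k - 3) \<le> exp (- (c * real k) * (norm (w - z))\<^sup>2)" .
      have "proximity w z ^ k = proximity w z ^ 3 * proximity w z ^ (k - 3)" using k by (simp flip: power_add)
      also have "\<dots> \<le> (rho w / (1 - r)\<^sup>2) ^ 3 * exp (- (c * real k) * (norm (w - z))\<^sup>2)"
        using q0 q1 q2 rw by (intro mult_mono) auto
      finally have "1 / rho w ^ 3 * proximity w z ^ k \<le> 1 / rho w ^ 3 * ((rho w / (1 - r)\<^sup>2) ^ 3 * exp (- (c * real k) * (norm (w - z))\<^sup>2))"
        using rw by (intro mult_left_mono) auto
      also have "\<dots> = 1 / (1 - r) ^ 6 * exp (- (c * real k) * (norm (w - z))\<^sup>2)"
        using rw by (simp add: power_divide flip: power_mult)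
      finally show ?thesis using True rw r by (simp add: ennreal_mult[symmetric] q0 ennreal_leI)
    qed simp
    have "(\<integral>\<^sup>+w. ennreal (proximity w z ^ k) \<partial>hyp_measure) = (\<integral>\<^sup>+w. ennreal (indicator (ball 0 1) w / rho w ^ 3) * ennreal (proximity w z ^ k) \<partial>lborel)"
      by (rule nn_integral_hyp_measure) measurable
    also have "\<dots> \<le> (\<integral>\<^sup>+w. ennreal (1 / (1 - r) ^ 6) * ennreal (exp (- (c * real k) * (norm (w - z))\<^sup>2)) \<partial>lborel)"
      by (intro nn_integral_mono pt)
    also have "\<dots> = ennreal (1 / (1 - r) ^ 6) * (\<integral>\<^sup>+w. ennreal (exp (- (c * real k) * (norm (w - z))\<^sup>2)) \<partial>lborel)"
      by (rule nn_integral_cmult) measurable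
    also have "\<dots> \<le> ennreal (1 / (1 - r) ^ 6) * ennreal (G / (c * real k)\<^sup>2)"
      using k c by (intro mult_left_mono G(2)) auto
    also have "\<dots> = ennreal (G / (c\<^sup>2 * (1 - r) ^ 6) / (real k)\<^sup>2)"
      using r G(1) c by (simp add: ennreal_mult[symmetric] power_mult_distrib mult_ac)
    finally show ?thesis .
  qed
  show ?thesis
    by (rule exI[of _ "G / (c\<^sup>2 * (1 - r) ^ 6)"]) (use main G c r in auto)
qed

text \<open>
  One summand of the Poincare series, without the power. For the identity it is \<open>1 / (1 - \<langle>w,z\<rangle>)\<close>,
  whose powers, suitably weighted, are peaked at \<open>z\<close>.
\<close>

definition peak :: "complex^2 \<Rightarrow> complex^2 \<Rightarrow> complex^3^3 \<Rightarrow> complex" where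
  "peak z w \<gamma> = 1 / ((1 - herm (act \<gamma> w) z) * autfactor \<gamma> w)"

lemma cmod_peak:
  assumes "\<gamma> \<in> carrier SU21" "z \<in> ball 0 1" "w \<in> ball 0 1"
  shows "(cmod (peak z w \<gamma>))\<^sup>2 = proximity (act \<gamma> w) z / (rho z * rho w)"
  unfolding peak_def proximity_def rho_act[OF assms(1,3)]
  using rho_pos[OF assms(2)] rho_pos[OF assms(3)]
  by (simp add: norm_divide norm_mult power_mult_distrib power_divide)

text \<open>
  The weighted summand is \<open>proximity^(3k/2)\<close>. The weaker exponent \<open>k\<close> is enough and stays integral.
\<close>

lemma cmod_peak_power:
  assumes "\<gamma> \<in> carrier SU21" "z \<in> ball 0 1" "w \<in> ball 0 1"
  shows "cmod (peak z w \<gamma> ^ (3 * k)) * sqrt (rho z * rho w) ^ (3 * k) \<le> proximity (act \<gamma> w) z ^ k"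
proof -
  let ?q = "proximity (act \<gamma> w) z" and ?s = "sqrt (rho z * rho w)"
  have q: "0 \<le> ?q" "?q \<le> 1" using proximity_pos[OF act_ball[OF assms(1,3)] assms(2)] proximity_le_1[OF assms(2) act_ball[OF assms(1,3)]] by auto
  have p: "rho z * rho w > 0" using rho_pos[OF assms(2)] rho_pos[OF assms(3)] by simp
  have "(cmod (peak z w \<gamma>) * ?s)\<^sup>2 = ?q"
    unfolding power_mult_distrib cmod_peak[OF assms] real_sqrt_pow2[OF less_imp_le[OF p]]
    by (rule nonzero_eq_divide_eq[THEN iffD1, OF less_imp_neq[OF p, symmetric] refl])
  moreover have "cmod (peak z w \<gamma>) * ?s \<ge> 0" using p by simp
  ultimately have eq: "cmod (peak z w \<gamma>) * ?s = sqrt ?q" by (metis real_sqrt_unique)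
  have "sqrt ?q ^ 3 = ?q * sqrt ?q" using q(1) by (simp add: power3_eq_cube)
  also have "\<dots> \<le> ?q" using q by (simp add: mult_left_le)
  finally have "(sqrt ?q ^ 3) ^ k \<le> ?q ^ k" using q by (intro power_mono) auto
  then show ?thesis unfolding norm_power power_mult_distrib[symmetric] eq by (simp add: power_mult)
qed

definition poincare :: "(complex^3^3) set \<Rightarrow> nat \<Rightarrow> complex^2 \<Rightarrow> complex^2 \<Rightarrow> complex" where
  "poincare \<Gamma> k z w = (\<Sum>\<^sub>\<infinity>\<gamma>\<in>\<Gamma>. peak z w \<gamma> ^ (3 * k))"

lemma infsum_power_le:
  fixes f :: "'a \<Rightarrow> real"
  assumes "f summable_on A" "\<And>x. x \<in> A \<Longrightarrow> 0 \<le> g x" "\<And>x. x \<in> A \<Longrightarrow> g x \<le> f x"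
  shows "g summable_on A" "infsum g A \<le> infsum f A"
proof -
  show "g summable_on A" by (rule summable_on_comparison_test[OF assms(1)]) (use assms in auto)
  then show "infsum g A \<le> infsum f A" by (rule infsum_mono) (use assms in auto)
qed

context cocompact_lattice
begin

definition orbit_const :: "real \<Rightarrow> real" where
  "orbit_const r = (\<Sum>\<^sub>\<infinity>\<gamma>\<in>\<Gamma>. 1 / cmod (\<gamma>$3$3) ^ 6) / (1 - r) ^ 12"

definition covers :: "real \<Rightarrow> bool" where
  "covers r \<longleftrightarrow> 0 < r \<and> r < 1 \<and> (\<forall>z\<in>ball 0 1. \<exists>\<gamma>\<in>\<Gamma>. act \<gamma> z \<in> cball 0 r)"

lemma covers_exists: "\<exists>r. covers r"
  unfolding covers_def using exhaustion by blast

text \<open>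
  For \<open>w\<close> in the ball of radius \<open>r\<close> the terms are bounded by inverse powers of the height. Any other
  \<open>w\<close> has a translate there, and the sum does not change along an orbit.
\<close>

lemma proximity_orbit_sum:
  assumes r: "covers r" and z: "z \<in> cball 0 r" and w: "w \<in> ball 0 1" and k: "k \<ge> 3"
  shows "(\<lambda>\<gamma>. proximity (act \<gamma> w) z ^ k) summable_on \<Gamma>"
    and "(\<Sum>\<^sub>\<infinity>\<gamma>\<in>\<Gamma>. proximity (act \<gamma> w) z ^ k) \<le> orbit_const r"
proof -
  have r': "0 < r" "r < 1" using r by (auto simp: covers_def)
  have zb: "z \<in> ball 0 1" using z r' by auto
  have base: "(\<lambda>\<gamma>. proximity (act \<gamma> w) z ^ k) summable_on \<Gamma> \<and> (\<Sum>\<^sub>\<infinity>\<gamma>\<in>\<Gamma>. proximity (act \<gamma> w) z ^ k) \<le> orbit_const r"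
    if w: "w \<in> cball 0 r" for w
  proof -
    have wb: "w \<in> ball 0 1" using w r' by auto
    have le: "proximity (act \<gamma> w) z ^ k \<le> 1 / (1 - r) ^ 12 * (1 / cmod (\<gamma>$3$3) ^ 6)" and ge: "0 \<le> proximity (act \<gamma> w) z ^ k" if g: "\<gamma> \<in> \<Gamma>" for \<gamma>
    proof -
      have q: "0 \<le> proximity (act \<gamma> w) z" "proximity (act \<gamma> w) z \<le> 1"
        using proximity_pos[OF act_mem[OF g wb] zb] proximity_le_1[OF zb act_mem[OF g wb]] by auto
      then have "proximity (act \<gamma> w) z ^ k \<le> proximity (act \<gamma> w) z ^ 3" using k by (intro power_decreasing) auto
      also have "\<dots> \<le> (1 / ((cmod (\<gamma>$3$3))\<^sup>2 * (1 - r) ^ 4)) ^ 3"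
        by (intro power_mono proximity_orbit_le[OF g z w r'(2)] q)
      also have "\<dots> = 1 / (1 - r) ^ 12 * (1 / cmod (\<gamma>$3$3) ^ 6)"
        by (simp add: power_divide power_mult_distrib mult.commute flip: power_mult)
      finally show "proximity (act \<gamma> w) z ^ k \<le> 1 / (1 - r) ^ 12 * (1 / cmod (\<gamma>$3$3) ^ 6)" .
      show "0 \<le> proximity (act \<gamma> w) z ^ k" using q by simp
    qed
    have s: "(\<lambda>\<gamma>. 1 / (1 - r) ^ 12 * (1 / cmod (\<gamma>$3$3) ^ 6)) summable_on \<Gamma>"
      by (intro summable_on_cmult_right summable_orbit)
    have "infsum (\<lambda>\<gamma>. 1 / (1 - r) ^ 12 * (1 / cmod (\<gamma>$3$3) ^ 6)) \<Gamma> = orbit_const r"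
      unfolding orbit_const_def by (subst infsum_cmult_right') simp
    then show ?thesis using infsum_power_le[OF s ge le] by simp
  qed
  obtain \<tau> where t: "\<tau> \<in> \<Gamma>" "act \<tau> w \<in> cball 0 r" using r w unfolding covers_def by blast
  have eq: "act \<gamma> w = act (\<gamma> ** SU21_inv \<tau>) (act \<tau> w)" if "\<gamma> \<in> \<Gamma>" for \<gamma>
    using act_mult[OF in_SU21[OF inv_mem[OF t(1)]] act_mem[OF t(1) w], of \<gamma>] act_inv(1)[OF in_SU21[OF t(1)] w] by simp
  note b = base[OF t(2)]
  have "(\<lambda>\<gamma>. proximity (act (\<gamma> ** SU21_inv \<tau>) (act \<tau> w)) z ^ k) summable_on \<Gamma>"
    using b summable_on_reindex_bij_betw[OF bij_mult_right[OF inv_mem[OF t(1)]], of "\<lambda>\<gamma>. proximity (act \<gamma> (act \<tau> w)) z ^ k"] by simp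
  then show "(\<lambda>\<gamma>. proximity (act \<gamma> w) z ^ k) summable_on \<Gamma>"
    by (rule summable_on_cong[THEN iffD1, rotated]) (simp add: eq[symmetric])
  have "(\<Sum>\<^sub>\<infinity>\<gamma>\<in>\<Gamma>. proximity (act \<gamma> w) z ^ k) = (\<Sum>\<^sub>\<infinity>\<gamma>\<in>\<Gamma>. proximity (act (\<gamma> ** SU21_inv \<tau>) (act \<tau> w)) z ^ k)"
    by (intro infsum_cong) (simp add: eq[symmetric])
  also have "\<dots> = (\<Sum>\<^sub>\<infinity>\<gamma>\<in>\<Gamma>. proximity (act \<gamma> (act \<tau> w)) z ^ k)"
    by (rule infsum_reindex_bij_betw[OF bij_mult_right[OF inv_mem[OF t(1)]]])
  finally show "(\<Sum>\<^sub>\<infinity>\<gamma>\<in>\<Gamma>. proximity (act \<gamma> w) z ^ k) \<le> orbit_const r" using b by simp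
qed

lemma peak_norm_bound:
  assumes g: "\<gamma> \<in> \<Gamma>" and z: "z \<in> cball 0 r" and r: "r < 1" and w: "w \<in> cball 0 R" and R: "R < 1" and k: "k \<ge> 2"
  shows "cmod (peak z w \<gamma> ^ (3 * k)) \<le> (1 / ((1 - r) * (1 - R))) ^ (3 * k) * (1 / cmod (\<gamma>$3$3) ^ 6)"
proof -
  have zb: "z \<in> ball 0 1" and wb: "w \<in> ball 0 1" using z w r R by auto
  have D: "cmod (\<gamma>$3$3) \<ge> 1" by (rule SU21_33_ge_1[OF in_SU21[OF g]])
  have "norm (act \<gamma> w) \<le> 1" using act_mem[OF g wb] by simp
  then have "cmod (1 - herm z (act \<gamma> w)) \<ge> 1 - norm z" by (rule one_minus_herm_ge)
  then have 1: "cmod (1 - herm (act \<gamma> w) z) \<ge> 1 - r"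
    using z cmod_one_minus_herm_commute[of "act \<gamma> w" z] by simp
  have "cmod (\<gamma>$3$3) * (1 - R) \<le> cmod (\<gamma>$3$3) * (1 - norm w)" using w by (intro mult_left_mono) auto
  then have 2: "cmod (autfactor \<gamma> w) \<ge> cmod (\<gamma>$3$3) * (1 - R)" using autfactor_ge[OF in_SU21[OF g], of w] by simp
  have p: "(1 - r) * (cmod (\<gamma>$3$3) * (1 - R)) > 0" using D r R by (intro mult_pos_pos) auto
  have "cmod (peak z w \<gamma>) = 1 / (cmod (1 - herm (act \<gamma> w) z) * cmod (autfactor \<gamma> w))"
    by (simp add: peak_def norm_divide norm_mult)
  also have "\<dots> \<le> 1 / ((1 - r) * (cmod (\<gamma>$3$3) * (1 - R)))"
    using 1 2 p r R by (intro divide_left_mono mult_mono) (auto intro!: mult_pos_pos less_le_trans[OF _ 1] less_le_trans[OF _ 2] less_le_trans[OF _ D])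
  also have "\<dots> = 1 / ((1 - r) * (1 - R)) * (1 / cmod (\<gamma>$3$3))" by simp
  finally have pk: "cmod (peak z w \<gamma>) \<le> 1 / ((1 - r) * (1 - R)) * (1 / cmod (\<gamma>$3$3))" .
  have D1: "1 / cmod (\<gamma>$3$3) \<le> 1" using D by (subst divide_le_eq_1) auto
  have "cmod (peak z w \<gamma>) ^ (3 * k) \<le> (1 / ((1 - r) * (1 - R)) * (1 / cmod (\<gamma>$3$3))) ^ (3 * k)"
    by (intro power_mono pk) auto
  also have "\<dots> = (1 / ((1 - r) * (1 - R))) ^ (3 * k) * (1 / cmod (\<gamma>$3$3)) ^ (3 * k)" by (simp only: power_mult_distrib)
  also have "\<dots> \<le> (1 / ((1 - r) * (1 - R))) ^ (3 * k) * (1 / cmod (\<gamma>$3$3)) ^ 6"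
    using D1 k r R by (intro mult_left_mono power_decreasing) auto
  finally show ?thesis by (simp add: norm_power power_divide)
qed

lemma peak_summable:
  assumes z: "z \<in> ball 0 1" and w: "w \<in> ball 0 1" and k: "k \<ge> 2"
  shows "(\<lambda>\<gamma>. cmod (peak z w \<gamma> ^ (3 * k))) summable_on \<Gamma>"
proof (rule summable_on_comparison_test)
  show "(\<lambda>\<gamma>. (1 / ((1 - norm z) * (1 - norm w))) ^ (3 * k) * (1 / cmod (\<gamma>$3$3) ^ 6)) summable_on \<Gamma>"
    by (intro summable_on_cmult_right summable_orbit)
  show "cmod (peak z w \<gamma> ^ (3 * k)) \<le> (1 / ((1 - norm z) * (1 - norm w))) ^ (3 * k) * (1 / cmod (\<gamma>$3$3) ^ 6)" if "\<gamma> \<in> \<Gamma>" for \<gamma>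
    by (rule peak_norm_bound[OF that]) (use z w k in auto)
qed auto

text \<open>
  The series converges uniformly near every point, so it is holomorphic; by the cocycle property of the
  automorphy factor, replacing \<open>w\<close> by \<open>\<sigma> w\<close> multiplies it by the right factor and permutes its terms.
\<close>

lemma poincare_aut_form:
  assumes z: "z \<in> ball 0 1" and k: "k \<ge> 2"
  shows "poincare \<Gamma> k z \<in> aut_forms (3 * k) \<Gamma>"
  unfolding aut_forms_def mem_Collect_eq
proof (intro conjI ballI)
  show "holomorphic2_on (poincare \<Gamma> k z) (ball 0 1)"
  proof (rule holomorphic2_uniform_limit)
    show "finite_subsets_at_top \<Gamma> \<noteq> bot" by simp
    have hol: "holomorphic2_on (\<lambda>w. peak z w \<gamma> ^ (3 * k)) (ball 0 1)" if g: "\<gamma> \<in> \<Gamma>" for \<gamma>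
      unfolding peak_def
    proof (intro holomorphic2_on_power holomorphic2_on_divide holomorphic2_on_mult holomorphic2_on_const holomorphic2_autfactor)
      show "holomorphic2_on (\<lambda>w. 1 - herm (act \<gamma> w) z) (ball 0 1)"
        unfolding herm_def by (intro holomorphic2_intros holomorphic2_act in_SU21 g)
      show "(1 - herm (act \<gamma> w) z) * autfactor \<gamma> w \<noteq> 0" if "w \<in> ball 0 1" for w
        using one_minus_herm_nz[OF z act_mem[OF g that]] autfactor_nz[OF in_SU21[OF g] that] by simp
    qed
    show "\<forall>\<^sub>F T in finite_subsets_at_top \<Gamma>. holomorphic2_on (\<lambda>w. \<Sum>\<gamma>\<in>T. peak z w \<gamma> ^ (3 * k)) (ball 0 1)"
    proof (rule eventually_finite_subsets_at_top_weakI)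
      fix T assume "finite T" "T \<subseteq> \<Gamma>"
      then show "holomorphic2_on (\<lambda>w. \<Sum>\<gamma>\<in>T. peak z w \<gamma> ^ (3 * k)) (ball 0 1)"
        by (intro holomorphic2_on_sum hol) auto
    qed
    fix w :: "complex^2" assume w: "w \<in> ball 0 1"
    define s where "s = (1 - norm w) / 2"
    define R where "R = (1 + norm w) / 2"
    have s: "s > 0" "R < 1" using w by (auto simp: s_def R_def)
    have sub: "x \<in> cball 0 R" if "x \<in> ball w s" for x
      using norm_triangle_ineq[of w "x - w"] that by (simp add: s_def R_def dist_norm norm_minus_commute field_simps)
    have "uniform_limit (ball w s) (\<lambda>T w. \<Sum>\<gamma>\<in>T. peak z w \<gamma> ^ (3 * k)) (poincare \<Gamma> k z) (finite_subsets_at_top \<Gamma>)"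
      unfolding poincare_def[abs_def]
    proof (rule Weierstrass_m_test_general)
      show "(\<lambda>\<gamma>. (1 / ((1 - norm z) * (1 - R))) ^ (3 * k) * (1 / cmod (\<gamma>$3$3) ^ 6)) summable_on \<Gamma>"
        by (intro summable_on_cmult_right summable_orbit)
      show "cmod (peak z x \<gamma> ^ (3 * k)) \<le> (1 / ((1 - norm z) * (1 - R))) ^ (3 * k) * (1 / cmod (\<gamma>$3$3) ^ 6)" if "\<gamma> \<in> \<Gamma>" "x \<in> ball w s" for \<gamma> x
        by (rule peak_norm_bound[OF that(1) _ _ sub[OF that(2)] s(2) k]) (use z in auto)
    qed
    then show "\<exists>r>0. uniform_limit (ball w r) (\<lambda>T w. \<Sum>\<gamma>\<in>T. peak z w \<gamma> ^ (3 * k)) (poincare \<Gamma> k z) (finite_subsets_at_top \<Gamma>)"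
      using s(1) by blast
  qed simp
next
  fix \<sigma> and w :: "complex^2" assume s: "\<sigma> \<in> \<Gamma>" and w: "w \<in> ball 0 1"
  have eq: "peak z (act \<sigma> w) \<gamma> = autfactor \<sigma> w * peak z w (\<gamma> ** \<sigma>)" for \<gamma>
    unfolding peak_def act_mult[OF in_SU21[OF s] w] autfactor_mult[OF in_SU21[OF s] w]
    using autfactor_nz[OF in_SU21[OF s] w] by (simp add: mult_ac)
  have "poincare \<Gamma> k z (act \<sigma> w) = (\<Sum>\<^sub>\<infinity>\<gamma>\<in>\<Gamma>. autfactor \<sigma> w ^ (3 * k) * peak z w (\<gamma> ** \<sigma>) ^ (3 * k))"
    unfolding poincare_def eq power_mult_distrib ..
  also have "\<dots> = autfactor \<sigma> w ^ (3 * k) * (\<Sum>\<^sub>\<infinity>\<gamma>\<in>\<Gamma>. peak z w (\<gamma> ** \<sigma>) ^ (3 * k))"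
    by (rule infsum_cmult_right')
  also have "(\<Sum>\<^sub>\<infinity>\<gamma>\<in>\<Gamma>. peak z w (\<gamma> ** \<sigma>) ^ (3 * k)) = poincare \<Gamma> k z w"
    unfolding poincare_def by (rule infsum_reindex_bij_betw[OF bij_mult_right[OF s]])
  finally show "poincare \<Gamma> k z (act \<sigma> w) = autfactor \<sigma> w ^ (3 * k) * poincare \<Gamma> k z w" .
qed

lemma poincare_norm_le:
  assumes z: "z \<in> ball 0 1" and w: "w \<in> ball 0 1" and k: "k \<ge> 2" 
    and s: "(\<lambda>\<gamma>. proximity (act \<gamma> w) z ^ k) summable_on \<Gamma>"
  shows "cmod (poincare \<Gamma> k z w) * sqrt (rho z * rho w) ^ (3 * k) \<le> (\<Sum>\<^sub>\<infinity>\<gamma>\<in>\<Gamma>. proximity (act \<gamma> w) z ^ k)"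
proof -
  have "cmod (poincare \<Gamma> k z w) * sqrt (rho z * rho w) ^ (3 * k) \<le>
     (\<Sum>\<^sub>\<infinity>\<gamma>\<in>\<Gamma>. cmod (peak z w \<gamma> ^ (3 * k))) * sqrt (rho z * rho w) ^ (3 * k)"
    unfolding poincare_def using rho_pos[OF z] rho_pos[OF w]
    by (intro mult_right_mono norm_infsum_bound peak_summable z w k) auto
  also have "\<dots> = (\<Sum>\<^sub>\<infinity>\<gamma>\<in>\<Gamma>. cmod (peak z w \<gamma> ^ (3 * k)) * sqrt (rho z * rho w) ^ (3 * k))"
    by (rule infsum_cmult_left'[symmetric])
  also have "\<dots> \<le> (\<Sum>\<^sub>\<infinity>\<gamma>\<in>\<Gamma>. proximity (act \<gamma> w) z ^ k)"
    by (rule infsum_power_le(2)[OF s]) 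
       (use cmod_peak_power[OF in_SU21 z w] rho_pos[OF z] rho_pos[OF w] in auto)
  finally show ?thesis .
qed

text \<open>
  The identity contributes exactly 1. By \<open>systole_gap\<close> every other term is at most
  \<open>(1 - \<delta>)^(k - 3)\<close> times a term of a series which converges uniformly in \<open>z\<close>.
\<close>

lemma poincare_diag:
  assumes r: "covers r"
  shows "\<exists>k0. \<forall>k\<ge>k0. \<forall>z\<in>cball 0 r. cmod (poincare \<Gamma> k z z) * rho z ^ (3 * k) \<ge> 1/2"
proof -
  have r': "0 < r" "r < 1" using r by (auto simp: covers_def)
  obtain \<delta> where \<delta>: "0 < \<delta>" "\<delta> < 1" "\<And>\<gamma> z. \<gamma> \<in> \<Gamma> \<Longrightarrow> z \<in> cball 0 r \<Longrightarrow> \<gamma> \<noteq> mat 1 \<Longrightarrow> proximity (act \<gamma> z) z \<le> 1 - \<delta>"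
    using systole_gap[OF r'] by blast
  have "(\<lambda>n. (1 - \<delta>) ^ n * orbit_const r) \<longlonglongrightarrow> 0"
    using \<delta> by (intro tendsto_mult_left_zero LIMSEQ_power_zero) auto
  then have "\<forall>\<^sub>F n in sequentially. (1 - \<delta>) ^ n * orbit_const r < 1/2" by (rule order_tendstoD) simp
  then obtain n0 where n0: "\<And>n. n \<ge> n0 \<Longrightarrow> (1 - \<delta>) ^ n * orbit_const r < 1/2"
    by (auto simp: eventually_sequentially)
  have "cmod (poincare \<Gamma> k z z) * rho z ^ (3 * k) \<ge> 1/2" if k: "k \<ge> n0 + 3" and z: "z \<in> cball 0 r" for k z
  proof -
    have zb: "z \<in> ball 0 1" using z r' by auto
    have rz: "rho z > 0" by (rule rho_pos[OF zb])
    have sq: "sqrt (rho z * rho z) = rho z" using rz by simp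
    note summ = peak_summable[OF zb zb, of k]
    define f where "f \<gamma> = peak z z \<gamma> ^ (3 * k)" for \<gamma>
    have fs: "(\<lambda>\<gamma>. cmod (f \<gamma>)) summable_on \<Gamma>" unfolding f_def using summ k by simp
    have fs1: "(\<lambda>\<gamma>. cmod (f \<gamma>)) summable_on (\<Gamma> - {mat 1})" by (rule summable_on_subset_banach[OF fs]) auto
    have "infsum f ({mat 1} \<union> (\<Gamma> - {mat 1})) = infsum f {mat 1} + infsum f (\<Gamma> - {mat 1})"
      by (rule infsum_Un_disjoint) (use abs_summable_summable[OF fs1] in auto)
    moreover have "{mat 1} \<union> (\<Gamma> - {mat 1}) = \<Gamma>" using one_mem by auto
    ultimately have split: "poincare \<Gamma> k z z = f (mat 1) + infsum f (\<Gamma> - {mat 1})"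
      by (simp add: poincare_def f_def[abs_def])
    have f1: "cmod (f (mat 1)) * rho z ^ (3 * k) = 1"
    proof -
      have "f (mat 1) = 1 / of_real (rho z) ^ (3 * k)"
        by (simp add: f_def peak_def rho_herm power_divide)
      then show ?thesis using rz by (simp add: norm_divide norm_power)
    qed
    have qs: "(\<lambda>\<gamma>. proximity (act \<gamma> z) z ^ 3) summable_on \<Gamma>" "(\<Sum>\<^sub>\<infinity>\<gamma>\<in>\<Gamma>. proximity (act \<gamma> z) z ^ 3) \<le> orbit_const r"
      using proximity_orbit_sum[OF r z zb, of 3] by auto
    have qs1: "(\<lambda>\<gamma>. (1 - \<delta>) ^ (k - 3) * proximity (act \<gamma> z) z ^ 3) summable_on (\<Gamma> - {mat 1})"
      by (intro summable_on_cmult_right summable_on_subset_banach[OF qs(1)]) auto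
    have ptw: "cmod (f \<gamma>) * rho z ^ (3 * k) \<le> (1 - \<delta>) ^ (k - 3) * proximity (act \<gamma> z) z ^ 3" if g: "\<gamma> \<in> \<Gamma> - {mat 1}" for \<gamma>
    proof -
      have gG: "\<gamma> \<in> \<Gamma>" using g by auto
      have q0: "proximity (act \<gamma> z) z \<ge> 0" using proximity_pos[OF act_mem[OF gG zb] zb] by simp
      have "cmod (f \<gamma>) * rho z ^ (3 * k) \<le> proximity (act \<gamma> z) z ^ k"
        using cmod_peak_power[OF in_SU21[OF gG] zb zb, of k] unfolding f_def sq .
      also have "\<dots> = proximity (act \<gamma> z) z ^ (k - 3) * proximity (act \<gamma> z) z ^ 3" using k by (simp flip: power_add)
      also have "\<dots> \<le> (1 - \<delta>) ^ (k - 3) * proximity (act \<gamma> z) z ^ 3"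
        using q0 \<delta>(3)[OF gG z] g by (intro mult_right_mono power_mono) auto
      finally show ?thesis .
    qed
    have "cmod (infsum f (\<Gamma> - {mat 1})) * rho z ^ (3 * k) \<le> infsum (\<lambda>\<gamma>. cmod (f \<gamma>)) (\<Gamma> - {mat 1}) * rho z ^ (3 * k)"
      using rz by (intro mult_right_mono norm_infsum_bound fs1) auto
    also have "\<dots> = infsum (\<lambda>\<gamma>. cmod (f \<gamma>) * rho z ^ (3 * k)) (\<Gamma> - {mat 1})"
      by (rule infsum_cmult_left'[symmetric])
    also have "\<dots> \<le> infsum (\<lambda>\<gamma>. (1 - \<delta>) ^ (k - 3) * proximity (act \<gamma> z) z ^ 3) (\<Gamma> - {mat 1})"
      by (rule infsum_power_le(2)[OF qs1]) (use ptw rz in auto)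
    also have "\<dots> = (1 - \<delta>) ^ (k - 3) * infsum (\<lambda>\<gamma>. proximity (act \<gamma> z) z ^ 3) (\<Gamma> - {mat 1})"
      by (rule infsum_cmult_right')
    also have "\<dots> \<le> (1 - \<delta>) ^ (k - 3) * infsum (\<lambda>\<gamma>. proximity (act \<gamma> z) z ^ 3) \<Gamma>"
      using \<delta> proximity_pos[OF act_mem[OF _ zb] zb]
      by (intro mult_left_mono infsum_mono2 qs(1) summable_on_subset_banach[OF qs(1)]) (auto simp: less_imp_le)
    also have "\<dots> \<le> (1 - \<delta>) ^ (k - 3) * orbit_const r" using \<delta> qs(2) by (intro mult_left_mono) auto
    also have "\<dots> < 1/2" using k by (intro n0) auto
    finally have rest: "cmod (infsum f (\<Gamma> - {mat 1})) * rho z ^ (3 * k) < 1/2" .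
    have "cmod (f (mat 1)) \<le> cmod (poincare \<Gamma> k z z) + cmod (infsum f (\<Gamma> - {mat 1}))"
      unfolding split by (metis add_diff_cancel_right' norm_triangle_ineq4)
    then have "cmod (f (mat 1)) * rho z ^ (3 * k) \<le> (cmod (poincare \<Gamma> k z z) + cmod (infsum f (\<Gamma> - {mat 1}))) * rho z ^ (3 * k)"
      using rz by (intro mult_right_mono) auto
    then show ?thesis using f1 rest by (simp add: distrib_right)
  qed
  then show ?thesis by blast
qed

text \<open>
  With \<open>\<phi>\<close> the orbit sum of \<open>proximity^k\<close>, the weighted square of the series is at most
  \<open>\<phi>^2 \<le> (sup \<phi>) \<phi>\<close>, and the integral of \<open>\<phi>\<close> over the fundamental domain unfolds.
\<close>

lemma poincare_L2:
  assumes r: "covers r" and z: "z \<in> cball 0 r" and k: "k \<ge> 3" and Fm [measurable]: "F' \<in> sets borel" and FB: "F' \<subseteq> ball 0 1"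
   and ae: "tiles F'"
  shows "(\<integral>\<^sup>+w. indicator F' w * ennreal ((cmod (poincare \<Gamma> k z w))\<^sup>2 * rho w ^ (3 * k)) \<partial>hyp_measure)
     \<le> ennreal (orbit_const r / rho z ^ (3 * k)) * (\<integral>\<^sup>+w. ennreal (proximity w z ^ k) \<partial>hyp_measure)"
proof -
  have zb: "z \<in> ball 0 1" using z r by (auto simp: covers_def)
  have rz: "rho z > 0" by (rule rho_pos[OF zb])
  let ?C = "ennreal (orbit_const r / rho z ^ (3 * k))"
  have "(\<integral>\<^sup>+w. indicator F' w * ennreal ((cmod (poincare \<Gamma> k z w))\<^sup>2 * rho w ^ (3 * k)) \<partial>hyp_measure) \<le>
     (\<integral>\<^sup>+w. ?C * (indicator F' w * (\<integral>\<^sup>+\<gamma>. ennreal (proximity (act \<gamma> w) z ^ k) \<partial>count_space \<Gamma>)) \<partial>hyp_measure)"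
  proof (intro nn_integral_mono)
    fix w :: "complex^2"
    show "indicator F' w * ennreal ((cmod (poincare \<Gamma> k z w))\<^sup>2 * rho w ^ (3 * k)) \<le>
       ?C * (indicator F' w * (\<integral>\<^sup>+\<gamma>. ennreal (proximity (act \<gamma> w) z ^ k) \<partial>count_space \<Gamma>))"
    proof (cases "w \<in> F'")
      case True
      then have wb: "w \<in> ball 0 1" using FB by auto
      have rw: "rho w > 0" by (rule rho_pos[OF wb])
      define \<phi> where "\<phi> = (\<Sum>\<^sub>\<infinity>\<gamma>\<in>\<Gamma>. proximity (act \<gamma> w) z ^ k)"
      note q = proximity_orbit_sum[OF r z wb k]
      have nn: "0 \<le> proximity (act \<gamma> w) z ^ k" if "\<gamma> \<in> \<Gamma>" for \<gamma>
        using proximity_pos[OF act_mem[OF that wb] zb] by simp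
      have \<phi>0: "\<phi> \<ge> 0" unfolding \<phi>_def by (intro infsum_nonneg nn)
      have "cmod (poincare \<Gamma> k z w) * sqrt (rho z * rho w) ^ (3 * k) \<le> \<phi>"
        unfolding \<phi>_def using k by (intro poincare_norm_le[OF zb wb _ q(1)]) auto
      then have "(cmod (poincare \<Gamma> k z w) * sqrt (rho z * rho w) ^ (3 * k))\<^sup>2 \<le> \<phi>\<^sup>2"
        using rz rw by (intro power_mono) auto
      also have "\<dots> \<le> orbit_const r * \<phi>" unfolding power2_eq_square using q(2) \<phi>0 by (intro mult_right_mono) (auto simp: \<phi>_def)
      finally have "(cmod (poincare \<Gamma> k z w))\<^sup>2 * (sqrt (rho z * rho w) ^ (3 * k))\<^sup>2 \<le> orbit_const r * \<phi>"
        by (simp add: power_mult_distrib)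
      moreover have "(sqrt (rho z * rho w) ^ (3 * k))\<^sup>2 = rho z ^ (3 * k) * rho w ^ (3 * k)"
      proof -
        have "(sqrt (rho z * rho w) ^ (3 * k))\<^sup>2 = ((sqrt (rho z * rho w))\<^sup>2) ^ (3 * k)" by (simp only: power_mult[symmetric] mult.commute)
        also have "(sqrt (rho z * rho w))\<^sup>2 = rho z * rho w" using rz rw by simp
        finally show ?thesis by (simp add: power_mult_distrib)
      qed
      ultimately have "(cmod (poincare \<Gamma> k z w))\<^sup>2 * rho w ^ (3 * k) \<le> orbit_const r / rho z ^ (3 * k) * \<phi>"
        using rz by (simp add: pos_le_divide_eq mult_ac)
      then have "ennreal ((cmod (poincare \<Gamma> k z w))\<^sup>2 * rho w ^ (3 * k)) \<le> ennreal (orbit_const r / rho z ^ (3 * k) * \<phi>)"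
        by (rule ennreal_leI)
      also have "\<dots> = ?C * ennreal \<phi>" by (rule ennreal_mult''[OF \<phi>0])
      also have "\<dots> \<le> ?C * (\<integral>\<^sup>+\<gamma>. ennreal (proximity (act \<gamma> w) z ^ k) \<partial>count_space \<Gamma>)"
        unfolding \<phi>_def by (intro mult_left_mono ennreal_infsum_le q(1) nn) auto
      finally show ?thesis using True by simp
    qed simp
  qed
  also have "\<dots> = (\<integral>\<^sup>+w. indicator F' w * (\<integral>\<^sup>+\<gamma>. ?C * ennreal (proximity (act \<gamma> w) z ^ k) \<partial>count_space \<Gamma>) \<partial>hyp_measure)"
    by (intro nn_integral_cong) (simp add: nn_integral_cmult mult.left_commute)
  also have "\<dots> = (\<integral>\<^sup>+w. ?C * ennreal (proximity w z ^ k) \<partial>hyp_measure)"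
    by (rule nn_integral_unfold[OF Fm _ ae]) measurable
  also have "\<dots> = ?C * (\<integral>\<^sup>+w. ennreal (proximity w z ^ k) \<partial>hyp_measure)"
    by (rule nn_integral_cmult) measurable
  finally show ?thesis .
qed

end

section \<open>Point evaluation on automorphic forms\<close>

definition turn :: "real \<Rightarrow> complex" where
  "turn x = exp (2 * of_real pi * \<i> * of_real x)"

lemma norm_turn [simp]: "cmod (turn x) = 1"
  by (simp add: turn_def norm_exp_eq_Re)

lemma continuous_turn [continuous_intros]: "continuous_on S f \<Longrightarrow> continuous_on S (\<lambda>x. turn (f x))"
  unfolding turn_def by (intro continuous_intros)

text \<open>
  Multiplication by a unit complex number, as an element of SU(2,1). It lets invariance of the
  hyperbolic measure serve as rotation invariance of Lebesgue measure.
\<close>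

definition rot :: "real \<Rightarrow> complex^3^3" where
  "rot x = (\<chi> i j. if i = j then (if i = 3 then turn (- 2 * x / 3) else turn (x / 3)) else 0)"

lemma turn_add: "turn x * turn y = turn (x + y)"
  by (simp add: turn_def ring_distribs flip: exp_add)

lemma turn_cnj: "cnj (turn x) = turn (- x)"
  by (simp add: turn_def exp_cnj)

lemma turn_0 [simp]: "turn 0 = 1" by (simp add: turn_def)

lemma rot_SU21: "rot x \<in> carrier SU21"
proof -
  have "conj_transpose (rot x) ** H21 ** rot x = H21"
    unfolding vec_eq_iff forall_3
    by (simp add: rot_def H21_def conj_transpose_def matrix_matrix_mult_def sum_3 turn_cnj turn_add)
  moreover have "det (rot x) = 1"
    by (simp add: det_3 rot_def turn_add)
  ultimately show ?thesis by (simp add: SU21_def)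
qed

lemma act_rot: "act (rot x) w = turn x *s w"
proof -
  have nz: "turn y \<noteq> 0" for y using norm_turn[of y] by force
  have "x + - 2 * x / 3 = x / 3" by simp
  then have t: "turn (x / 3) = turn x * turn (- 2 * x / 3)" by (simp only: turn_add)
  have e: "rot x $ 1 $ 1 = turn (x / 3)" "rot x $ 2 $ 2 = turn (x / 3)" "rot x $ 3 $ 3 = turn (- 2 * x / 3)"
    "rot x $ 1 $ 2 = 0" "rot x $ 1 $ 3 = 0" "rot x $ 2 $ 1 = 0" "rot x $ 2 $ 3 = 0" "rot x $ 3 $ 1 = 0" "rot x $ 3 $ 2 = 0"
    by (simp_all add: rot_def)
  show ?thesis
    unfolding vec2_eq_iff act_1 act_2 autfactor_def actnum_def e t using nz[of "- 2 * x / 3"] by simp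
qed

lemma circle_mean_value:
  assumes "\<phi> holomorphic_on cball 0 1"
  shows "((\<lambda>x. \<phi> (turn x)) has_integral \<phi> 0) {0..1}"
proof -
  have "((\<lambda>u. \<phi> u / (u - 0)) has_contour_integral (2 * of_real pi * \<i> * \<phi> 0)) (circlepath 0 1)"
    by (rule Cauchy_integral_circlepath_simple[OF assms]) simp
  then have "((\<lambda>x. \<phi> (turn x) / turn x * (2 * of_real pi * \<i> * turn x)) has_integral (2 * of_real pi * \<i> * \<phi> 0)) {0..1}"
    unfolding has_contour_integral vector_derivative_circlepath unfolding circlepath
    by (simp add: turn_def)
  then have "((\<lambda>x. 2 * of_real pi * \<i> * \<phi> (turn x)) has_integral (2 * of_real pi * \<i> * \<phi> 0)) {0..1}"
    by (simp add: turn_def mult_ac)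
  then have "((\<lambda>x. (1 / (2 * of_real pi * \<i>)) * (2 * of_real pi * \<i> * \<phi> (turn x))) has_integral (1 / (2 * of_real pi * \<i>)) * (2 * of_real pi * \<i> * \<phi> 0)) {0..1}"
    by (rule has_integral_mult_right)
  then show ?thesis by simp
qed

lemma circle_submean:
  assumes "\<phi> holomorphic_on cball 0 1"
  shows "ennreal ((cmod (\<phi> 0))\<^sup>2) \<le> (\<integral>\<^sup>+x. indicator {0..1} x * ennreal ((cmod (\<phi> (turn x)))\<^sup>2) \<partial>lborel)"
proof -
  have "(\<lambda>t. (\<phi> t)\<^sup>2) holomorphic_on cball 0 1" by (intro holomorphic_intros assms)
  note m = circle_mean_value[OF this]
  have c: "continuous_on {0..1} (\<lambda>x. \<phi> (turn x))"
    by (rule continuous_on_compose2[OF holomorphic_on_imp_continuous_on[OF assms]]) (auto intro!: continuous_intros)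
  define g where "g x = (cmod (\<phi> (turn x)))\<^sup>2" for x
  have gc: "continuous_on {0..1} g" unfolding g_def by (intro continuous_intros c)
  obtain I where I: "(g has_integral I) {0..1}" using integrable_continuous_interval[OF gc] by (auto simp: integrable_on_def)
  have "norm (integral {0..1} (\<lambda>x. (\<phi> (turn x))\<^sup>2)) \<le> integral {0..1} g"
    using m I by (intro integral_norm_bound_integral) (auto simp: g_def norm_power integrable_on_def)
  then have "norm ((\<phi> 0)\<^sup>2) \<le> I" using m I by (simp only: integral_unique)
  then have le: "(cmod (\<phi> 0))\<^sup>2 \<le> I" by (simp add: norm_power)
  have "((\<lambda>x. indicator {0..1} x *\<^sub>R g x) has_integral I) UNIV"
    by (intro has_integral_eq[rotated, OF has_integral_restrict_UNIV[THEN iffD2, OF I]]) (auto simp: indicator_def)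
  then have "(\<integral>\<^sup>+x. ennreal (indicator {0..1} x *\<^sub>R g x) \<partial>lborel) = I"
    by (intro nn_integral_has_integral_lborel borel_measurable_continuous_on_indicator gc) (auto simp: g_def)
  moreover have "ennreal (indicator {0..1} x *\<^sub>R g x) = indicator {0..1} x * ennreal ((cmod (\<phi> (turn x)))\<^sup>2)" for x
    by (simp add: g_def indicator_def)
  ultimately show ?thesis using le by (simp add: ennreal_leI)
qed

lemma norm_smult_vec2: "norm (c *s (v :: complex^2)) = cmod c * norm v"
  by (simp add: norm_vec_def L2_set_def norm_mult power_mult_distrib real_sqrt_mult sum_distrib_left[symmetric])

lemma nn_integral_rot:
  assumes [measurable]: "g \<in> borel_measurable borel" and supp: "\<And>w. w \<notin> ball 0 1 \<Longrightarrow> g w = 0"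
  shows "(\<integral>\<^sup>+w. g (turn x *s w) \<partial>lborel) = (\<integral>\<^sup>+w. g (w :: complex^2) \<partial>lborel)"
proof -
  define u where "u w = ennreal (rho w ^ 3) * g w" for w
  have um [measurable]: "u \<in> borel_measurable borel" unfolding u_def by measurable
  have rr: "rho (turn x *s w) = rho w" for w by (simp add: rho_def norm_smult_vec2)
  have "(\<integral>\<^sup>+w. u (act (rot x) w) \<partial>hyp_measure) = (\<integral>\<^sup>+w. u w \<partial>hyp_measure)"
    by (rule nn_integral_act[OF rot_SU21 um])
  moreover have "(\<integral>\<^sup>+w. u w \<partial>hyp_measure) = (\<integral>\<^sup>+w. g w \<partial>lborel)"
    by (subst nn_integral_hyp_measure[OF um]) (unfold u_def, intro nn_integral_cong hyp_density_cancel supp)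
  moreover have "(\<integral>\<^sup>+w. u (act (rot x) w) \<partial>hyp_measure) = (\<integral>\<^sup>+w. g (turn x *s w) \<partial>lborel)"
  proof -
    have "(\<integral>\<^sup>+w. u (act (rot x) w) \<partial>hyp_measure) = (\<integral>\<^sup>+w. ennreal (indicator (ball 0 1) w / rho w ^ 3) * u (act (rot x) w) \<partial>lborel)"
      by (rule nn_integral_hyp_measure) measurable
    also have "\<dots> = (\<integral>\<^sup>+w. ennreal (indicator (ball 0 1) w / rho w ^ 3) * (ennreal (rho w ^ 3) * g (turn x *s w)) \<partial>lborel)"
      by (simp add: u_def act_rot rr)
    also have "\<dots> = (\<integral>\<^sup>+w. g (turn x *s w) \<partial>lborel)"
      by (intro nn_integral_cong hyp_density_cancel supp) (auto simp: norm_smult_vec2)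
    finally show ?thesis .
  qed
  ultimately show ?thesis by simp
qed

lemma nn_integral_translate_lborel:
  assumes "f \<in> borel_measurable borel"
  shows "(\<integral>\<^sup>+w. f (z + w) \<partial>lborel) = (\<integral>\<^sup>+w. f (w :: complex^2) \<partial>lborel)"
  using assms by (subst (2) lborel_distr_plus[of z, symmetric]) (simp add: nn_integral_distr)

text \<open>
  Averaging the one-variable mean value inequality over all complex lines through \<open>z\<close>: for fixed angle
  the integral over the ball does not depend on the angle, so Tonelli's theorem gives the claim.
\<close>

lemma submean_ball:
  assumes h: "holomorphic2_on h S" and sub: "ball z s \<subseteq> S" and s: "0 < s" "s \<le> 1"
  shows "ennreal ((cmod (h z))\<^sup>2) * emeasure lborel (ball (0::complex^2) s) 
     \<le> (\<integral>\<^sup>+w. indicator (ball z s) w * ennreal ((cmod (h w))\<^sup>2) \<partial>lborel)"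
proof -
  have inS: "z + w \<in> S" if "w \<in> ball 0 s" for w using that sub by (auto simp: dist_norm)
  have hc: "continuous_on (ball z s) (\<lambda>w. (cmod (h w))\<^sup>2)"
    by (intro continuous_intros holomorphic2_on_imp_continuous_on[OF holomorphic2_on_subset[OF h sub]])
  define f where "f w = indicator (ball z s) w * ennreal ((cmod (h w))\<^sup>2)" for w
  have "(\<lambda>w. ennreal (indicator (ball z s) w *\<^sub>R (cmod (h w))\<^sup>2)) \<in> borel_measurable borel"
    by (intro measurable_compose[OF borel_measurable_continuous_on_indicator[OF _ hc] measurable_ennreal]) simp
  moreover have "(\<lambda>w. ennreal (indicator (ball z s) w *\<^sub>R (cmod (h w))\<^sup>2)) = f"
    by (auto simp: f_def indicator_def)
  ultimately have fm [measurable]: "f \<in> borel_measurable borel" by (simp only:)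
  define g where "g w = f (z + w)" for w
  have gm [measurable]: "g \<in> borel_measurable borel" unfolding g_def by measurable
  have gsupp: "g w = 0" if "w \<notin> ball 0 1" for w using that s by (auto simp: g_def f_def indicator_def dist_norm)
  have pt: "indicator (ball 0 s) w * ennreal ((cmod (h z))\<^sup>2) \<le> (\<integral>\<^sup>+x. indicator {0..1} x * g (turn x *s w) \<partial>lborel)" for w
  proof (cases "w \<in> ball 0 s")
    case True
    have "(\<lambda>t. h (z + t *s w)) holomorphic_on cball 0 1"
    proof (rule slice_holomorphic[OF h])
      fix t :: complex assume "t \<in> cball 0 1"
      then have "cmod t * norm w \<le> norm w" by (simp add: mult_left_le_one_le)
      then have "t *s w \<in> ball 0 s" using True by (simp add: norm_smult_vec2)
      then show "z + t *s w \<in> S" by (rule inS)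
    qed
    from circle_submean[OF this]
    have "ennreal ((cmod (h z))\<^sup>2) \<le> (\<integral>\<^sup>+x. indicator {0..1} x * ennreal ((cmod (h (z + turn x *s w)))\<^sup>2) \<partial>lborel)" by simp
    moreover have "g (turn x *s w) = ennreal ((cmod (h (z + turn x *s w)))\<^sup>2)" for x
    proof -
      have "norm (turn x *s w) < s" using True by (simp add: norm_smult_vec2)
      then show ?thesis by (simp add: g_def f_def dist_norm)
    qed
    ultimately show ?thesis using True by simp
  qed simp
  have joint: "(\<lambda>p. indicator {0..1} (fst p) * g (turn (fst p) *s snd p)) \<in> borel_measurable (lborel \<Otimes>\<^sub>M lborel)"
  proof -
    have "continuous_on UNIV (\<lambda>p :: real \<times> (complex^2). turn (fst p) *s snd p)"
      unfolding vector_scalar_mult_def by (intro continuous_intros continuous_on_vec_lambda)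
    then have "(\<lambda>p :: real \<times> (complex^2). turn (fst p) *s snd p) \<in> borel_measurable borel"
      by (rule borel_measurable_continuous_onI)
    then have m1: "(\<lambda>p :: real \<times> (complex^2). g (turn (fst p) *s snd p)) \<in> borel_measurable borel" by (rule measurable_compose) simp
    have "(fst :: real \<times> (complex^2) \<Rightarrow> real) \<in> borel_measurable borel" by (intro borel_measurable_continuous_onI continuous_intros)
    then have m2: "(\<lambda>p :: real \<times> (complex^2). indicator {0..1} (fst p) :: ennreal) \<in> borel_measurable borel" by (rule measurable_compose) simp
    show ?thesis unfolding lborel_prod using borel_measurable_times_ennreal[OF m2 m1] by simp
  qed
  have "ennreal ((cmod (h z))\<^sup>2) * emeasure lborel (ball (0::complex^2) s) = (\<integral>\<^sup>+w. indicator (ball (0::complex^2) s) w * ennreal ((cmod (h z))\<^sup>2) \<partial>lborel)"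
    by (subst mult.commute, subst nn_integral_multc) simp_all
  also have "\<dots> \<le> (\<integral>\<^sup>+w. (\<integral>\<^sup>+x. indicator {0..1} x * g (turn x *s w) \<partial>lborel) \<partial>lborel)"
    by (intro nn_integral_mono pt)
  also have "\<dots> = (\<integral>\<^sup>+x. (\<integral>\<^sup>+w. indicator {0..1} x * g (turn x *s w) \<partial>lborel) \<partial>lborel)"
    by (rule lborel_pair.Fubini') (use joint in \<open>simp add: case_prod_beta'\<close>)
  also have "\<dots> = (\<integral>\<^sup>+x. indicator {0..1::real} x * (\<integral>\<^sup>+w. g w \<partial>lborel) \<partial>lborel)"
  proof (intro nn_integral_cong)
    fix x :: real
    have "(\<lambda>w :: complex^2. turn x *s w) \<in> borel_measurable borel"
      unfolding vector_scalar_mult_def by (intro borel_measurable_continuous_onI continuous_intros continuous_on_vec_lambda)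
    then have "(\<lambda>w :: complex^2. g (turn x *s w)) \<in> borel_measurable lborel" by (auto intro: measurable_compose)
    then have "(\<integral>\<^sup>+w. indicator {0..1} x * g (turn x *s w) \<partial>lborel) = indicator {0..1} x * (\<integral>\<^sup>+w. g (turn x *s w) \<partial>lborel)"
      by (rule nn_integral_cmult)
    then show "(\<integral>\<^sup>+w. indicator {0..1} x * g (turn x *s w) \<partial>lborel) = indicator {0..1} x * (\<integral>\<^sup>+w. g w \<partial>lborel)"
      using nn_integral_rot[of g x, OF gm] gsupp by simp
  qed
  also have "\<dots> = (\<integral>\<^sup>+w. g w \<partial>lborel)" by (subst nn_integral_multc) simp_all
  also have "\<dots> = (\<integral>\<^sup>+w. f w \<partial>lborel)" unfolding g_def by (rule nn_integral_translate_lborel[OF fm])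
  finally show ?thesis unfolding f_def .
qed

lemma proximity_ge:
  assumes "z \<in> cball 0 r" "r < 1" "w \<in> ball 0 1"
  shows "proximity w z \<ge> 1 - (norm (w - z))\<^sup>2 / (1 - r)\<^sup>2"
proof -
  have ge: "cmod (1 - herm w z) \<ge> 1 - r"
    using one_minus_herm_ge[of w z] cmod_one_minus_herm_commute[of w z] assms by simp
  have p: "(cmod (1 - herm w z))\<^sup>2 \<ge> (1 - r)\<^sup>2" "(1 - r)\<^sup>2 > 0" using ge assms by (auto intro!: power_mono)
  have nz: "(cmod (1 - herm w z))\<^sup>2 \<noteq> 0" using p by linarith
  have "1 - proximity w z = ((cmod (1 - herm w z))\<^sup>2 - rho z * rho w) / (cmod (1 - herm w z))\<^sup>2"
    unfolding proximity_def using nz by (simp add: diff_divide_distrib mult.commute)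
  also have "\<dots> \<le> (norm (w - z))\<^sup>2 / (1 - r)\<^sup>2" using p rho_rho_ge by (intro frac_le) auto
  finally show ?thesis by simp
qed

lemma aut_forms_norm_invariant:
  assumes "f \<in> aut_forms m \<Gamma>" "\<gamma> \<in> \<Gamma>" "\<gamma> \<in> carrier SU21" "w \<in> ball 0 1"
  shows "(cmod (f (act \<gamma> w)))\<^sup>2 * rho (act \<gamma> w) ^ m = (cmod (f w))\<^sup>2 * rho w ^ m"
proof -
  have "f (act \<gamma> w) = autfactor \<gamma> w ^ m * f w" using assms unfolding aut_forms_def by blast
  moreover have "cmod (autfactor \<gamma> w) \<noteq> 0" using autfactor_nz[OF assms(3,4)] by simp
  ultimately show ?thesis unfolding rho_act[OF assms(3,4)]
    by (simp add: norm_mult norm_power power_mult_distrib power_divide mult.commute flip: power_mult)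
qed

lemma aut_forms_holomorphic: "f \<in> aut_forms m \<Gamma> \<Longrightarrow> holomorphic2_on f (ball 0 1)"
  by (simp add: aut_forms_def)

text \<open>
  The squared norm of a form, as an extended real so that no integrability has to be checked.
\<close>

definition form_norm :: "(complex^2) set \<Rightarrow> nat \<Rightarrow> (complex^2 \<Rightarrow> complex) \<Rightarrow> ennreal" where
  "form_norm F k f = (\<integral>\<^sup>+w. indicator F w * ennreal ((cmod (f w))\<^sup>2 * rho w ^ (3 * k)) \<partial>hyp_measure)"

lemma measurable_indicator_continuous:
  fixes g :: "complex^2 \<Rightarrow> real"
  assumes "E \<in> sets borel" "continuous_on (ball 0 1) g" "E \<subseteq> ball 0 1"
  shows "(\<lambda>w. indicator E w * ennreal (g w)) \<in> borel_measurable borel"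
proof -
  have "(\<lambda>w. ennreal (indicator E w *\<^sub>R g w)) \<in> borel_measurable borel"
    by (intro measurable_compose[OF borel_measurable_continuous_on_indicator[OF assms(1) continuous_on_subset[OF assms(2,3)]] measurable_ennreal])
  moreover have "(\<lambda>w. ennreal (indicator E w *\<^sub>R g w)) = (\<lambda>w. indicator E w * ennreal (g w))"
    by (auto simp: indicator_def)
  ultimately show ?thesis by simp
qed

lemma continuous_on_form_density:
  assumes "holomorphic2_on f (ball 0 1)"
  shows "continuous_on (ball 0 1) (\<lambda>w. (cmod (f w))\<^sup>2 * rho w ^ m)"
  unfolding rho_def by (intro continuous_intros holomorphic2_on_imp_continuous_on[OF assms])

context cocompact_lattice
begin

text \<open>
  Unfold the integral over \<open>E\<close>: the density is invariant, and every orbit meets \<open>E\<close> a bounded number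
  of times.
\<close>

lemma local_norm_le:
  assumes f: "f \<in> aut_forms (3 * k) \<Gamma>" and r: "r < 1" and E: "E \<in> sets borel" "E \<subseteq> cball 0 r"
    and Fm [measurable]: "F' \<in> sets borel" and FB: "F' \<subseteq> ball 0 1"
    and ae: "tiles F'"
  shows "form_norm E k f \<le> ennreal (mult_bound r) * form_norm F' k f"
proof -
  define u where "u w = indicator E w * ennreal ((cmod (f w))\<^sup>2 * rho w ^ (3 * k))" for w
  have EB: "E \<subseteq> ball 0 1" using E(2) r by auto
  note cont = continuous_on_form_density[OF aut_forms_holomorphic[OF f], of "3 * k"]
  have um: "u \<in> borel_measurable borel" unfolding u_def by (rule measurable_indicator_continuous[OF E(1) cont EB])
  have "form_norm E k f = (\<integral>\<^sup>+z. u z \<partial>hyp_measure)" by (simp add: form_norm_def u_def)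
  also have "\<dots> = (\<integral>\<^sup>+z. indicator F' z * (\<integral>\<^sup>+\<gamma>. u (act \<gamma> z) \<partial>count_space \<Gamma>) \<partial>hyp_measure)"
    by (rule nn_integral_unfold[OF Fm um ae, symmetric])
  also have "\<dots> \<le> (\<integral>\<^sup>+z. ennreal (mult_bound r) * (indicator F' z * ennreal ((cmod (f z))\<^sup>2 * rho z ^ (3 * k))) \<partial>hyp_measure)"
  proof (intro nn_integral_mono)
    fix z :: "complex^2"
    show "indicator F' z * (\<integral>\<^sup>+\<gamma>. u (act \<gamma> z) \<partial>count_space \<Gamma>) \<le> ennreal (mult_bound r) * (indicator F' z * ennreal ((cmod (f z))\<^sup>2 * rho z ^ (3 * k)))"
    proof (cases "z \<in> F'")
      case True
      then have zb: "z \<in> ball 0 1" using FB by auto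
      have "(\<integral>\<^sup>+\<gamma>. u (act \<gamma> z) \<partial>count_space \<Gamma>) = (\<integral>\<^sup>+\<gamma>. indicator E (act \<gamma> z) * ennreal ((cmod (f z))\<^sup>2 * rho z ^ (3 * k)) \<partial>count_space \<Gamma>)"
        unfolding u_def using aut_forms_norm_invariant[OF f _ in_SU21 zb] by (intro nn_integral_cong) simp
      also have "\<dots> = (\<integral>\<^sup>+\<gamma>. indicator E (act \<gamma> z) \<partial>count_space \<Gamma>) * ennreal ((cmod (f z))\<^sup>2 * rho z ^ (3 * k))"
        by (rule nn_integral_multc) simp
      also have "\<dots> \<le> ennreal (mult_bound r) * ennreal ((cmod (f z))\<^sup>2 * rho z ^ (3 * k))"
        by (intro mult_right_mono overlap_nn zb r E(2)) simp
      finally show ?thesis using True by simp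
    qed simp
  qed
  also have "\<dots> = ennreal (mult_bound r) * form_norm F' k f"
    unfolding form_norm_def
    using measurable_indicator_continuous[OF Fm cont FB] by (intro nn_integral_cmult) simp
  finally show ?thesis .
qed

text \<open>
  Apply the mean value inequality to \<open>h w = f w * (1 - \<langle>w,z\<rangle>)^(3k)\<close> on a ball of radius
  \<open>(1 - r) / (2 sqrt k)\<close>. There \<open>proximity w z \<ge> 1 - 1/(4k)\<close>, so \<open>|h w|^2\<close> and the weighted square of \<open>f\<close>
  differ only by a bounded factor and a constant depending on \<open>z\<close>.
\<close>

lemma point_evaluation_bound:
  assumes r: "covers r"
  shows "\<exists>C>0. \<forall>k\<ge>1. \<forall>f\<in>aut_forms (3 * k) \<Gamma>. \<forall>z\<in>cball 0 r. \<forall>F'. F' \<in> sets borel \<longrightarrow> F' \<subseteq> ball 0 1 \<longrightarrow>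
     tiles F' \<longrightarrow>
     ennreal ((cmod (f z))\<^sup>2 * rho z ^ (3 * k)) \<le> ennreal (C * (real k)\<^sup>2) * form_norm F' k f"
proof -
  have r': "0 < r" "r < 1" using r by (auto simp: covers_def)
  define V where "V = (unit_ball_vol 4 :: real)"
  have V: "V > 0" unfolding V_def by (rule unit_ball_vol_pos) simp
  (* The balls used for the mean value inequality lie in the ball of radius R. *)
  define R where "R = (1 + r) / 2"
  have R: "R < 1" using r' by (simp add: R_def)
  (* 64 = 4 * 16: the factor 4 compares |h|^2 with the weighted square of f, and s^4 = (1 - r)^4 / (16 k^2).
  The summand 1 keeps C positive. *)
  define C where "C = 64 * (real (mult_bound R) + 1) / (V * (1 - r) ^ 4)"
  have C: "C > 0" unfolding C_def using V r' by (intro divide_pos_pos mult_pos_pos) auto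
  have "ennreal ((cmod (f z))\<^sup>2 * rho z ^ (3 * k)) \<le> ennreal (C * (real k)\<^sup>2) * form_norm F' k f"
    if k: "k \<ge> 1" and f: "f \<in> aut_forms (3 * k) \<Gamma>" and z: "z \<in> cball 0 r" and F': "F' \<in> sets borel" "F' \<subseteq> ball 0 1"
      and ae: "tiles F'" for k f z F'
  proof -
    have zb: "z \<in> ball 0 1" using z r' by auto
    have rz: "rho z > 0" by (rule rho_pos[OF zb])
    define s where "s = (1 - r) / (2 * sqrt (real k))"
    have sk: "sqrt (real k) \<ge> 1" using k by simp
    have s0: "s > 0" unfolding s_def using r' sk by (intro divide_pos_pos) auto
    have s1: "s \<le> (1 - r) / 2" unfolding s_def using r' sk by (intro divide_left_mono) auto
    have s2: "s\<^sup>2 = (1 - r)\<^sup>2 / (4 * real k)" unfolding s_def using k by (simp add: power_divide power_mult_distrib)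
    have s4: "s ^ 4 = (1 - r) ^ 4 / (16 * (real k)\<^sup>2)"
    proof -
      have "s ^ 4 = (s\<^sup>2)\<^sup>2" by (simp flip: power_mult)
      then show ?thesis unfolding s2 by (simp add: power_divide power_mult_distrib flip: power_mult)
    qed
    have sub: "w \<in> cball 0 R" if "w \<in> ball z s" for w
      using norm_triangle_ineq[of z "w - z"] that z s1 by (simp add: R_def dist_norm norm_minus_commute field_simps)
    have subB: "ball z s \<subseteq> ball 0 1" using sub R by force
    define h where "h w = f w * (1 - herm w z) ^ (3 * k)" for w
    have hh: "holomorphic2_on h (ball 0 1)"
      unfolding h_def herm_def by (intro holomorphic2_intros aut_forms_holomorphic[OF f])
    have hz: "(cmod (h z))\<^sup>2 = (cmod (f z))\<^sup>2 * rho z ^ (3 * k) * rho z ^ (3 * k)"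
      unfolding h_def rho_herm[symmetric] using rz
      by (simp add: norm_mult norm_power power_mult_distrib power2_eq_square mult_ac)
    have hw: "(cmod (h w))\<^sup>2 \<le> 4 * rho z ^ (3 * k) * ((cmod (f w))\<^sup>2 * rho w ^ (3 * k))" if w: "w \<in> ball z s" for w
    proof -
      have wb: "w \<in> ball 0 1" using subB w by auto
      have nz: "(cmod (1 - herm w z))\<^sup>2 > 0" using one_minus_herm_nz[OF zb wb] by simp
      have "(norm (w - z))\<^sup>2 \<le> s\<^sup>2" using w by (intro power_mono) (auto simp: dist_norm norm_minus_commute)
      then have "(norm (w - z))\<^sup>2 / (1 - r)\<^sup>2 \<le> s\<^sup>2 / (1 - r)\<^sup>2" by (intro divide_right_mono) auto
      also have "\<dots> = 1 / (4 * real k)" unfolding s2 using r' by simp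
      finally have q: "proximity w z \<ge> 1 - 1 / (4 * real k)" using proximity_ge[OF z r'(2) wb] by linarith
      have q0: "1 - 1 / (4 * real k) \<ge> 0" using k by (simp add: field_simps)
      have "1 + real (3 * k) * (- (1 / (4 * real k))) \<le> (1 + - (1 / (4 * real k))) ^ (3 * k)"
        by (rule Bernoulli_inequality) (use q0 in simp)
      also have "\<dots> \<le> proximity w z ^ (3 * k)" using q q0 by (intro power_mono) auto
      finally have q4: "1/4 \<le> proximity w z ^ (3 * k)" using k by simp
      have "(cmod (h w))\<^sup>2 * (1/4) \<le> (cmod (h w))\<^sup>2 * proximity w z ^ (3 * k)" using q4 by (intro mult_left_mono) auto
      also have "\<dots> = (cmod (f w))\<^sup>2 * ((cmod (1 - herm w z))\<^sup>2 * proximity w z) ^ (3 * k)"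
        unfolding h_def by (simp add: norm_mult norm_power power_mult_distrib power2_eq_square mult_ac)
      also have "(cmod (1 - herm w z))\<^sup>2 * proximity w z = rho w * rho z" unfolding proximity_def using nz by simp
      finally show ?thesis by (simp add: power_mult_distrib mult_ac)
    qed
    let ?v = "(cmod (f z))\<^sup>2 * rho z ^ (3 * k)"
    have "ennreal ((cmod (h z))\<^sup>2) * emeasure lborel (ball (0::complex^2) s) \<le> (\<integral>\<^sup>+w. indicator (ball z s) w * ennreal ((cmod (h w))\<^sup>2) \<partial>lborel)"
      by (rule submean_ball[OF hh subB s0]) (use s1 r' in simp)
    also have "\<dots> \<le> (\<integral>\<^sup>+w. ennreal (indicator (ball 0 1) w / rho w ^ 3) * (ennreal (4 * rho z ^ (3 * k)) * (indicator (ball z s) w * ennreal ((cmod (f w))\<^sup>2 * rho w ^ (3 * k)))) \<partial>lborel)"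
    proof (intro nn_integral_mono)
      fix w
      show "indicator (ball z s) w * ennreal ((cmod (h w))\<^sup>2) \<le> ennreal (indicator (ball 0 1) w / rho w ^ 3) * (ennreal (4 * rho z ^ (3 * k)) * (indicator (ball z s) w * ennreal ((cmod (f w))\<^sup>2 * rho w ^ (3 * k))))"
      proof (cases "w \<in> ball z s")
        case True
        then have wb: "w \<in> ball 0 1" using subB by auto
        have rw: "rho w > 0" by (rule rho_pos[OF wb])
        have "1 \<le> 1 / rho w ^ 3" using rw rho_le_1[of w] by (simp add: power_le_one)
        have "ennreal ((cmod (h w))\<^sup>2) \<le> 1 * ennreal (4 * rho z ^ (3 * k) * ((cmod (f w))\<^sup>2 * rho w ^ (3 * k)))"
          using hw[OF True] by (simp add: ennreal_leI)
        also have "\<dots> \<le> ennreal (1 / rho w ^ 3) * ennreal (4 * rho z ^ (3 * k) * ((cmod (f w))\<^sup>2 * rho w ^ (3 * k)))"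
          using \<open>1 \<le> 1 / rho w ^ 3\<close> by (intro mult_right_mono) auto
        also have "\<dots> = ennreal (1 / rho w ^ 3) * (ennreal (4 * rho z ^ (3 * k)) * ennreal ((cmod (f w))\<^sup>2 * rho w ^ (3 * k)))"
          using rz rw by (simp add: ennreal_mult)
        finally show ?thesis using True wb by simp
      qed simp
    qed
    also have "\<dots> = (\<integral>\<^sup>+w. ennreal (4 * rho z ^ (3 * k)) * (indicator (ball z s) w * ennreal ((cmod (f w))\<^sup>2 * rho w ^ (3 * k))) \<partial>hyp_measure)"
      by (rule nn_integral_hyp_measure[symmetric])
         (intro borel_measurable_times_ennreal borel_measurable_const measurable_indicator_continuous continuous_on_form_density aut_forms_holomorphic[OF f] subB borel_ball)
    also have "\<dots> = ennreal (4 * rho z ^ (3 * k)) * form_norm (ball z s) k f"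
      unfolding form_norm_def
      using measurable_indicator_continuous[OF borel_ball continuous_on_form_density[OF aut_forms_holomorphic[OF f]] subB]
      by (intro nn_integral_cmult) simp
    also have "\<dots> \<le> ennreal (4 * rho z ^ (3 * k)) * (ennreal (mult_bound R) * form_norm F' k f)"
      by (intro mult_left_mono local_norm_le[OF f R _ _ F' ae]) (use sub in auto)
    also have "emeasure lborel (ball (0::complex^2) s) = ennreal (V * s ^ 4)"
      unfolding V_def using s0 by (subst emeasure_ball) auto
    finally have main: "ennreal ((cmod (h z))\<^sup>2) * ennreal (V * s ^ 4) \<le> ennreal (4 * rho z ^ (3 * k)) * (ennreal (mult_bound R) * form_norm F' k f)" .
    define A where "A = 1 / (rho z ^ (3 * k) * (V * s ^ 4))"
    have A: "A > 0" unfolding A_def using rz V s0 by simp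
    have "ennreal ?v = ennreal A * (ennreal ((cmod (h z))\<^sup>2) * ennreal (V * s ^ 4))"
    proof -
      have "?v = A * ((cmod (h z))\<^sup>2 * (V * s ^ 4))" unfolding hz A_def using rz V s0 by simp
      then show ?thesis using A V s0 by (simp add: ennreal_mult)
    qed
    also have "\<dots> \<le> ennreal A * (ennreal (4 * rho z ^ (3 * k)) * (ennreal (mult_bound R) * form_norm F' k f))"
      by (intro mult_left_mono main) simp
    also have "\<dots> = ennreal (A * (4 * rho z ^ (3 * k)) * mult_bound R) * form_norm F' k f"
      using A rz by (simp add: ennreal_mult mult.assoc)
    also have "\<dots> \<le> ennreal (C * (real k)\<^sup>2) * form_norm F' k f"
    proof (intro mult_right_mono ennreal_leI)
      have "A * (4 * rho z ^ (3 * k)) * mult_bound R = 64 * real (mult_bound R) / (V * (1 - r) ^ 4) * (real k)\<^sup>2"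
        unfolding A_def s4 using rz V k r' by (simp add: field_simps)
      also have "\<dots> \<le> C * (real k)\<^sup>2"
        unfolding C_def using V r' by (intro mult_right_mono divide_right_mono) auto
      finally show "A * (4 * rho z ^ (3 * k)) * mult_bound R \<le> C * (real k)\<^sup>2" .
    qed simp
    finally show ?thesis .
  qed
  then show ?thesis using C by blast
qed

end

section \<open>The Bergman kernel on the diagonal\<close>

lemma holomorphic2_on_lincomb:
  fixes d :: nat
  shows "(\<And>j. j < d \<Longrightarrow> holomorphic2_on (f j) S) \<Longrightarrow> holomorphic2_on (\<lambda>z. \<Sum>j<d. a j * f j z) S"
  by (intro holomorphic2_on_sum holomorphic2_on_mult holomorphic2_on_const) auto

lemma aut_forms_lincomb:
  assumes "\<And>j. j < (d::nat) \<Longrightarrow> f j \<in> aut_forms m \<Gamma>"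
  shows "(\<lambda>z. \<Sum>j<d. a j * f j z) \<in> aut_forms m \<Gamma>"
  unfolding aut_forms_def mem_Collect_eq
proof (intro conjI ballI)
  show "holomorphic2_on (\<lambda>z. \<Sum>j<d. a j * f j z) (ball 0 1)"
    using assms by (intro holomorphic2_on_lincomb) (auto intro: aut_forms_holomorphic)
  fix \<gamma> and z :: "complex^2" assume "\<gamma> \<in> \<Gamma>" "z \<in> ball 0 1"
  then have "f j (act \<gamma> z) = autfactor \<gamma> z ^ m * f j z" if "j < d" for j
    using assms[OF that] unfolding aut_forms_def by blast
  then show "(\<Sum>j<d. a j * f j (act \<gamma> z)) = autfactor \<gamma> z ^ m * (\<Sum>j<d. a j * f j z)"
    by (simp add: sum_distrib_left mult_ac)
qed

lemma cauchy_schwarz_sum: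
  fixes a b :: "nat \<Rightarrow> complex"
  shows "(cmod (\<Sum>j<d. a j * b j))\<^sup>2 \<le> (\<Sum>j<d. (cmod (a j))\<^sup>2) * (\<Sum>j<d. (cmod (b j))\<^sup>2)"
proof -
  have "cmod (\<Sum>j<d. a j * b j) \<le> (\<Sum>j<d. cmod (a j) * cmod (b j))"
    by (metis (mono_tags, lifting) norm_mult norm_sum sum.cong)
  then have "(cmod (\<Sum>j<d. a j * b j))\<^sup>2 \<le> (\<Sum>j<d. cmod (a j) * cmod (b j))\<^sup>2" by (intro power_mono) auto
  also have "\<dots> \<le> (\<Sum>j<d. (cmod (a j))\<^sup>2) * (\<Sum>j<d. (cmod (b j))\<^sup>2)" by (rule Cauchy_Schwarz_ineq_sum)
  finally show ?thesis .
qed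

text \<open>
  The inner product integrates over a Lebesgue measurable domain; this rewrites it over the Borel
  subset.
\<close>

lemma hyp_inner_lborel:
  fixes k :: nat and f g :: "complex^2 \<Rightarrow> complex"
  assumes F: "F \<in> sets lebesgue" and FB: "F \<subseteq> ball 0 1" and F': "F' \<in> sets borel" "F' \<subseteq> F" "negligible (F - F')"
    and f: "continuous_on (ball 0 1) f" and g: "continuous_on (ball 0 1) g"
  defines "G \<equiv> \<lambda>z. indicator F' z *\<^sub>R (of_real ((1 - (norm z)\<^sup>2) ^ (3 * k)) * f z * cnj (g z) * of_real (1 / (1 - (norm z)\<^sup>2) ^ 3))"
  shows "G \<in> borel_measurable borel" "hyp_inner F k f g = (LINT z|lborel. G z)"
proof -
  define H where "H z = (of_real ((1 - (norm z)\<^sup>2) ^ (3 * k)) * f z * cnj (g z) * of_real (1 / (1 - (norm z)\<^sup>2) ^ 3))" for z :: "complex^2"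
  have nz: "(1 - (norm z)\<^sup>2) ^ 3 \<noteq> 0" if "z \<in> ball 0 1" for z :: "complex^2"
    using rho_pos[OF that] by (simp add: rho_def)
  have Hc: "continuous_on (ball 0 1) H" unfolding H_def
    using nz by (intro continuous_intros f g) auto
  have GB: "G = (\<lambda>z. indicator F' z *\<^sub>R H z)" by (simp add: G_def H_def)
  have F'B: "F' \<subseteq> ball 0 1" using F' FB by auto
  show Gm: "G \<in> borel_measurable borel" unfolding GB
    by (rule borel_measurable_continuous_on_indicator[OF F'(1) continuous_on_subset[OF Hc F'B]])
  have HBm: "(\<lambda>z. indicator (ball 0 1) z *\<^sub>R H z) \<in> borel_measurable borel"
    by (rule borel_measurable_continuous_on_indicator[OF _ Hc]) simp
  have HBl: "(\<lambda>z. indicator (ball 0 1) z *\<^sub>R H z) \<in> borel_measurable lebesgue"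
    by (rule measurable_completion) (use HBm in simp)
  have Gl: "G \<in> borel_measurable lebesgue" by (rule measurable_completion) (use Gm in simp)
  have "(\<lambda>z. indicator F z *\<^sub>R (indicator (ball 0 1) z *\<^sub>R H z)) \<in> borel_measurable lebesgue"
    by (intro borel_measurable_scaleR borel_measurable_indicator F HBl)
  moreover have "(\<lambda>z. indicator F z *\<^sub>R (indicator (ball 0 1) z *\<^sub>R H z)) = (\<lambda>z. indicator F z *\<^sub>R H z)"
    using FB by (auto simp: fun_eq_iff indicator_def)
  ultimately have Fl: "(\<lambda>z. indicator F z *\<^sub>R H z) \<in> borel_measurable lebesgue" by (simp only:)
  have "AE z in lebesgue. z \<notin> F - F'"
    using F'(3) unfolding negligible_iff_null_sets by (rule AE_not_in)
  then have ae: "AE z in lebesgue. indicator F z *\<^sub>R H z = G z"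
    by eventually_elim (use F'(2) in \<open>auto simp: GB indicator_def\<close>)
  have "hyp_inner F k f g = (LINT z|lebesgue. indicator F z *\<^sub>R H z)"
    by (simp add: hyp_inner_def set_lebesgue_integral_def H_def)
  also have "\<dots> = (LINT z|lebesgue. G z)" by (rule integral_cong_AE[OF Fl Gl ae])
  also have "\<dots> = (LINT z|lborel. G z)" by (rule integral_completion) (use Gm in simp)
  finally show "hyp_inner F k f g = (LINT z|lborel. G z)" .
qed

text \<open>
  Pythagoras for an orthonormal family. That the products are integrable is part of the conclusion to be
  drawn from the hypotheses: a non-integrable function has Bochner integral 0, whereas the diagonal
  integrals are 1, and the mixed products are dominated by the diagonal ones.
\<close>

lemma form_norm_lincomb:
  fixes d :: nat
  assumes F: "F \<in> sets lebesgue" and FB: "F \<subseteq> ball 0 1" and F': "F' \<in> sets borel" "F' \<subseteq> F" "negligible (F - F')"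
    and f: "\<And>j. j < d \<Longrightarrow> continuous_on (ball 0 1) (f j)"
    and on: "\<And>i j. i < d \<Longrightarrow> j < d \<Longrightarrow> hyp_inner F k (f i) (f j) = (if i = j then 1 else 0)"
    and g: "\<And>z. z \<in> ball 0 1 \<Longrightarrow> g z = (\<Sum>j<d. a j * f j z)"
  shows "form_norm F' k g = ennreal (\<Sum>j<d. (cmod (a j))\<^sup>2)"
proof -
  define G where "G i j z = indicator F' z *\<^sub>R (of_real ((1 - (norm z)\<^sup>2) ^ (3 * k)) * f i z * cnj (f j z) * of_real (1 / (1 - (norm z)\<^sup>2) ^ 3))"
    for i j and z :: "complex^2"
  have F'B: "F' \<subseteq> ball 0 1" using F' FB by auto
  have Gm: "G i j \<in> borel_measurable borel" and GI: "(LINT z|lborel. G i j z) = (if i = j then 1 else 0)" if "i < d" "j < d" for i j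
    using hyp_inner_lborel[OF F FB F' f[OF that(1)] f[OF that(2)], of k] on[OF that] unfolding G_def by simp_all
  have Gd: "integrable lborel (G i i)" if "i < d" for i
  proof (rule ccontr)
    assume "\<not> integrable lborel (G i i)"
    then have "(LINT z|lborel. G i i z) = 0" by (rule not_integrable_integral_eq)
    then show False using GI[OF that that] by simp
  qed
  have Gi: "integrable lborel (G i j)" if "i < d" "j < d" for i j
  proof (rule Bochner_Integration.integrable_bound)
    show "integrable lborel (\<lambda>z. norm (G i i z) + norm (G j j z))"
      using Gd that by (intro Bochner_Integration.integrable_add integrable_norm) auto
    show "G i j \<in> borel_measurable lborel" using Gm[OF that] by simp
    show "AE z in lborel. norm (G i j z) \<le> norm (norm (G i i z) + norm (G j j z))"
    proof (intro AE_I2)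
      fix z :: "complex^2"
      show "norm (G i j z) \<le> norm (norm (G i i z) + norm (G j j z))"
      proof (cases "z \<in> F'")
        case True
        define R where "R = (1 - (norm z)\<^sup>2) ^ (3 * k) * (1 / (1 - (norm z)\<^sup>2) ^ 3)"
        have G: "cmod (G i j z) = \<bar>R\<bar> * (cmod (f i z) * cmod (f j z))" for i j
          using True by (simp add: G_def R_def norm_mult norm_divide norm_power abs_mult power_abs del: of_real_diff of_real_power)
        have "cmod (f i z) * cmod (f j z) \<le> cmod (f i z) * cmod (f i z) + cmod (f j z) * cmod (f j z)"
        proof -
          have "0 \<le> (cmod (f i z) - cmod (f j z))\<^sup>2" "0 \<le> cmod (f i z) * cmod (f j z)" by simp_all
          then show ?thesis unfolding power2_eq_square by (simp only: algebra_simps)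
        qed
        then have "\<bar>R\<bar> * (cmod (f i z) * cmod (f j z)) \<le> \<bar>R\<bar> * (cmod (f i z) * cmod (f i z) + cmod (f j z) * cmod (f j z))"
          by (intro mult_left_mono) auto
        then show ?thesis unfolding G by (simp add: distrib_left)
      qed (simp add: G_def)
    qed
  qed
  define R where "R z = indicator F' z * ((cmod (g z))\<^sup>2 * rho z ^ (3 * k) / rho z ^ 3)" for z
  have Rexp: "complex_of_real (R z) = (\<Sum>i<d. \<Sum>j<d. (a i * cnj (a j)) * G i j z)" for z
  proof (cases "z \<in> F'")
    case True
    then have zb: "z \<in> ball 0 1" using F'B by auto
    have "complex_of_real (R z) = g z * cnj (g z) * (of_real (rho z ^ (3 * k)) * of_real (1 / rho z ^ 3))"
      using True by (simp add: R_def complex_norm_square[unfolded of_real_power])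
    also have "g z * cnj (g z) = (\<Sum>i<d. \<Sum>j<d. (a i * f i z) * (cnj (a j) * cnj (f j z)))"
      unfolding g[OF zb] by (simp add: sum_product)
    finally show ?thesis using True unfolding G_def rho_def
      by (simp add: sum_distrib_left sum_distrib_right sum_divide_distrib mult_ac del: of_real_diff of_real_power)
  qed (simp add: R_def G_def)
  have "integrable lborel (\<lambda>z. complex_of_real (R z))"
    unfolding Rexp using Gi by (intro Bochner_Integration.integrable_sum integrable_mult_right) auto
  then have Ri: "integrable lborel R" by (simp only: complex_of_real_integrable_eq)
  have "complex_of_real (LINT z|lborel. R z) = (LINT z|lborel. complex_of_real (R z))" by simp
  also have "\<dots> = (\<Sum>i<d. \<Sum>j<d. (a i * cnj (a j)) * (LINT z|lborel. G i j z))"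
  proof -
    have int: "integrable lborel (\<lambda>z. (a i * cnj (a j)) * G i j z)" if "i < d" "j < d" for i j
      using Gi[OF that] by (rule integrable_mult_right)
    have "(LINT z|lborel. complex_of_real (R z)) = (\<Sum>i<d. LINT z|lborel. (\<Sum>j<d. (a i * cnj (a j)) * G i j z))"
      unfolding Rexp by (intro Bochner_Integration.integral_sum Bochner_Integration.integrable_sum int) auto
    also have "\<dots> = (\<Sum>i<d. \<Sum>j<d. LINT z|lborel. (a i * cnj (a j)) * G i j z)"
      by (intro sum.cong refl Bochner_Integration.integral_sum int) auto
    finally show ?thesis by (simp only: integral_mult_right_zero)
  qed
  also have "\<dots> = (\<Sum>i<d. \<Sum>j<d. if i = j then a i * cnj (a j) else 0)"
    by (intro sum.cong refl) (simp add: GI)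
  also have "\<dots> = (\<Sum>i<d. a i * cnj (a i))" by (intro sum.cong refl) (simp add: sum.delta')
  also have "\<dots> = complex_of_real (\<Sum>i<d. (cmod (a i))\<^sup>2)" by (simp add: complex_norm_square[unfolded of_real_power])
  finally have RI: "(LINT z|lborel. R z) = (\<Sum>i<d. (cmod (a i))\<^sup>2)" using of_real_eq_iff by blast
  have R0: "R z \<ge> 0" for z
    using rho_pos[of z] F'B by (auto simp: R_def indicator_def)
  have "form_norm F' k g = (\<integral>\<^sup>+w. ennreal (indicator (ball 0 1) w / rho w ^ 3) * (indicator F' w * ennreal ((cmod (g w))\<^sup>2 * rho w ^ (3 * k))) \<partial>lborel)"
  proof -
    have "continuous_on (ball 0 1) (\<lambda>z. \<Sum>j<d. a j * f j z)" using f by (intro continuous_intros) auto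
    then have "continuous_on (ball 0 1) g" by (rule continuous_on_eq) (simp add: g)
    then have "continuous_on (ball 0 1) (\<lambda>w. (cmod (g w))\<^sup>2 * rho w ^ (3 * k))" unfolding rho_def by (intro continuous_intros)
    then show ?thesis unfolding form_norm_def
      by (intro nn_integral_hyp_measure measurable_indicator_continuous F'(1) F'B)
  qed
  also have "\<dots> = (\<integral>\<^sup>+w. ennreal (R w) \<partial>lborel)"
  proof (intro nn_integral_cong)
    fix w :: "complex^2"
    show "ennreal (indicator (ball 0 1) w / rho w ^ 3) * (indicator F' w * ennreal ((cmod (g w))\<^sup>2 * rho w ^ (3 * k))) = ennreal (R w)"
    proof (cases "w \<in> F'")
      case True
      then have "w \<in> ball 0 1" using F'B by auto
      then have "rho w > 0" by (rule rho_pos)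
      then show ?thesis using True \<open>w \<in> ball 0 1\<close> by (simp add: R_def ennreal_mult[symmetric] mult.commute)
    qed (simp add: R_def)
  qed
  also have "\<dots> = ennreal (LINT z|lborel. R z)" by (rule nn_integral_eq_integral[OF Ri]) (use R0 in simp)
  finally show ?thesis using RI by simp
qed

context cocompact_lattice
begin

lemma bergman_norm_invariant:
  assumes f: "\<And>j. j < d \<Longrightarrow> f j \<in> aut_forms (3 * k) \<Gamma>" and g: "\<gamma> \<in> \<Gamma>" and w: "w \<in> ball 0 1"
  shows "bergman_norm k d f (act \<gamma> w) = bergman_norm k d f w"
  unfolding bergman_norm_eq_sum rho_def[symmetric] sum_distrib_left
  using aut_forms_norm_invariant[OF f g in_SU21[OF g] w] by (intro sum.cong) (auto simp: mult.commute)

text \<open>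
  For the upper bound take the form \<open>h = \<Sum>j. cnj (f_j z) f_j\<close>, for which \<open>h z\<close> and the squared norm are
  both equal to \<open>B = \<Sum>j. |f_j z|^2\<close>. For the lower bound expand the Poincare series in the basis and
  apply the Cauchy-Schwarz inequality to its value at \<open>z\<close>.
\<close>

lemma bergman_bounds:
  assumes r: "covers r"
  shows "\<exists>k0 c1 c2. c1 > 0 \<and> c2 > 0 \<and> k0 \<ge> 1 \<and> (\<forall>k\<ge>k0. \<forall>F d f. fundamental_domain \<Gamma> F \<longrightarrow> orthonormal_basis \<Gamma> F k d f \<longrightarrow>
     (\<forall>z\<in>ball 0 1. c1 * (real k)\<^sup>2 \<le> bergman_norm k d f z \<and> bergman_norm k d f z \<le> c2 * (real k)\<^sup>2))"
proof -
  have r': "0 < r" "r < 1" using r by (auto simp: covers_def)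
  obtain c2 where c2: "c2 > 0" and c2A: "\<forall>k\<ge>1. \<forall>f\<in>aut_forms (3 * k) \<Gamma>. \<forall>z\<in>cball 0 r. \<forall>F'. F' \<in> sets borel \<longrightarrow> F' \<subseteq> ball 0 1 \<longrightarrow>
     tiles F' \<longrightarrow>
     ennreal ((cmod (f z))\<^sup>2 * rho z ^ (3 * k)) \<le> ennreal (c2 * (real k)\<^sup>2) * form_norm F' k f"
    using point_evaluation_bound[OF r] by (elim exE conjE) (rule that)
  obtain k1 where k1: "\<And>k z. k \<ge> k1 \<Longrightarrow> z \<in> cball 0 r \<Longrightarrow> cmod (poincare \<Gamma> k z z) * rho z ^ (3 * k) \<ge> 1/2"
    using poincare_diag[OF r] by blast
  obtain C where C: "C > 0" "\<And>k z. k \<ge> 6 \<Longrightarrow> z \<in> cball 0 r \<Longrightarrow> (\<integral>\<^sup>+w. ennreal (proximity w z ^ k) \<partial>hyp_measure) \<le> ennreal (C / (real k)\<^sup>2)"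
    using proximity_integral_bound[OF r'] by blast
  define S where "S = orbit_const r + 1"
  have oc: "orbit_const r \<ge> 0" unfolding orbit_const_def using r' by (intro divide_nonneg_nonneg infsum_nonneg) auto
  have S: "S > 0" unfolding S_def using oc by simp
  define c1 where "c1 = 1 / (4 * S * C)"
  have c1: "c1 > 0" unfolding c1_def using S C by simp
  define k0 where "k0 = max k1 6"
  have main: "c1 * (real k)\<^sup>2 \<le> bergman_norm k d f z \<and> bergman_norm k d f z \<le> c2 * (real k)\<^sup>2"
    if k: "k \<ge> k0" and fd: "fundamental_domain \<Gamma> F" and onb: "orthonormal_basis \<Gamma> F k d f" and z: "z \<in> cball 0 r" for k F d f z
  proof -
    have zb: "z \<in> ball 0 1" using z r' by auto
    have rz: "rho z > 0" by (rule rho_pos[OF zb])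
    have k': "k \<ge> k1" "k \<ge> 6" using k by (auto simp: k0_def)
    have faut: "\<And>j. j < d \<Longrightarrow> f j \<in> aut_forms (3 * k) \<Gamma>"
      and on: "\<And>i j. i < d \<Longrightarrow> j < d \<Longrightarrow> hyp_inner F k (f i) (f j) = (if i = j then 1 else 0)"
      and span: "\<And>g. g\<in>aut_forms (3 * k) \<Gamma> \<Longrightarrow> \<exists>a. \<forall>z\<in>ball 0 1. g z = (\<Sum>j<d. a j * f j z)"
      using onb unfolding orthonormal_basis_def by auto
    have fc: "\<And>j. j < d \<Longrightarrow> continuous_on (ball 0 1) (f j)"
      using faut aut_forms_holomorphic holomorphic2_on_imp_continuous_on by blast
    have F: "F \<in> sets lebesgue" "F \<subseteq> ball 0 1" using fd by (auto simp: fundamental_domain_def)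
    obtain F' where F': "F' \<in> sets borel" "F' \<subseteq> F" "negligible (F - F')" and F'B: "F' \<subseteq> ball 0 1" 
      and ae: "tiles F'"
      using borel_fundamental[OF fd] by blast
    note fn = form_norm_lincomb[OF F F' fc on]
    define B where "B = (\<Sum>j<d. (cmod (f j z))\<^sup>2)"
    have B0: "B \<ge> 0" unfolding B_def by (intro sum_nonneg) auto
    have bn: "bergman_norm k d f z = B * rho z ^ (3 * k)" unfolding bergman_norm_eq_sum B_def rho_def by (simp add: mult.commute)
    have upper: "B * rho z ^ (3 * k) \<le> c2 * (real k)\<^sup>2"
    proof -
      define h where "h w = (\<Sum>j<d. cnj (f j z) * f j w)" for w
      have h: "h \<in> aut_forms (3 * k) \<Gamma>" unfolding h_def by (rule aut_forms_lincomb) (rule faut)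
      have "h z = of_real B" unfolding h_def B_def by (simp add: complex_norm_square[unfolded of_real_power] mult.commute)
      then have hz: "cmod (h z) = B" using B0 by simp
      have "form_norm F' k h = ennreal (\<Sum>j<d. (cmod (cnj (f j z)))\<^sup>2)" by (rule fn) (auto simp: h_def)
      then have hn: "form_norm F' k h = ennreal B" by (simp add: B_def)
      have "ennreal (B\<^sup>2 * rho z ^ (3 * k)) \<le> ennreal (c2 * (real k)\<^sup>2) * ennreal B"
        using c2A[rule_format, OF _ h z F'(1) F'B ae] k' unfolding hz hn by simp
      also have "\<dots> = ennreal (c2 * (real k)\<^sup>2 * B)" using c2 B0 by (simp add: ennreal_mult)
      finally have "B\<^sup>2 * rho z ^ (3 * k) \<le> c2 * (real k)\<^sup>2 * B"
        using c2 B0 by (subst (asm) ennreal_le_iff) auto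
      then have "(B * rho z ^ (3 * k)) * B \<le> (c2 * (real k)\<^sup>2) * B" by (simp add: power2_eq_square mult_ac)
      then show ?thesis using B0 c2 by (cases "B = 0") (auto simp: mult_le_cancel_right)
    qed
    have lower: "c1 * (real k)\<^sup>2 \<le> B * rho z ^ (3 * k)"
    proof -
      let ?P = "poincare \<Gamma> k z"
      have P: "?P \<in> aut_forms (3 * k) \<Gamma>" by (rule poincare_aut_form[OF zb]) (use k' in simp)
      obtain a where a: "\<And>w. w \<in> ball 0 1 \<Longrightarrow> ?P w = (\<Sum>j<d. a j * f j w)" using span[OF P] by blast
      define A where "A = (\<Sum>j<d. (cmod (a j))\<^sup>2)"
      have A0: "A \<ge> 0" unfolding A_def by (intro sum_nonneg) auto
      have "ennreal A = form_norm F' k ?P" unfolding A_def by (rule fn[symmetric]) (assumption | rule a)+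
      also have "\<dots> \<le> ennreal (orbit_const r / rho z ^ (3 * k)) * (\<integral>\<^sup>+w. ennreal (proximity w z ^ k) \<partial>hyp_measure)"
        unfolding form_norm_def by (rule poincare_L2[OF r z _ F'(1) F'B ae]) (use k' in simp)
      also have "\<dots> \<le> ennreal (S / rho z ^ (3 * k)) * ennreal (C / (real k)\<^sup>2)"
        using rz by (intro mult_mono ennreal_leI C(2) k' z divide_right_mono) (auto simp: S_def)
      also have "\<dots> = ennreal (S / rho z ^ (3 * k) * (C / (real k)\<^sup>2))"
        using S C rz by (intro ennreal_mult[symmetric]) auto
      finally have A1: "A \<le> S / rho z ^ (3 * k) * (C / (real k)\<^sup>2)"
        using S C rz by (subst (asm) ennreal_le_iff) auto
      have "(1/2)\<^sup>2 \<le> (cmod (?P z) * rho z ^ (3 * k))\<^sup>2" using k1[OF k'(1) z] by (intro power_mono) auto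
      also have "\<dots> = (cmod (?P z))\<^sup>2 * (rho z ^ (3 * k))\<^sup>2" by (simp add: power_mult_distrib)
      also have "\<dots> \<le> (A * B) * (rho z ^ (3 * k))\<^sup>2"
        unfolding a[OF zb] A_def B_def by (intro mult_right_mono cauchy_schwarz_sum) auto
      also have "\<dots> \<le> (S / rho z ^ (3 * k) * (C / (real k)\<^sup>2) * B) * (rho z ^ (3 * k))\<^sup>2"
        using A1 B0 by (intro mult_right_mono) auto
      also have "\<dots> = S * C * (B * rho z ^ (3 * k)) / (real k)\<^sup>2" using rz by (simp add: power2_eq_square)
      finally have "1/4 \<le> S * C * (B * rho z ^ (3 * k)) / (real k)\<^sup>2" by (simp add: power2_eq_square)
      moreover have "(real k)\<^sup>2 > 0" using k' by simp
      ultimately have "(real k)\<^sup>2 / 4 \<le> S * C * (B * rho z ^ (3 * k))" by (simp add: pos_le_divide_eq)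
      then show ?thesis unfolding c1_def using S C by (simp add: pos_divide_le_eq mult_ac)
    qed
    show ?thesis using upper lower bn by simp
  qed
  have "c1 * (real k)\<^sup>2 \<le> bergman_norm k d f z \<and> bergman_norm k d f z \<le> c2 * (real k)\<^sup>2"
    if k: "k \<ge> k0" and fd: "fundamental_domain \<Gamma> F" and onb: "orthonormal_basis \<Gamma> F k d f" and z: "z \<in> ball 0 1" for k F d f z
  proof -
    obtain \<gamma> where g: "\<gamma> \<in> \<Gamma>" "act \<gamma> z \<in> cball 0 r" using r z unfolding covers_def by blast
    have "\<And>j. j < d \<Longrightarrow> f j \<in> aut_forms (3 * k) \<Gamma>" using onb unfolding orthonormal_basis_def by auto
    then show ?thesis using main[OF k fd onb g(2)] bergman_norm_invariant[OF _ g(1) z] by simp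
  qed
  then show ?thesis using c1 c2 by (intro exI[of _ k0] exI[of _ c1] exI[of _ c2]) (auto simp: k0_def)
qed

end

section \<open>The complex Hessian of the Bergman potential\<close>

text \<open>
  \<open>F\<close> is real differentiable at \<open>z\<close> and \<open>P a\<close>, \<open>Q a\<close> are its derivatives with respect to \<open>z_a\<close> and the
  conjugate of \<open>z_a\<close>. This form of the differential makes the product and chain rules immediate.
\<close>

definition has_wirtinger :: "(complex^2 \<Rightarrow> complex) \<Rightarrow> (2 \<Rightarrow> complex) \<Rightarrow> (2 \<Rightarrow> complex) \<Rightarrow> complex^2 \<Rightarrow> bool" where
  "has_wirtinger F P Q z \<longleftrightarrow> (F has_derivative (\<lambda>v. P 1 * v$1 + P 2 * v$2 + Q 1 * cnj (v$1) + Q 2 * cnj (v$2))) (at z)"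

lemma has_wirtingerD:
  assumes "has_wirtinger F P Q z"
  shows "wirtinger a F z = P a" "wirtinger_bar a F z = Q a"
proof -
  have fd: "frechet_derivative F (at z) = (\<lambda>v. P 1 * v$1 + P 2 * v$2 + Q 1 * cnj (v$1) + Q 2 * cnj (v$2))"
    by (rule frechet_derivative_at[OF assms[unfolded has_wirtinger_def], symmetric])
  have "a = 1 \<or> a = 2" by (rule exhaust_2)
  then show "wirtinger a F z = P a" "wirtinger_bar a F z = Q a"
    unfolding wirtinger_def wirtinger_bar_def fd by (auto simp: axis_def algebra_simps)
qed

lemma has_wirtinger_transform:
  assumes "has_wirtinger F P Q z" "open S" "z \<in> S" "\<And>w. w \<in> S \<Longrightarrow> F w = G w"
  shows "has_wirtinger G P Q z"
  using has_derivative_transform_within_open[OF assms(1)[unfolded has_wirtinger_def] assms(2,3)] assms(4)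
  unfolding has_wirtinger_def by blast

lemma has_wirtinger_eq: "has_wirtinger F P Q z \<Longrightarrow> P 1 = P' 1 \<Longrightarrow> P 2 = P' 2 \<Longrightarrow> Q 1 = Q' 1 \<Longrightarrow> Q 2 = Q' 2 \<Longrightarrow> has_wirtinger F P' Q' z"
  by (simp add: has_wirtinger_def)

lemma has_wirtinger_holomorphic:
  assumes "holomorphic2_on f S" "z \<in> S"
  shows "has_wirtinger f (\<lambda>a. cpartial a f z) (\<lambda>a. 0) z"
  using holomorphic2_on_has_derivative[OF assms] by (simp add: has_wirtinger_def)

lemma has_wirtinger_cnj:
  assumes "has_wirtinger f P Q z"
  shows "has_wirtinger (\<lambda>z. cnj (f z)) (\<lambda>a. cnj (Q a)) (\<lambda>a. cnj (P a)) z"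
  using has_derivative_cnj[OF assms[unfolded has_wirtinger_def]] by (simp add: has_wirtinger_def algebra_simps)

lemma has_wirtinger_const: "has_wirtinger (\<lambda>z. c) (\<lambda>a. 0) (\<lambda>a. 0) z"
  by (simp add: has_wirtinger_def)

lemma has_wirtinger_add:
  assumes "has_wirtinger f P Q z" "has_wirtinger g P' Q' z"
  shows "has_wirtinger (\<lambda>z. f z + g z) (\<lambda>a. P a + P' a) (\<lambda>a. Q a + Q' a) z"
  using has_derivative_add[OF assms[unfolded has_wirtinger_def]] unfolding has_wirtinger_def by (simp add: algebra_simps)

lemma has_wirtinger_mult:
  assumes "has_wirtinger f P Q z" "has_wirtinger g P' Q' z"
  shows "has_wirtinger (\<lambda>z. f z * g z) (\<lambda>a. P a * g z + f z * P' a) (\<lambda>a. Q a * g z + f z * Q' a) z"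
  using has_derivative_mult[OF assms[unfolded has_wirtinger_def]] unfolding has_wirtinger_def by (simp add: algebra_simps)

lemma has_wirtinger_sum:
  assumes "\<And>j. j < (d::nat) \<Longrightarrow> has_wirtinger (f j) (P j) (Q j) z"
  shows "has_wirtinger (\<lambda>z. \<Sum>j<d. f j z) (\<lambda>a. \<Sum>j<d. P j a) (\<lambda>a. \<Sum>j<d. Q j a) z"
  using assms by (induction d) (auto intro: has_wirtinger_const has_wirtinger_add)

lemma has_wirtinger_inverse:
  assumes "has_wirtinger f P Q z" "f z \<noteq> 0"
  shows "has_wirtinger (\<lambda>z. inverse (f z)) (\<lambda>a. - P a / (f z)\<^sup>2) (\<lambda>a. - Q a / (f z)\<^sup>2) z"
proof -
  have "((\<lambda>z. inverse (f z)) has_derivative (\<lambda>v. - (inverse (f z) * (P 1 * v$1 + P 2 * v$2 + Q 1 * cnj (v$1) + Q 2 * cnj (v$2)) * inverse (f z)))) (at z)"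
    by (rule Deriv.has_derivative_inverse[OF assms(2) assms(1)[unfolded has_wirtinger_def]])
  moreover have "(\<lambda>v::complex^2. - (inverse (f z) * (P 1 * v$1 + P 2 * v$2 + Q 1 * cnj (v$1) + Q 2 * cnj (v$2)) * inverse (f z))) =
    (\<lambda>v. (- P 1 / (f z)\<^sup>2) * v$1 + (- P 2 / (f z)\<^sup>2) * v$2 + (- Q 1 / (f z)\<^sup>2) * cnj (v$1) + (- Q 2 / (f z)\<^sup>2) * cnj (v$2))"
    using assms(2) by (auto simp: fun_eq_iff field_simps power2_eq_square)
  ultimately show ?thesis by (simp add: has_wirtinger_def)
qed

lemma has_wirtinger_divide:
  assumes "has_wirtinger f P Q z" "has_wirtinger g P' Q' z" "g z \<noteq> 0"
  shows "has_wirtinger (\<lambda>z. f z / g z) (\<lambda>a. P a / g z - f z * P' a / (g z)\<^sup>2) (\<lambda>a. Q a / g z - f z * Q' a / (g z)\<^sup>2) z"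
  using has_wirtinger_mult[OF assms(1) has_wirtinger_inverse[OF assms(2,3)]]
  unfolding divide_inverse[symmetric] by (rule has_wirtinger_eq) (simp_all add: divide_inverse)

text \<open>
  The differential of a real function is real, so composing it with the real logarithm does not leave
  this calculus.
\<close>

lemma has_wirtinger_ln:
  fixes \<phi> :: "complex^2 \<Rightarrow> real"
  assumes w: "has_wirtinger (\<lambda>w. complex_of_real (\<phi> w)) P Q z" and pos: "\<phi> z > 0"
  shows "has_wirtinger (\<lambda>w. complex_of_real (ln (\<phi> w))) (\<lambda>a. P a / of_real (\<phi> z)) (\<lambda>a. Q a / of_real (\<phi> z)) z"
proof -
  define D where "D v = P 1 * v$1 + P 2 * v$2 + Q 1 * cnj (v$1) + Q 2 * cnj (v$2)" for v :: "complex^2"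
  have d: "((\<lambda>w. complex_of_real (\<phi> w)) has_derivative D) (at z)" using w unfolding has_wirtinger_def D_def .
  have dr: "(\<phi> has_derivative (\<lambda>v. Re (D v))) (at z)" using has_derivative_Re[OF d] by simp
  have "((\<lambda>w. complex_of_real (\<phi> w)) has_derivative (\<lambda>v. complex_of_real (Re (D v)))) (at z)"
    by (rule has_derivative_of_real[OF dr])
  then have D: "(\<lambda>v. complex_of_real (Re (D v))) = D" using has_derivative_unique[OF _ d] by blast
  have "((\<lambda>w. ln (\<phi> w)) has_derivative (\<lambda>v. Re (D v) / \<phi> z)) (at z)"
    using pos by (auto intro!: derivative_eq_intros dr simp: divide_inverse mult_ac)
  then have "((\<lambda>w. complex_of_real (ln (\<phi> w))) has_derivative (\<lambda>v. complex_of_real (Re (D v) / \<phi> z))) (at z)"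
    by (rule has_derivative_of_real)
  moreover have "(\<lambda>v. complex_of_real (Re (D v) / \<phi> z)) = (\<lambda>v. D v / of_real (\<phi> z))"
    using D by (auto simp: fun_eq_iff)
  ultimately show ?thesis unfolding has_wirtinger_def D_def by (simp add: add_divide_distrib)
qed

lemma has_wirtinger_compose:
  fixes \<psi> :: "complex^2 \<Rightarrow> complex^2"
  assumes F: "has_wirtinger F P Q (\<psi> z)"
    and d: "(\<psi> has_derivative (\<lambda>v. \<chi> i. if i = 1 then J 1 1 * v$1 + J 1 2 * v$2 else J 2 1 * v$1 + J 2 2 * v$2)) (at z)"
  shows "has_wirtinger (\<lambda>w. F (\<psi> w)) (\<lambda>a. P 1 * J 1 a + P 2 * J 2 a) (\<lambda>a. Q 1 * cnj (J 1 a) + Q 2 * cnj (J 2 a)) z"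
  using has_derivative_compose[OF d F[unfolded has_wirtinger_def]] unfolding has_wirtinger_def
  by (simp add: algebra_simps)

lemma has_wirtinger_coord: "has_wirtinger (\<lambda>z. z $ b) (\<lambda>a. if a = b then 1 else 0) (\<lambda>a. 0) z"
proof -
  have "b = 1 \<or> b = 2" by (rule exhaust_2)
  then show ?thesis unfolding has_wirtinger_def
    by (auto intro!: bounded_linear_imp_has_derivative bounded_linear_vec_nth)
qed

lemma has_wirtinger_rho: "has_wirtinger (\<lambda>z. complex_of_real (rho z)) (\<lambda>a. - cnj (z $ a)) (\<lambda>a. - (z $ a)) z"
proof -
  have "(\<lambda>z. complex_of_real (rho z)) = (\<lambda>z. 1 + (- 1) * (z$1 * cnj (z$1) + z$2 * cnj (z$2)))"
    by (auto simp: rho_herm herm_def)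
  then show ?thesis
    by (simp only:) (rule has_wirtinger_eq[OF has_wirtinger_add[OF has_wirtinger_const has_wirtinger_mult[OF has_wirtinger_const
      has_wirtinger_add[OF has_wirtinger_mult[OF has_wirtinger_coord has_wirtinger_cnj[OF has_wirtinger_coord]] has_wirtinger_mult[OF has_wirtinger_coord has_wirtinger_cnj[OF has_wirtinger_coord]]]]]], simp_all)
qed

text \<open>
  The derivative of \<open>m log (1 - |w|^2) + log (\<Sum>j. |f_j w|^2)\<close> with respect to the conjugate of \<open>w_b\<close>.
\<close>

definition pot_dbar :: "nat \<Rightarrow> nat \<Rightarrow> (nat \<Rightarrow> complex^2 \<Rightarrow> complex) \<Rightarrow> 2 \<Rightarrow> complex^2 \<Rightarrow> complex" where
  "pot_dbar m d f b w = of_nat m * (- (w $ b) / of_real (rho w)) +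
     (\<Sum>j<d. f j w * cnj (cpartial b (f j) w)) / (\<Sum>j<d. f j w * cnj (f j w))"

text \<open>
  The derivative of \<open>pot_dbar\<close> with respect to \<open>w_a\<close>, that is, the complex Hessian of the potential.
\<close>

definition pot_hess :: "nat \<Rightarrow> nat \<Rightarrow> (nat \<Rightarrow> complex^2 \<Rightarrow> complex) \<Rightarrow> 2 \<Rightarrow> 2 \<Rightarrow> complex^2 \<Rightarrow> complex" where
  "pot_hess m d f a b w =
     - of_nat m * ((if a = b then 1 else 0) / of_real (rho w) + cnj (w $ a) * w $ b / (of_real (rho w))\<^sup>2) +
     ((\<Sum>j<d. cpartial a (f j) w * cnj (cpartial b (f j) w)) / (\<Sum>j<d. f j w * cnj (f j w))
      - (\<Sum>j<d. f j w * cnj (cpartial b (f j) w)) * (\<Sum>j<d. cpartial a (f j) w * cnj (f j w)) / (\<Sum>j<d. f j w * cnj (f j w))\<^sup>2)"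

lemma sum_norm_complex: "(\<Sum>j<d. f j w * cnj (f j w)) = complex_of_real (\<Sum>j<d. (cmod (f j w))\<^sup>2)"
  unfolding of_real_sum complex_norm_square ..

context
  fixes f :: "nat \<Rightarrow> complex^2 \<Rightarrow> complex" and d k :: nat
  assumes hol: "\<And>j. j < d \<Longrightarrow> holomorphic2_on (f j) (ball 0 1)"
    and pos: "\<And>w. w \<in> ball 0 1 \<Longrightarrow> bergman_norm k d f w > 0"
begin

abbreviation hess :: "2 \<Rightarrow> 2 \<Rightarrow> complex^2 \<Rightarrow> complex" where "hess \<equiv> pot_hess (3 * k) d f"
abbreviation dbar :: "2 \<Rightarrow> complex^2 \<Rightarrow> complex" where "dbar \<equiv> pot_dbar (3 * k) d f"

lemma sum_sq_pos: "w \<in> ball 0 1 \<Longrightarrow> (\<Sum>j<d. (cmod (f j w))\<^sup>2) > 0"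
  using pos[of w] rho_pos[of w] unfolding bergman_norm_eq_sum rho_def[symmetric]
  by (simp add: zero_less_mult_iff)

lemma has_wirtinger_sum_sq:
  assumes w: "w \<in> ball 0 1"
  shows "has_wirtinger (\<lambda>w. \<Sum>j<d. f j w * cnj (f j w)) (\<lambda>a. \<Sum>j<d. cpartial a (f j) w * cnj (f j w)) (\<lambda>b. \<Sum>j<d. f j w * cnj (cpartial b (f j) w)) w"
proof -
  have "has_wirtinger (\<lambda>w. f j w * cnj (f j w)) (\<lambda>a. cpartial a (f j) w * cnj (f j w)) (\<lambda>b. f j w * cnj (cpartial b (f j) w)) w" if "j < d" for j
    by (rule has_wirtinger_eq[OF has_wirtinger_mult[OF has_wirtinger_holomorphic[OF hol[OF that] w] has_wirtinger_cnj[OF has_wirtinger_holomorphic[OF hol[OF that] w]]]]) simp_all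
  then show ?thesis by (rule has_wirtinger_sum)
qed

lemma has_wirtinger_potential:
  assumes w: "w \<in> ball 0 1"
  shows "\<exists>P. has_wirtinger (\<lambda>w. complex_of_real (ln (bergman_norm k d f w))) P (\<lambda>b. dbar b w) w"
proof -
  have rw: "rho w > 0" by (rule rho_pos[OF w])
  have Bw: "(\<Sum>j<d. (cmod (f j w))\<^sup>2) > 0" by (rule sum_sq_pos[OF w])
  have 1: "has_wirtinger (\<lambda>w. complex_of_real (ln (rho w))) (\<lambda>a. - cnj (w $ a) / of_real (rho w)) (\<lambda>a. - (w $ a) / of_real (rho w)) w"
    by (rule has_wirtinger_ln[OF has_wirtinger_rho rw])
  have 2: "has_wirtinger (\<lambda>w. complex_of_real (ln (\<Sum>j<d. (cmod (f j w))\<^sup>2))) 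
     (\<lambda>a. (\<Sum>j<d. cpartial a (f j) w * cnj (f j w)) / of_real (\<Sum>j<d. (cmod (f j w))\<^sup>2)) 
     (\<lambda>b. (\<Sum>j<d. f j w * cnj (cpartial b (f j) w)) / of_real (\<Sum>j<d. (cmod (f j w))\<^sup>2)) w"
    by (rule has_wirtinger_ln[OF has_wirtinger_sum_sq[OF w, unfolded sum_norm_complex] Bw])
  note 3 = has_wirtinger_add[OF has_wirtinger_mult[OF has_wirtinger_const[of "of_nat (3 * k)" w] 1] 2]
  have eq: "of_nat (3 * k) * complex_of_real (ln (rho x)) + complex_of_real (ln (\<Sum>j<d. (cmod (f j x))\<^sup>2)) =
     complex_of_real (ln (bergman_norm k d f x))" if "x \<in> ball 0 1" for x
    unfolding bergman_norm_eq_sum rho_def[symmetric]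
    using rho_pos[OF that] sum_sq_pos[OF that] by (simp add: ln_mult ln_realpow)
  show ?thesis
    by (rule exI, rule has_wirtinger_eq[OF has_wirtinger_transform[OF 3 open_ball w eq] refl refl])
       (simp_all add: pot_dbar_def sum_norm_complex)
qed

lemma wirtinger_bar_potential:
  "w \<in> ball 0 1 \<Longrightarrow> wirtinger_bar b (\<lambda>w. complex_of_real (ln (bergman_norm k d f w))) w = dbar b w"
  using has_wirtinger_potential has_wirtingerD(2) by blast

lemma has_wirtinger_pot_dbar:
  assumes w: "w \<in> ball 0 1"
  shows "\<exists>R. has_wirtinger (dbar b) (\<lambda>a. hess a b w) R w"
proof -
  have rw: "complex_of_real (rho w) \<noteq> 0" using rho_pos[OF w] by simp
  have Bw: "(\<Sum>j<d. f j w * cnj (f j w)) \<noteq> 0" unfolding sum_norm_complex using sum_sq_pos[OF w] by (simp del: of_real_sum)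
  have h2: "has_wirtinger (cpartial b (f j)) (\<lambda>a. cpartial a (cpartial b (f j)) w) (\<lambda>a. 0) w" if "j < d" for j
    by (rule has_wirtinger_holomorphic[OF holomorphic2_on_cpartial[OF hol[OF that] open_ball] w])
  have "has_wirtinger (\<lambda>w. f j w * cnj (cpartial b (f j) w)) (\<lambda>a. cpartial a (f j) w * cnj (cpartial b (f j) w)) (\<lambda>a. f j w * cnj (cpartial a (cpartial b (f j)) w)) w" if "j < d" for j
    by (rule has_wirtinger_eq[OF has_wirtinger_mult[OF has_wirtinger_holomorphic[OF hol[OF that] w] has_wirtinger_cnj[OF h2[OF that]]]]) simp_all
  then have n: "has_wirtinger (\<lambda>w. \<Sum>j<d. f j w * cnj (cpartial b (f j) w)) (\<lambda>a. \<Sum>j<d. cpartial a (f j) w * cnj (cpartial b (f j) w)) (\<lambda>a. \<Sum>j<d. f j w * cnj (cpartial a (cpartial b (f j)) w)) w"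
    by (rule has_wirtinger_sum)
  have m: "has_wirtinger (\<lambda>w. - 1 * w $ b) (\<lambda>a. - 1 * (if a = b then 1 else 0)) (\<lambda>a. 0) w"
    by (rule has_wirtinger_eq[OF has_wirtinger_mult[OF has_wirtinger_const has_wirtinger_coord]]) simp_all
  have q: "has_wirtinger (\<lambda>w. of_nat (3 * k) * ((- 1 * w $ b) / complex_of_real (rho w)) + (\<Sum>j<d. f j w * cnj (cpartial b (f j) w)) / (\<Sum>j<d. f j w * cnj (f j w)))
     (\<lambda>a. 0 * ((- 1 * w $ b) / complex_of_real (rho w)) + of_nat (3 * k) * ((- 1 * (if a = b then 1 else 0)) / of_real (rho w) - (- 1 * w $ b) * (- cnj (w $ a)) / (of_real (rho w))\<^sup>2)
        + ((\<Sum>j<d. cpartial a (f j) w * cnj (cpartial b (f j) w)) / (\<Sum>j<d. f j w * cnj (f j w))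
      - (\<Sum>j<d. f j w * cnj (cpartial b (f j) w)) * (\<Sum>j<d. cpartial a (f j) w * cnj (f j w)) / (\<Sum>j<d. f j w * cnj (f j w))\<^sup>2))
     (\<lambda>a. 0 * ((- 1 * w $ b) / complex_of_real (rho w)) + of_nat (3 * k) * (0 / of_real (rho w) - (- 1 * w $ b) * (- (w $ a)) / (of_real (rho w))\<^sup>2)
        + ((\<Sum>j<d. f j w * cnj (cpartial a (cpartial b (f j)) w)) / (\<Sum>j<d. f j w * cnj (f j w))
      - (\<Sum>j<d. f j w * cnj (cpartial b (f j) w)) * (\<Sum>j<d. f j w * cnj (cpartial a (f j) w)) / (\<Sum>j<d. f j w * cnj (f j w))\<^sup>2)) w"
    by (intro has_wirtinger_add has_wirtinger_mult[OF has_wirtinger_const] has_wirtinger_divide m has_wirtinger_rho n has_wirtinger_sum_sq w rw Bw)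
  have e: "(\<lambda>w. of_nat (3 * k) * ((- 1 * w $ b) / complex_of_real (rho w)) + (\<Sum>j<d. f j w * cnj (cpartial b (f j) w)) / (\<Sum>j<d. f j w * cnj (f j w))) = dbar b"
    by (simp add: pot_dbar_def fun_eq_iff)
  show ?thesis
    by (rule exI, rule has_wirtinger_eq[OF q[unfolded e] _ _ refl refl]) (simp_all add: pot_hess_def algebra_simps)
qed

lemma ddbar_potential:
  assumes z: "z \<in> ball 0 1"
  shows "wirtinger a (wirtinger_bar b (\<lambda>w. complex_of_real (ln (bergman_norm k d f w)))) z = hess a b z"
proof -
  obtain R where "has_wirtinger (dbar b) (\<lambda>a. hess a b z) R z"
    using has_wirtinger_pot_dbar[OF z] by blast
  then have "has_wirtinger (wirtinger_bar b (\<lambda>w. complex_of_real (ln (bergman_norm k d f w)))) (\<lambda>a. hess a b z) R z"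
    by (rule has_wirtinger_transform[OF _ open_ball z]) (simp add: wirtinger_bar_potential)
  then show ?thesis by (rule has_wirtingerD(1))
qed

text \<open>
  The factor \<open>1 / pi^2\<close> is the square of the quotient of the normalisations \<open>i / (2 pi)\<close> and \<open>i / 2\<close> of
  the two metrics.
\<close>

lemma form_ratio_bergman:
  assumes z: "z \<in> ball 0 1"
  shows "form_ratio (bergman_vol k d f z) (hyp_vol z) = of_real (rho z ^ 3 / pi\<^sup>2) *
     (hess 1 1 z * hess 2 2 z - hess 1 2 z * hess 2 1 z)"
    (is "_ = _ * ?det")
proof (rule form_ratio_eqI)
  have rz: "rho z > 0" by (rule rho_pos[OF z])
  have v: "bergman_vol k d f z = (\<lambda>u v w x. (- (\<i> / (2 * of_real pi)))\<^sup>2 * ?det *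
     wedge22 (wedge11 (dz 1) (dzbar 1)) (wedge11 (dz 2) (dzbar 2)) u v w x)"
    unfolding bergman_vol_def bergman_metric_def ddbar_def
    by (subst volume_form_11) (simp add: ddbar_potential[OF z])
  show "bergman_vol k d f z u v w x = of_real (rho z ^ 3 / pi\<^sup>2) * ?det * hyp_vol z u v w x" for u v w x
    unfolding v hyp_vol_def rho_def[symmetric] using rz by (simp add: power_mult_distrib power_divide field_simps)
  show "hyp_vol z (axis 1 1) (axis 1 \<i>) (axis 2 1) (axis 2 \<i>) \<noteq> 0"
    unfolding hyp_vol_standard_frame rho_def[symmetric] using rz by simp
qed

text \<open>
  The chain rule for an invariant potential. The conjugated Jacobian is antiholomorphic, so
  differentiating it with respect to \<open>z_a\<close> gives nothing.
\<close>

lemma pot_hess_invariant: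
  assumes g: "\<gamma> \<in> carrier SU21" and z: "z \<in> ball 0 1"
    and inv: "\<And>w. w \<in> ball 0 1 \<Longrightarrow> bergman_norm k d f (act \<gamma> w) = bergman_norm k d f w"
  shows "hess a b z = 
      (hess 1 1 (act \<gamma> z) * jacobian 1 a \<gamma> z + hess 2 1 (act \<gamma> z) * jacobian 2 a \<gamma> z) * cnj (jacobian 1 b \<gamma> z)
    + (hess 1 2 (act \<gamma> z) * jacobian 1 a \<gamma> z + hess 2 2 (act \<gamma> z) * jacobian 2 a \<gamma> z) * cnj (jacobian 2 b \<gamma> z)"
proof -
  have first: "dbar b w = dbar 1 (act \<gamma> w) * cnj (jacobian 1 b \<gamma> w) + dbar 2 (act \<gamma> w) * cnj (jacobian 2 b \<gamma> w)"
    if w: "w \<in> ball 0 1" for w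
  proof -
    obtain P where P: "has_wirtinger (\<lambda>w. complex_of_real (ln (bergman_norm k d f w))) P (\<lambda>b. dbar b (act \<gamma> w)) (act \<gamma> w)"
      using has_wirtinger_potential[OF act_ball[OF g w]] by blast
    have "has_wirtinger (\<lambda>w. complex_of_real (ln (bergman_norm k d f w))) (\<lambda>a. P 1 * jacobian 1 a \<gamma> w + P 2 * jacobian 2 a \<gamma> w)
        (\<lambda>b. dbar 1 (act \<gamma> w) * cnj (jacobian 1 b \<gamma> w) + dbar 2 (act \<gamma> w) * cnj (jacobian 2 b \<gamma> w)) w"
      by (rule has_wirtinger_transform[OF has_wirtinger_compose[where J = "\<lambda>i j. jacobian i j \<gamma> w", OF P act_has_derivative[OF g w]] open_ball w]) (simp add: inv)
    from has_wirtingerD(2)[OF this] show ?thesis using wirtinger_bar_potential[OF w] by simp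
  qed
  have hj: "has_wirtinger (\<lambda>w. cnj (jacobian i b \<gamma> w)) (\<lambda>a. 0) (\<lambda>a. cnj (cpartial a (jacobian i b \<gamma>) z)) z" for i
  proof -
    have "holomorphic2_on (jacobian i b \<gamma>) (ball 0 1)"
      unfolding jacobian_def[abs_def] by (rule holomorphic2_on_cpartial[OF holomorphic2_act[OF g] open_ball])
    from has_wirtinger_cnj[OF has_wirtinger_holomorphic[OF this z]] show ?thesis by simp
  qed
  have hc: "\<exists>R. has_wirtinger (\<lambda>w. dbar c (act \<gamma> w)) (\<lambda>a. hess 1 c (act \<gamma> z) * jacobian 1 a \<gamma> z + hess 2 c (act \<gamma> z) * jacobian 2 a \<gamma> z) R z" for c
  proof -
    obtain R where R: "has_wirtinger (dbar c) (\<lambda>a. hess a c (act \<gamma> z)) R (act \<gamma> z)"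
      using has_wirtinger_pot_dbar[OF act_ball[OF g z]] by blast
    show ?thesis
      by (rule exI, rule has_wirtinger_compose[where J = "\<lambda>i j. jacobian i j \<gamma> z", OF R act_has_derivative[OF g z]])
  qed
  obtain R1 where R1: "has_wirtinger (\<lambda>w. dbar 1 (act \<gamma> w)) (\<lambda>a. hess 1 1 (act \<gamma> z) * jacobian 1 a \<gamma> z + hess 2 1 (act \<gamma> z) * jacobian 2 a \<gamma> z) R1 z"
    using hc by blast
  obtain R2 where R2: "has_wirtinger (\<lambda>w. dbar 2 (act \<gamma> w)) (\<lambda>a. hess 1 2 (act \<gamma> z) * jacobian 1 a \<gamma> z + hess 2 2 (act \<gamma> z) * jacobian 2 a \<gamma> z) R2 z"
    using hc by blast
  have A: "has_wirtinger (dbar b) (\<lambda>a. (hess 1 1 (act \<gamma> z) * jacobian 1 a \<gamma> z + hess 2 1 (act \<gamma> z) * jacobian 2 a \<gamma> z) * cnj (jacobian 1 b \<gamma> z)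
       + dbar 1 (act \<gamma> z) * 0 + 
      ((hess 1 2 (act \<gamma> z) * jacobian 1 a \<gamma> z + hess 2 2 (act \<gamma> z) * jacobian 2 a \<gamma> z) * cnj (jacobian 2 b \<gamma> z)
       + dbar 2 (act \<gamma> z) * 0)) 
      (\<lambda>a. R1 a * cnj (jacobian 1 b \<gamma> z) + dbar 1 (act \<gamma> z) * cnj (cpartial a (jacobian 1 b \<gamma>) z) +
        (R2 a * cnj (jacobian 2 b \<gamma> z) + dbar 2 (act \<gamma> z) * cnj (cpartial a (jacobian 2 b \<gamma>) z))) z"
    by (rule has_wirtinger_transform[OF has_wirtinger_add[OF has_wirtinger_mult[OF R1 hj] has_wirtinger_mult[OF R2 hj]] open_ball z]) (simp add: first)
  obtain R where R: "has_wirtinger (dbar b) (\<lambda>a. hess a b z) R z"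
    using has_wirtinger_pot_dbar[OF z] by blast
  show ?thesis using has_wirtingerD(1)[OF A, of a] has_wirtingerD(1)[OF R, of a] by simp
qed

text \<open>
  The Hessian determinant picks up the squared modulus of the Jacobian determinant, \<open>1 / |j|^6\<close>, which is
  the cube of the factor by which \<open>1 - |z|^2\<close> changes.
\<close>

lemma form_ratio_invariant:
  assumes g: "\<gamma> \<in> carrier SU21" and z: "z \<in> ball 0 1"
    and inv: "\<And>w. w \<in> ball 0 1 \<Longrightarrow> bergman_norm k d f (act \<gamma> w) = bergman_norm k d f w"
  shows "cmod (form_ratio (bergman_vol k d f z) (hyp_vol z)) = cmod (form_ratio (bergman_vol k d f (act \<gamma> z)) (hyp_vol (act \<gamma> z)))"
proof -
  let ?G = "\<lambda>a b. hess a b z" and ?G' = "\<lambda>a b. hess a b (act \<gamma> z)"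
  have nz: "cmod (autfactor \<gamma> z) > 0" using autfactor_nz[OF g z] by simp
  have H: "?G a b = (?G' 1 1 * jacobian 1 a \<gamma> z + ?G' 2 1 * jacobian 2 a \<gamma> z) * cnj (jacobian 1 b \<gamma> z)
    + (?G' 1 2 * jacobian 1 a \<gamma> z + ?G' 2 2 * jacobian 2 a \<gamma> z) * cnj (jacobian 2 b \<gamma> z)" for a b
    by (rule pot_hess_invariant[OF g z inv])
  have "?G 1 1 * ?G 2 2 - ?G 1 2 * ?G 2 1 = (?G' 1 1 * ?G' 2 2 - ?G' 1 2 * ?G' 2 1) *
     (jacobian 1 1 \<gamma> z * jacobian 2 2 \<gamma> z - jacobian 1 2 \<gamma> z * jacobian 2 1 \<gamma> z) * cnj (jacobian 1 1 \<gamma> z * jacobian 2 2 \<gamma> z - jacobian 1 2 \<gamma> z * jacobian 2 1 \<gamma> z)"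
    unfolding H complex_cnj_diff complex_cnj_mult by algebra
  then have "cmod (?G 1 1 * ?G 2 2 - ?G 1 2 * ?G 2 1) = cmod (?G' 1 1 * ?G' 2 2 - ?G' 1 2 * ?G' 2 1) / cmod (autfactor \<gamma> z) ^ 6"
    unfolding jacobian_det[OF g z] by (simp add: norm_mult norm_divide norm_power flip: power_add)
  then show ?thesis
    unfolding form_ratio_bergman[OF z] form_ratio_bergman[OF act_ball[OF g z]] rho_act[OF g z]
    using nz rho_pos[OF z] by (simp add: norm_mult norm_divide norm_power power_divide flip: power_mult)
qed

text \<open>
  Write \<open>B w = \<Sum>j. |f_j w|^2\<close>. On the ball of radius \<open>s = (1 - r) / (12k)\<close> about \<open>z\<close> the weight
  \<open>(1 - |w|^2)^(3k)\<close> drops by at most a factor 2, so \<open>B\<close> is at most a constant times \<open>B z\<close> there. Cauchy's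
  estimate for \<open>h = \<Sum>j. cnj (\<partial>_a f_j z) f_j\<close> then bounds \<open>D a = \<Sum>j. |\<partial>_a f_j z|^2 = \<partial>_a h z\<close> by a
  constant times \<open>k^2 B z\<close>, and the Cauchy-Schwarz inequality bounds both terms of the Hessian of
  \<open>log B\<close> by \<open>D\<close> and \<open>B\<close>.
\<close>

lemma pot_hess_bound:
  assumes r: "0 < r" "r < 1" and z: "z \<in> cball 0 r" and k: "k \<ge> 1"
    and c: "c1 > 0" "\<And>w. w \<in> ball 0 1 \<Longrightarrow> c1 * (real k)\<^sup>2 \<le> bergman_norm k d f w" "\<And>w. w \<in> ball 0 1 \<Longrightarrow> bergman_norm k d f w \<le> c2 * (real k)\<^sup>2"
  shows "cmod (hess a b z) \<le> (6 / (1 - r)\<^sup>2 + 2304 * (c2 / c1) / (1 - r)\<^sup>2) * (real k)\<^sup>2"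
proof -
  have zb: "z \<in> ball 0 1" using z r by auto
  have rz: "rho z > 0" by (rule rho_pos[OF zb])
  have rz': "rho z \<ge> 1 - r" by (rule rho_ge[OF z]) (use r in auto)
  define B where "B w = (\<Sum>j<d. (cmod (f j w))\<^sup>2)" for w
  have bn: "bergman_norm k d f w = B w * rho w ^ (3 * k)" for w unfolding bergman_norm_eq_sum B_def rho_def by (simp add: mult.commute)
  have B0: "B z > 0" unfolding B_def by (rule sum_sq_pos[OF zb])
  define s where "s = (1 - r) / (12 * real k)"
  have s: "s > 0" using r k by (simp add: s_def)
  have s1: "s \<le> (1 - r) / 12" unfolding s_def using r k by (intro divide_left_mono) auto
  have "c1 * (real k)\<^sup>2 \<le> c2 * (real k)\<^sup>2" using c(2)[OF zb] c(3)[OF zb] by (rule order_trans)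
  then have "c1 \<le> c2" by (rule mult_right_le_imp_le) (use k in simp)
  then have c2: "c2 / c1 \<ge> 1" using c(1) by (simp add: le_divide_eq)
  have sub: "ball z s \<subseteq> ball 0 1"
  proof
    fix w assume "w \<in> ball z s"
    then have "norm w \<le> norm z + norm (w - z)" "norm (w - z) < s" using norm_triangle_ineq[of z "w - z"] by (auto simp: dist_norm norm_minus_commute)
    then show "w \<in> ball 0 1" using z s1 r by auto
  qed
  have Bw: "B w \<le> 2 * (c2 / c1) * B z" if w: "w \<in> ball z s" for w
  proof -
    have wb: "w \<in> ball 0 1" using sub w by auto
    have rw: "rho w > 0" by (rule rho_pos[OF wb])
    have n: "norm w \<le> norm z + s" using norm_triangle_ineq[of z "w - z"] w by (auto simp: dist_norm norm_minus_commute)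
    have "(norm w)\<^sup>2 \<le> (norm z + s)\<^sup>2" using n by (intro power_mono) auto
    also have "\<dots> = (norm z)\<^sup>2 + s * (2 * norm z + s)" by (simp add: power2_eq_square algebra_simps)
    also have "\<dots> \<le> (norm z)\<^sup>2 + s * 2"
    proof -
      have "norm z \<le> r" using z by simp
      then have "2 * norm z + s \<le> 2" using s1 r by argo
      then show ?thesis using s by (intro add_left_mono mult_left_mono) auto
    qed
    finally have "rho w \<ge> rho z - 2 * s" unfolding rho_def by simp
    also have "2 * s = (1 - r) * (1 / (6 * real k))" using k by (simp add: s_def field_simps)
    also have "rho z - (1 - r) * (1 / (6 * real k)) \<ge> rho z - rho z * (1 / (6 * real k))"
      using rz' by (intro diff_left_mono mult_right_mono) auto
    finally have rr: "rho w \<ge> rho z * (1 - 1 / (6 * real k))" by (simp add: algebra_simps)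
    have q0: "1 - 1 / (6 * real k) \<ge> 0" using k by (simp add: field_simps)
    have "1 + real (3 * k) * (- (1 / (6 * real k))) \<le> (1 + - (1 / (6 * real k))) ^ (3 * k)"
      by (rule Bernoulli_inequality) (use q0 in simp)
    then have "1/2 \<le> (1 - 1 / (6 * real k)) ^ (3 * k)" using k by simp
    then have "rho z ^ (3 * k) * (1/2) \<le> rho z ^ (3 * k) * (1 - 1 / (6 * real k)) ^ (3 * k)"
      using rz by (intro mult_left_mono) auto
    also have "\<dots> \<le> rho w ^ (3 * k)" unfolding power_mult_distrib[symmetric] using rr rz q0 by (intro power_mono) auto
    finally have p: "rho z ^ (3 * k) \<le> 2 * rho w ^ (3 * k)" by simp
    have bw0: "B w \<ge> 0" unfolding B_def by (intro sum_nonneg) auto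
    have "B w * rho z ^ (3 * k) \<le> 2 * (B w * rho w ^ (3 * k))" using mult_left_mono[OF p bw0] by simp
    also have "\<dots> \<le> 2 * (c2 * (real k)\<^sup>2)" using c(3)[OF wb] bn[of w] by simp
    also have "\<dots> = 2 * (c2 / c1) * (c1 * (real k)\<^sup>2)" using c(1) by simp
    also have "\<dots> \<le> 2 * (c2 / c1) * (B z * rho z ^ (3 * k))" using c(2)[OF zb] bn[of z] c2 by (intro mult_left_mono) auto
    finally have "B w * rho z ^ (3 * k) \<le> (2 * (c2 / c1) * B z) * rho z ^ (3 * k)" by (simp add: mult_ac)
    then show ?thesis by (rule mult_right_le_imp_le) (use rz in simp)
  qed
  define D where "D a = (\<Sum>j<d. (cmod (cpartial a (f j) z))\<^sup>2)" for a
  (* 1152 = 4 * 2 * 144: Cauchy's estimate squared, the factor 2 in Bw, and 1 / s^2 = 144 k^2 / (1 - r)^2. *)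
  define K where "K = 1152 * (c2 / c1) / (1 - r)\<^sup>2 * (real k)\<^sup>2"
  have "0 \<le> 1152 * (c2 / c1)" using c2 by linarith
  then have K0: "K \<ge> 0" unfolding K_def by (rule mult_nonneg_nonneg[OF divide_nonneg_nonneg]) simp_all
  have D0: "D a \<ge> 0" for a unfolding D_def by (intro sum_nonneg) auto
  have D: "D a \<le> K * B z" for a
  proof -
    define h where "h w = (\<Sum>j<d. cnj (cpartial a (f j) z) * f j w)" for w
    have hh: "holomorphic2_on h (ball 0 1)" unfolding h_def by (rule holomorphic2_on_lincomb) (rule hol)
    have "has_wirtinger h (\<lambda>b. \<Sum>j<d. cnj (cpartial a (f j) z) * cpartial b (f j) z) (\<lambda>b. 0) z"
    proof -
      have "has_wirtinger (\<lambda>w. cnj (cpartial a (f j) z) * f j w) (\<lambda>b. cnj (cpartial a (f j) z) * cpartial b (f j) z) (\<lambda>b. 0) z" if "j < d" for j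
        by (rule has_wirtinger_eq[OF has_wirtinger_mult[OF has_wirtinger_const has_wirtinger_holomorphic[OF hol[OF that] zb]]]) simp_all
      from has_wirtinger_sum[of d, OF this] show ?thesis unfolding h_def by simp
    qed
    then have "cpartial a h z = (\<Sum>j<d. cnj (cpartial a (f j) z) * cpartial a (f j) z)"
      by (rule trans[OF has_wirtingerD(1)[OF has_wirtinger_holomorphic[OF hh zb], symmetric] has_wirtingerD(1)])
    also have "\<dots> = complex_of_real (D a)" unfolding D_def by (simp add: complex_norm_square[unfolded of_real_power] mult.commute)
    finally have hD: "cmod (cpartial a h z) = D a" using D0 by simp
    have hb: "cmod (h w) \<le> sqrt (D a * (2 * (c2 / c1) * B z))" if w: "w \<in> ball z s" for w
    proof (rule real_le_rsqrt)
      have "(cmod (h w))\<^sup>2 \<le> (\<Sum>j<d. (cmod (cnj (cpartial a (f j) z)))\<^sup>2) * B w"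
        unfolding h_def B_def by (rule cauchy_schwarz_sum)
      also have "\<dots> = D a * B w" by (simp add: D_def)
      also have "\<dots> \<le> D a * (2 * (c2 / c1) * B z)" by (intro mult_left_mono Bw[OF w] D0)
      finally show "(cmod (h w))\<^sup>2 \<le> D a * (2 * (c2 / c1) * B z)" .
    qed
    have nn: "0 \<le> D a * (2 * (c2 / c1) * B z)"
      by (intro mult_nonneg_nonneg) (use D0[of a] c2 B0 in linarith)+
    have "D a \<le> 2 * sqrt (D a * (2 * (c2 / c1) * B z)) / s"
      unfolding hD[symmetric] by (rule cpartial_bound[OF hh sub s]) (use hb hD in simp)
    then have "(D a)\<^sup>2 \<le> (2 * sqrt (D a * (2 * (c2 / c1) * B z)) / s)\<^sup>2" by (intro power_mono D0)
    also have "\<dots> = 4 * (D a * (2 * (c2 / c1) * B z)) / s\<^sup>2"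
      unfolding power_divide power_mult_distrib real_sqrt_pow2[OF nn] by simp
    also have "\<dots> = D a * (K * B z)"
      unfolding K_def s_def using r k c(1) by (simp add: power_divide power_mult_distrib field_simps)
    finally have "D a * D a \<le> D a * (K * B z)" by (simp add: power2_eq_square)
    then show ?thesis using D0[of a] mult_nonneg_nonneg[OF K0 less_imp_le[OF B0]] mult_left_le_imp_le[of "D a" "D a" "K * B z"]
      by (cases "D a = 0") (simp_all only: order.not_eq_order_implies_strict)
  qed
  have sn: "(\<Sum>j<d. f j z * cnj (f j z)) = complex_of_real (B z)" unfolding B_def by (rule sum_norm_complex)
  have cs: "cmod (\<Sum>j<d. u j * cnj (v j)) \<le> sqrt (\<Sum>j<d. (cmod (u j))\<^sup>2) * sqrt (\<Sum>j<d. (cmod (v j))\<^sup>2)" for u v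
    unfolding real_sqrt_mult[symmetric] using cauchy_schwarz_sum[of u "\<lambda>j. cnj (v j)" d] by (intro real_le_rsqrt) simp
  have sD: "sqrt (D a) \<le> sqrt (K * B z)" for a using D by simp
  have KB: "sqrt (K * B z) * sqrt (K * B z) = K * B z" using K0 B0 by simp
  have t1: "cmod ((\<Sum>j<d. cpartial a (f j) z * cnj (cpartial b (f j) z)) / complex_of_real (B z)) \<le> K"
  proof -
    have "cmod (\<Sum>j<d. cpartial a (f j) z * cnj (cpartial b (f j) z)) \<le> sqrt (D a) * sqrt (D b)" using cs unfolding D_def .
    also have "\<dots> \<le> sqrt (K * B z) * sqrt (K * B z)" using sD D0 K0 B0 by (intro mult_mono) auto
    finally show ?thesis unfolding KB using B0 by (simp add: norm_divide pos_divide_le_eq)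
  qed
  have t2: "cmod ((\<Sum>j<d. f j z * cnj (cpartial b (f j) z)) * (\<Sum>j<d. cpartial a (f j) z * cnj (f j z)) / (complex_of_real (B z))\<^sup>2) \<le> K"
  proof -
    have 1: "cmod (\<Sum>j<d. f j z * cnj (cpartial b (f j) z)) \<le> sqrt (B z) * sqrt (D b)" using cs unfolding D_def B_def .
    have 2: "cmod (\<Sum>j<d. cpartial a (f j) z * cnj (f j z)) \<le> sqrt (D a) * sqrt (B z)" using cs unfolding D_def B_def .
    have "cmod ((\<Sum>j<d. f j z * cnj (cpartial b (f j) z)) * (\<Sum>j<d. cpartial a (f j) z * cnj (f j z))) \<le> (sqrt (B z) * sqrt (D b)) * (sqrt (D a) * sqrt (B z))"
      unfolding norm_mult using 1 2 D0 B0 by (intro mult_mono) auto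
    also have "\<dots> = B z * (sqrt (D b) * sqrt (D a))" using B0 by simp
    also have "\<dots> \<le> B z * (sqrt (K * B z) * sqrt (K * B z))" using sD D0 K0 B0 by (intro mult_left_mono mult_mono) auto
    finally show ?thesis unfolding KB using B0 by (simp add: norm_divide norm_mult pos_divide_le_eq power2_eq_square mult_ac)
  qed
  have t3: "cmod (- of_nat (3 * k) * ((if a = b then 1 else 0) / of_real (rho z) + cnj (z $ a) * z $ b / (of_real (rho z))\<^sup>2)) \<le> 6 / (1 - r)\<^sup>2 * (real k)\<^sup>2"
  proof -
    have i1: "1 / rho z \<le> 1 / (1 - r)" using rz' r by (intro divide_left_mono) auto
    have i2: "1 / (1 - r) \<le> 1 / (1 - r)\<^sup>2" using r by (intro divide_left_mono) (auto simp: power2_eq_square mult_left_le)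
    have "(1 - r)\<^sup>2 \<le> (rho z)\<^sup>2" using rz' r by (intro power_mono) auto
    then have i3: "1 / (rho z)\<^sup>2 \<le> 1 / (1 - r)\<^sup>2" using r rz by (intro divide_left_mono) auto
    have zz: "cmod (z $ a) * cmod (z $ b) \<le> 1"
      using zb Finite_Cartesian_Product.norm_nth_le[of z a] Finite_Cartesian_Product.norm_nth_le[of z b] by (intro mult_le_one) auto
    have "cmod ((if a = b then 1 else 0) / of_real (rho z) + cnj (z $ a) * z $ b / (of_real (rho z))\<^sup>2) \<le> 1 / rho z + cmod (z $ a) * cmod (z $ b) / (rho z)\<^sup>2"
      using rz by (intro norm_triangle_le add_mono) (auto simp: norm_divide norm_mult norm_power)
    also have "\<dots> \<le> 1 / rho z + 1 / (rho z)\<^sup>2" using zz by (intro add_left_mono divide_right_mono) auto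
    also have "\<dots> \<le> 2 / (1 - r)\<^sup>2" using i1 i2 i3 by simp
    finally have "3 * real k * cmod ((if a = b then 1 else 0) / of_real (rho z) + cnj (z $ a) * z $ b / (of_real (rho z))\<^sup>2) \<le> 3 * real k * (2 / (1 - r)\<^sup>2)"
      by (intro mult_left_mono) auto
    also have "\<dots> = 6 / (1 - r)\<^sup>2 * real k" by simp
    also have "\<dots> \<le> 6 / (1 - r)\<^sup>2 * (real k)\<^sup>2"
      using k by (intro mult_left_mono) (auto simp: power2_eq_square)
    finally show ?thesis by (simp add: norm_mult)
  qed
  have "cmod (hess a b z) \<le> 6 / (1 - r)\<^sup>2 * (real k)\<^sup>2 + (K + K)"
    unfolding pot_hess_def sn
    by (intro norm_triangle_le add_mono t3 order_trans[OF norm_triangle_ineq4] t1 t2)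
  also have "\<dots> = (6 / (1 - r)\<^sup>2 + 2304 * (c2 / c1) / (1 - r)\<^sup>2) * (real k)\<^sup>2"
    unfolding K_def by (simp add: algebra_simps)
  finally show ?thesis .
qed

end

section \<open>The volume comparison\<close>

theorem theorem2:
  fixes \<Gamma> :: "(complex^3^3) set"
  assumes "subgroup \<Gamma> SU21"
    and "discrete \<Gamma>"
    and "torsion_free \<Gamma>"
    and "cocompact \<Gamma>"
  shows "\<exists>k0::nat. \<forall>\<epsilon>::real. \<epsilon> > 0 \<longrightarrow> (\<exists>c::real. c > 0 \<and> (\<forall>k\<ge>k0. \<forall>F d f.
    fundamental_domain \<Gamma> F \<longrightarrow> orthonormal_basis \<Gamma> F k d f \<longrightarrow>
      (SUP z\<in>ball 0 1. ereal (cmod (form_ratio (bergman_vol k d f z) (hyp_vol z))))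
        \<le> ereal (c * real k powr (4 + \<epsilon>))))"
proof -
  interpret cocompact_lattice \<Gamma> by (rule cocompact_lattice.intro) (rule assms)+
  obtain r where r: "covers r" using covers_exists by blast
  have r': "0 < r" "r < 1" using r by (auto simp: covers_def)
  obtain k0 c1 c2 where c: "c1 > 0" "c2 > 0" "k0 \<ge> 1" and
    b: "\<And>k F d f z. k \<ge> k0 \<Longrightarrow> fundamental_domain \<Gamma> F \<Longrightarrow> orthonormal_basis \<Gamma> F k d f \<Longrightarrow> z \<in> ball 0 1 \<Longrightarrow>
       c1 * (real k)\<^sup>2 \<le> bergman_norm k d f z \<and> bergman_norm k d f z \<le> c2 * (real k)\<^sup>2"
    using bergman_bounds[OF r] by metis
  define M where "M = 6 / (1 - r)\<^sup>2 + 2304 * (c2 / c1) / (1 - r)\<^sup>2"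
  have M: "M > 0" unfolding M_def using r' c by (intro add_pos_pos divide_pos_pos mult_pos_pos) auto
  have main: "cmod (form_ratio (bergman_vol k d f z) (hyp_vol z)) \<le> 2 * M\<^sup>2 * real k powr (4 + \<epsilon>)"
    if \<epsilon>: "\<epsilon> > 0" and k: "k \<ge> k0" and fd: "fundamental_domain \<Gamma> F" and onb: "orthonormal_basis \<Gamma> F k d f" and z: "z \<in> ball 0 1"
    for \<epsilon> k F d f z
  proof -
    have k1: "k \<ge> 1" using k c(3) by simp
    have faut: "\<And>j. j < d \<Longrightarrow> f j \<in> aut_forms (3 * k) \<Gamma>" using onb unfolding orthonormal_basis_def by auto
    then have hol: "\<And>j. j < d \<Longrightarrow> holomorphic2_on (f j) (ball 0 1)" by (rule aut_forms_holomorphic)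
    have bk: "\<And>w. w \<in> ball 0 1 \<Longrightarrow> c1 * (real k)\<^sup>2 \<le> bergman_norm k d f w" "\<And>w. w \<in> ball 0 1 \<Longrightarrow> bergman_norm k d f w \<le> c2 * (real k)\<^sup>2"
      using b[OF k fd onb] by auto
    have "c1 * (real k)\<^sup>2 > 0" using c(1) k1 by simp
    then have pos: "\<And>w. w \<in> ball 0 1 \<Longrightarrow> bergman_norm k d f w > 0" using bk(1) by (rule less_le_trans)
    obtain \<gamma> where g: "\<gamma> \<in> \<Gamma>" "act \<gamma> z \<in> cball 0 r" using r z unfolding covers_def by blast
    define w where "w = act \<gamma> z"
    have w: "w \<in> cball 0 r" "w \<in> ball 0 1" using g(2) r' by (auto simp: w_def)
    let ?G = "\<lambda>a b. pot_hess (3 * k) d f a b w"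
    have Gb: "cmod (?G a b) \<le> M * (real k)\<^sup>2" for a b
      unfolding M_def by (rule pot_hess_bound[OF hol pos r' w(1) k1 c(1) bk])
    have M2: "M * (real k)\<^sup>2 \<ge> 0" using M by simp
    have "cmod (form_ratio (bergman_vol k d f z) (hyp_vol z)) = cmod (form_ratio (bergman_vol k d f w) (hyp_vol w))"
      unfolding w_def by (rule form_ratio_invariant[OF hol pos in_SU21[OF g(1)] z bergman_norm_invariant[OF faut g(1)]])
    also have "\<dots> = rho w ^ 3 / pi\<^sup>2 * cmod (?G 1 1 * ?G 2 2 - ?G 1 2 * ?G 2 1)"
    proof -
      have "form_ratio (bergman_vol k d f w) (hyp_vol w) = of_real (rho w ^ 3 / pi\<^sup>2) * (?G 1 1 * ?G 2 2 - ?G 1 2 * ?G 2 1)"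
        by (rule form_ratio_bergman[OF hol pos w(2)])
      then show ?thesis using rho_pos[OF w(2)] by (simp add: norm_mult norm_divide norm_power)
    qed
    also have "\<dots> \<le> 1 * (2 * (M * (real k)\<^sup>2)\<^sup>2)"
    proof (intro mult_mono)
      have "1 \<le> pi\<^sup>2" using pi_ge_two by (simp add: one_le_power)
      moreover have "rho w ^ 3 \<le> 1" using rho_pos[OF w(2)] rho_le_1[of w] by (simp add: power_le_one)
      ultimately show "rho w ^ 3 / pi\<^sup>2 \<le> 1" by (simp add: divide_le_eq)
      have "cmod (?G a b * ?G a' b') \<le> (M * (real k)\<^sup>2)\<^sup>2" for a b a' b'
        unfolding norm_mult power2_eq_square[of "M * _"] using Gb M2 by (intro mult_mono) auto
      then show "cmod (?G 1 1 * ?G 2 2 - ?G 1 2 * ?G 2 1) \<le> 2 * (M * (real k)\<^sup>2)\<^sup>2"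
        using norm_triangle_ineq4[of "?G 1 1 * ?G 2 2" "?G 1 2 * ?G 2 1"] by (smt (verit))
    qed auto
    also have "\<dots> = 2 * M\<^sup>2 * real k powr 4"
      using k1 by (simp add: power_mult_distrib powr_numeral flip: power_mult)
    also have "\<dots> \<le> 2 * M\<^sup>2 * real k powr (4 + \<epsilon>)"
      using k1 \<epsilon> by (intro mult_left_mono powr_mono) auto
    finally show ?thesis .
  qed
  show ?thesis
  proof (intro exI[of _ k0] allI impI exI[of _ "2 * M\<^sup>2"] conjI)
    show "2 * M\<^sup>2 > 0" using M by simp
  qed (auto intro!: SUP_least main)
qed

end
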